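(* Let $\mathbf{u}_h=\tfrac12\nabla^\perp h\in W^{3,2}_{\mathrm{div}}(\mathbb{T}^2;\mathbb{R}^2)$, $f\in W^{2,2}(\mathbb{T}^2)$ and $(b_0,\omega_0)\in\mathcal{M}=W^{3,2}(\mathbb{T}^2)\times W^{2,2}(\mathbb{T}^2)$. Then there exist $T>0$ and a pair $(b,\omega)$ such that $(b,\omega,T)$ is a local strong solution of the thermal quasi-geostrophic (TQG) system with data $\mathbf{u}_h$, $f$ and initial condition $(b_0,\omega_0)$.
   Context: $\mathbb{T}^2$ is the two-dimensional flat torus, $\nabla^\perp=(-\partial_y,\partial_x)$, $W^{k,2}(\mathbb{T}^2)$ are the usual $L^2$-based Sobolev spaces with norm $\|\cdot\|_{k,2}$, and $W^{k,2}_{\mathrm{div}}(\mathbb{T}^2;\mathbb{R}^2)$ is the space of weakly divergence-free vector fields in $W^{k,2}$. $\mathcal{M}=W^{3,2}(\mathbb{T}^2)\times W^{2,2}(\mathbb{T}^2)$ has norm $\|(b,\omega)\|_{\mathcal{M}}=\|b\|_{3,2}+\|\omega\|_{2,2}$. Standing assumption: all functions under consideration have zero average over $\mathbb{T}^2$. The TQG system for $(b,\omega)$ is $$\partial_t b+\mathbf{u}\cdot\nabla b=0,\qquad \partial_t\omega+\mathbf{u}\cdot\nabla(\omega-b)=-\mathbf{u}_h\cdot\nabla b,$$ $$\mathbf{u}=\nabla^\perp\psi,\qquad \mathbf{u}_h=\tfrac12\nabla^\perp h,\qquad \omega=(\Delta-1)\psi+f,$$ where $h$ and $f$ are given time-independent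 functions. Local strong solution: given $T>0$, $(b,\omega,T)$ is a local strong solution with initial condition $(b_0,\omega_0)$ if $b\in C([0,T];W^{3,2}(\mathbb{T}^2))$, $\omega\in C([0,T];W^{2,2}(\mathbb{T}^2))$, and for all $t\in[0,T]$ $$b(t)=b_0-\int_0^t\mathrm{div}(b\mathbf{u})\,d\tau,\qquad \omega(t)=\omega_0-\int_0^t\big[\mathrm{div}((\omega-b)\mathbf{u})+\mathrm{div}(b\mathbf{u}_h)\big]\,d\tau,$$ with $\mathbf{u}=\nabla^\perp(\Delta-1)^{-1}(\omega-f)$. *)

theory Defs
  imports "HOL-Analysis.Analysis"
begin

section \<open>The Hilbert space of square-integrable functions on the flat torus\<close>

text \<open>
  The torus is \<open>\<real>\<^sup>2 / \<int>\<^sup>2\<close>.  Integrals over it are integrals over the closed unit cell, whose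
  boundary is a null set.  Elements of \<open>torus_L2\<close> are equivalence classes modulo equality almost
  everywhere (every Lebesgue measurable class contains a Borel function).
\<close>

definition torus :: "(real \<times> real) measure" where
  "torus = restrict_space lborel ({0..1} \<times> {0..1})"

definition square_integrable :: "(real \<times> real \<Rightarrow> real) \<Rightarrow> bool" where
  "square_integrable f \<longleftrightarrow> f \<in> borel_measurable torus \<and> integrable torus (\<lambda>p. (f p)\<^sup>2)"

lemma square_integrable_mult:
  assumes "square_integrable f" "square_integrable g"
  shows "integrable torus (\<lambda>p. f p * g p)"
proof (rule Bochner_Integration.integrable_bound)
  show "integrable torus (\<lambda>p. (f p)\<^sup>2 + (g p)\<^sup>2)"
    using assms by (simp add: square_integrable_def)
  show "(\<lambda>p. f p * g p) \<in> borel_measurable torus"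
    using assms by (auto simp: square_integrable_def intro: borel_measurable_times)
  have "\<bar>a * b\<bar> \<le> a\<^sup>2 + b\<^sup>2" for a b :: real
  proof -
    have "2 * (\<bar>a\<bar> * \<bar>b\<bar>) \<le> a\<^sup>2 + b\<^sup>2"
      using sum_squares_bound[of "\<bar>a\<bar>" "\<bar>b\<bar>"] by (simp add: mult.assoc)
    moreover have "0 \<le> \<bar>a\<bar> * \<bar>b\<bar>" by simp
    ultimately show ?thesis by (simp only: abs_mult)
  qed
  then show "AE p in torus. norm (f p * g p) \<le> norm ((f p)\<^sup>2 + (g p)\<^sup>2)"
    by simp
qed

lemma square_integrable_zero: "square_integrable (\<lambda>_. 0)"
  by (simp add: square_integrable_def)

lemma square_integrable_scale:
  "square_integrable f \<Longrightarrow> square_integrable (\<lambda>p. c * f p)"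
  by (auto simp: square_integrable_def power_mult_distrib
      intro: borel_measurable_times borel_measurable_const)

lemma square_integrable_add:
  assumes "square_integrable f" "square_integrable g"
  shows "square_integrable (\<lambda>p. f p + g p)"
proof -
  have "integrable torus (\<lambda>p. (f p)\<^sup>2 + (g p)\<^sup>2 + 2 * (f p * g p))"
    using assms square_integrable_mult[OF assms] by (simp add: square_integrable_def)
  then show ?thesis
    using assms by (auto simp: square_integrable_def power2_sum mult.assoc
        intro: borel_measurable_add)
qed

quotient_type torus_L2 = "real \<times> real \<Rightarrow> real" / partial:
  "\<lambda>f g. square_integrable f \<and> square_integrable g \<and> (AE p in torus. f p = g p)"
proof (rule part_equivpI)
  show "\<exists>f. square_integrable f \<and> square_integrable f \<and> (AE p in torus. f p = f p)"
    using square_integrable_zero by auto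
  show "symp (\<lambda>f g. square_integrable f \<and> square_integrable g \<and> (AE p in torus. f p = g p))"
    by (auto simp: symp_def eq_commute)
  show "transp (\<lambda>f g. square_integrable f \<and> square_integrable g \<and> (AE p in torus. f p = g p))"
    by (auto simp: transp_def elim: AE_mp)
qed

instantiation torus_L2 :: real_inner
begin

lift_definition zero_torus_L2 :: torus_L2 is "\<lambda>_. 0"
  by (simp add: square_integrable_zero)

lift_definition plus_torus_L2 :: "torus_L2 \<Rightarrow> torus_L2 \<Rightarrow> torus_L2" is "\<lambda>f g p. f p + g p"
  by (auto simp: square_integrable_add)

lift_definition scaleR_torus_L2 :: "real \<Rightarrow> torus_L2 \<Rightarrow> torus_L2" is "\<lambda>c f p. c * f p"
  by (auto simp: square_integrable_scale)

lift_definition uminus_torus_L2 :: "torus_L2 \<Rightarrow> torus_L2" is "\<lambda>f p. - f p"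
  using square_integrable_scale[of _ "-1"] by auto

lift_definition minus_torus_L2 :: "torus_L2 \<Rightarrow> torus_L2 \<Rightarrow> torus_L2" is "\<lambda>f g p. f p - g p"
  using square_integrable_add[OF _ square_integrable_scale[of _ "-1"]] by auto

lift_definition inner_torus_L2 :: "torus_L2 \<Rightarrow> torus_L2 \<Rightarrow> real" is
  "\<lambda>f g. \<integral>p. f p * g p \<partial>torus"
  by (rule integral_cong_AE) (auto simp: square_integrable_def)

definition norm_torus_L2 :: "torus_L2 \<Rightarrow> real" where
  "norm_torus_L2 f = sqrt (f \<bullet> f)"

definition dist_torus_L2 :: "torus_L2 \<Rightarrow> torus_L2 \<Rightarrow> real" where
  "dist_torus_L2 f g = norm (f - g)"

definition sgn_torus_L2 :: "torus_L2 \<Rightarrow> torus_L2" where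
  "sgn_torus_L2 f = inverse (norm f) *\<^sub>R f"

definition uniformity_torus_L2 :: "(torus_L2 \<times> torus_L2) filter" where
  "uniformity_torus_L2 = (INF e\<in>{0<..}. principal {(x, y). dist x y < e})"

definition open_torus_L2 :: "torus_L2 set \<Rightarrow> bool" where
  "open_torus_L2 U \<longleftrightarrow> (\<forall>x\<in>U. eventually (\<lambda>(x', y). x' = x \<longrightarrow> y \<in> U) uniformity)"

instance
proof
  fix a b c :: torus_L2 and r s :: real
  show "a + b + c = a + (b + c)"
    by transfer (auto simp: square_integrable_add add.assoc)
  show "a + b = b + a"
    by transfer (auto simp: square_integrable_add add.commute)
  show "0 + a = a"
    by transfer auto
  show "- a + a = 0"
    by transfer (auto simp: square_integrable_zero)
  show "a - b = a + - b"
    by transfer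
      (auto simp: square_integrable_add square_integrable_scale[of _ "-1", simplified]
        dest: square_integrable_add[OF _ square_integrable_scale[of _ "-1", simplified]])
  show "r *\<^sub>R (a + b) = r *\<^sub>R a + r *\<^sub>R b"
    by transfer (auto simp: square_integrable_add square_integrable_scale algebra_simps
        dest: square_integrable_add intro!: square_integrable_add)
  show "(r + s) *\<^sub>R a = r *\<^sub>R a + s *\<^sub>R a"
    by transfer (auto simp: algebra_simps intro!: square_integrable_add square_integrable_scale)
  show "r *\<^sub>R s *\<^sub>R a = (r * s) *\<^sub>R a"
    by transfer (auto simp: mult.assoc intro!: square_integrable_scale)
  show "1 *\<^sub>R a = a"
    by transfer auto
  show "a \<bullet> b = b \<bullet> a"
    by transfer (simp add: mult.commute)
  show "(a + b) \<bullet> c = a \<bullet> c + b \<bullet> c"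
    by transfer (simp add: distrib_right square_integrable_mult)
  show "(r *\<^sub>R a) \<bullet> b = r * (a \<bullet> b)"
    by transfer (simp add: mult.assoc)
  show "0 \<le> a \<bullet> a"
    by transfer simp
  show "a \<bullet> a = 0 \<longleftrightarrow> a = 0"
    by transfer
      (auto simp: square_integrable_zero square_integrable_mult integral_nonneg_eq_0_iff_AE)
  show "norm a = sqrt (a \<bullet> a)"
    by (fact norm_torus_L2_def)
  show "dist a b = norm (a - b)"
    by (fact dist_torus_L2_def)
  show "sgn a = inverse (norm a) *\<^sub>R a"
    by (fact sgn_torus_L2_def)
  show "(uniformity :: (torus_L2 \<times> torus_L2) filter)
      = (INF e\<in>{0<..}. principal {(x, y). dist x y < e})"
    by (fact uniformity_torus_L2_def)
next
  fix U :: "torus_L2 set"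
  show "open U \<longleftrightarrow> (\<forall>x\<in>U. \<forall>\<^sub>F (x', y) in uniformity. x' = x \<longrightarrow> y \<in> U)"
    by (fact open_torus_L2_def)
qed

end

text \<open>
  Some representative of a class, and of a pair of classes viewed as a vector field.  They are only
  used under integrals over the torus, where the choice of the representative is irrelevant.
\<close>

abbreviation val :: "torus_L2 \<Rightarrow> real \<times> real \<Rightarrow> real" where
  "val \<equiv> rep_torus_L2"

definition vval :: "torus_L2 \<times> torus_L2 \<Rightarrow> real \<times> real \<Rightarrow> real \<times> real" where
  "vval u p = (val (fst u) p, val (snd u) p)"

definition mean_zero :: "torus_L2 set" where
  "mean_zero = {f. (\<integral>p. val f p \<partial>torus) = 0}"


section \<open>Test functions\<close>

definition pdx :: "(real \<times> real \<Rightarrow> real) \<Rightarrow> real \<times> real \<Rightarrow> real" where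
  "pdx \<phi> = (\<lambda>(x, y). deriv (\<lambda>s. \<phi> (s, y)) x)"

definition pdy :: "(real \<times> real \<Rightarrow> real) \<Rightarrow> real \<times> real \<Rightarrow> real" where
  "pdy \<phi> = (\<lambda>(x, y). deriv (\<lambda>s. \<phi> (x, s)) y)"

text \<open>
  Being coinductive, \<open>smooth\<close> says that all iterated partial derivatives exist and are
  (Frechet) differentiable on the whole plane, i.e. it is the class \<open>C\<^sup>\<infinity>(\<real>\<^sup>2)\<close>.
\<close>

coinductive smooth :: "(real \<times> real \<Rightarrow> real) \<Rightarrow> bool" where
  "\<lbrakk>\<And>p. \<phi> differentiable (at p); smooth (pdx \<phi>); smooth (pdy \<phi>)\<rbrakk> \<Longrightarrow> smooth \<phi>"

definition test_functions :: "(real \<times> real \<Rightarrow> real) set" where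
  "test_functions =
     {\<phi>. smooth \<phi> \<and> (\<forall>x y. \<phi> (x + 1, y) = \<phi> (x, y) \<and> \<phi> (x, y + 1) = \<phi> (x, y))}"


section \<open>Weak derivatives and Sobolev spaces\<close>

text \<open>
  Weak derivatives and weak divergences are unique when they exist, because smooth periodic functions
  are dense in \<open>torus_L2\<close>; the descriptions below are applied only where they exist.  In the system
  this is so because \<open>W\<^bsup>3,2\<^esup>\<close> and \<open>W\<^bsup>2,2\<^esup>\<close> are algebras in two dimensions.
\<close>

definition has_weak_deriv :: "nat \<Rightarrow> nat \<Rightarrow> torus_L2 \<Rightarrow> torus_L2 \<Rightarrow> bool" where
  "has_weak_deriv i j f g \<longleftrightarrow>
     (\<forall>\<phi>\<in>test_functions.
        (\<integral>p. val f p * (pdx ^^ i) ((pdy ^^ j) \<phi>) p \<partial>torus)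
          = (-1) ^ (i + j) * (\<integral>p. val g p * \<phi> p \<partial>torus))"

definition weak_deriv :: "nat \<Rightarrow> nat \<Rightarrow> torus_L2 \<Rightarrow> torus_L2" where
  "weak_deriv i j f = (THE g. has_weak_deriv i j f g)"

text \<open>\<open>sobolev k\<close> is the space \<open>W\<^bsup>k,2\<^esup>\<close> of scalar functions on the torus.\<close>

definition sobolev :: "nat \<Rightarrow> torus_L2 set" where
  "sobolev k = {f. \<forall>i j. i + j \<le> k \<longrightarrow> (\<exists>g. has_weak_deriv i j f g)}"

definition sobolev_norm :: "nat \<Rightarrow> torus_L2 \<Rightarrow> real" where
  "sobolev_norm k f = sqrt (\<Sum>(i, j) | i + j \<le> k. (norm (weak_deriv i j f))\<^sup>2)"

text \<open>
  The weak divergence is defined for integrable vector fields, since the product of two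
  square-integrable functions need not be square-integrable.
\<close>

definition has_weak_div :: "(real \<times> real \<Rightarrow> real \<times> real) \<Rightarrow> torus_L2 \<Rightarrow> bool" where
  "has_weak_div F g \<longleftrightarrow> integrable torus F \<and>
     (\<forall>\<phi>\<in>test_functions.
        (\<integral>p. F p \<bullet> (pdx \<phi> p, pdy \<phi> p) \<partial>torus) = - (\<integral>p. val g p * \<phi> p \<partial>torus))"

definition weak_div :: "(real \<times> real \<Rightarrow> real \<times> real) \<Rightarrow> torus_L2" where
  "weak_div F = (THE g. has_weak_div F g)"

definition sobolev_div :: "nat \<Rightarrow> (torus_L2 \<times> torus_L2) set" where
  "sobolev_div k = {u. u \<in> sobolev k \<times> sobolev k \<and> has_weak_div (vval u) 0}"

definition perp_grad :: "torus_L2 \<Rightarrow> torus_L2 \<times> torus_L2" where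
  "perp_grad \<psi> = (- weak_deriv 0 1 \<psi>, weak_deriv 1 0 \<psi>)"

definition laplacian :: "torus_L2 \<Rightarrow> torus_L2" where
  "laplacian \<psi> = weak_deriv 2 0 \<psi> + weak_deriv 0 2 \<psi>"


section \<open>The thermal quasi-geostrophic system\<close>

text \<open>
  The operator \<open>(\<Delta> - 1)\<^sup>-\<^sup>1\<close>, a bijection from square-integrable functions onto \<open>W\<^bsup>2,2\<^esup>\<close>.
\<close>

definition inv_helmholtz :: "torus_L2 \<Rightarrow> torus_L2" where
  "inv_helmholtz g = (THE \<psi>. \<psi> \<in> sobolev 2 \<and> laplacian \<psi> - \<psi> = g)"

definition velocity :: "torus_L2 \<Rightarrow> torus_L2 \<Rightarrow> torus_L2 \<times> torus_L2" where
  "velocity f \<omega> = perp_grad (inv_helmholtz (\<omega> - f))"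

definition flux :: "torus_L2 \<Rightarrow> torus_L2 \<times> torus_L2 \<Rightarrow> real \<times> real \<Rightarrow> real \<times> real" where
  "flux a u p = val a p *\<^sub>R vval u p"

definition state_space :: "(torus_L2 \<times> torus_L2) set" where
  "state_space = sobolev 3 \<times> sobolev 2"

text \<open>Membership in \<open>C([0,T]; W\<^bsup>k,2\<^esup>)\<close>; the values of \<open>v\<close> outside \<open>[0,T]\<close> play no role.\<close>

definition continuous_into_sobolev :: "nat \<Rightarrow> real \<Rightarrow> (real \<Rightarrow> torus_L2) \<Rightarrow> bool" where
  "continuous_into_sobolev k T v \<longleftrightarrow>
     (\<forall>t\<in>{0..T}. v t \<in> sobolev k \<and>
        ((\<lambda>s. sobolev_norm k (v s - v t)) \<longlongrightarrow> 0) (at t within {0..T}))"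

text \<open>
  The time integrals are integrals of functions with values in the Hilbert space \<open>torus_L2\<close>.  The
  integrands are continuous in time, so the gauge integral is the Riemann and Bochner integral.
  That all functions have zero average is a convention for the whole system.
\<close>

definition local_strong_solution ::
  "torus_L2 \<times> torus_L2 \<Rightarrow> torus_L2 \<Rightarrow> torus_L2 \<Rightarrow> torus_L2
    \<Rightarrow> (real \<Rightarrow> torus_L2) \<Rightarrow> (real \<Rightarrow> torus_L2) \<Rightarrow> real \<Rightarrow> bool" where
  "local_strong_solution u\<^sub>h f b\<^sub>0 \<omega>\<^sub>0 b \<omega> T \<longleftrightarrow>
     T > 0 \<and>
     continuous_into_sobolev 3 T b \<and>
     continuous_into_sobolev 2 T \<omega> \<and>
     (\<forall>t\<in>{0..T}. b t \<in> mean_zero \<and> \<omega> t \<in> mean_zero) \<and>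
     (\<forall>t\<in>{0..T}.
        ((\<lambda>\<tau>. weak_div (flux (b \<tau>) (velocity f (\<omega> \<tau>))))
           has_integral (b\<^sub>0 - b t)) {0..t} \<and>
        ((\<lambda>\<tau>. weak_div (flux (\<omega> \<tau> - b \<tau>) (velocity f (\<omega> \<tau>)))
              + weak_div (flux (b \<tau>) u\<^sub>h))
           has_integral (\<omega>\<^sub>0 - \<omega> t)) {0..t})"

end

theory Submission
  imports Defs "HOL-Complex_Analysis.Great_Picard"
begin

text \<open>
  Everything is done on Fourier coefficients over \<open>\<int>\<^sup>2\<close>.  With stream functions \<open>\<psi> = (\<Delta> - 1)\<^sup>-\<^sup>1 (\<omega> - f)\<close>
  and \<open>\<xi> = h / 2\<close> the system reads \<open>b' = J(\<psi>, b)\<close>, \<open>\<omega>' = J(\<psi>, \<omega> - b) + J(\<xi>, b)\<close>, where \<open>J\<close> is minus the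
  Jacobian determinant, a convolution with the antisymmetric kernel \<open>k \<times> l\<close>.  Antisymmetry makes the
  transport terms commutators, which are bounded by Young's inequality for sequences because
  \<open>|k|\<^sup>-\<^sup>4\<close> is summable over the lattice.

  The energy estimate is proved for the weights \<open>|k|\<^sup>s |k| / (N + |k|)\<close>, uniformly in \<open>N\<close>, and is linear in
  the weighted norms.  \<open>N = 0\<close> gives the a priori bound on a short time interval.  As \<open>N\<close> grows the weighted
  norms of the data tend to zero, hence so do the tails of the approximations, uniformly in time.
  Explicit Euler steps for the Galerkin system, with steps so small that the quadratic error is
  negligible, therefore converge along a subsequence coefficientwise and then strongly; the uniform tails also
  give continuity in time with values in \<open>W\<^bsup>3,2\<^esup> \<times> W\<^bsup>2,2\<^esup>\<close> without a uniqueness argument.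
\<close>

section \<open>Square-summable families on the frequency lattice\<close>

text \<open>Zero average removes the frequency 0, so |k| \<ge> 1 on all occupied modes and
  homogeneous weights are norms. The derivative count is tight: b at order 3 and \<omega> at order 2
  put \<psi> at order 4, so two derivatives of \<psi> have summable coefficients, which is what a
  commutator consumes. J(\<psi>, b) in the \<omega> equation is no commutator; the extra order of b
  pays for it. Norm bounds and coefficientwise limits alone give only weak continuity in time. A
  sharp frequency cutoff would detect small tails, but it jumps, and its commutators are not
  controlled; |k| / (N + |k|) has relative slope at most 1 for every N and behaves like a pure
  power. Linearity in the weighted norms is what closes a Gronwall argument with vanishing data. The
  theorem speaks of weak derivatives, weak divergences and definite descriptions. These become
  identities of coefficients once the trigonometric system is known to be complete, and complete
  even for integrable functions, since products of two L2 functions occur.\<close>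

type_synonym freq = "int \<times> int"

definition l2 :: "('a \<Rightarrow> real) \<Rightarrow> bool" where
  "l2 a \<longleftrightarrow> (\<lambda>k. (a k)\<^sup>2) summable_on UNIV"

definition n2 :: "('a \<Rightarrow> real) \<Rightarrow> real" where
  "n2 a = sqrt (\<Sum>\<^sub>\<infinity>k. (a k)\<^sup>2)"

lemma n2_nonneg [simp]: "0 \<le> n2 a"
  by (simp add: n2_def infsum_nonneg)

lemma n2_sq: "(n2 a)\<^sup>2 = (\<Sum>\<^sub>\<infinity>k. (a k)\<^sup>2)"
  by (simp add: n2_def infsum_nonneg)

lemma sum_le_n2:
  assumes "l2 a" "finite A" shows "(\<Sum>k\<in>A. (a k)\<^sup>2) \<le> (n2 a)\<^sup>2"
  unfolding n2_sq using assms by (intro finite_sum_le_infsum) (auto simp: l2_def)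

lemma L2_set_le_n2:
  assumes "l2 a" "finite A" shows "L2_set a A \<le> n2 a"
  unfolding L2_set_def using sum_le_n2[OF assms] by (simp add: real_le_lsqrt sum_nonneg)

text \<open>Bounds on finite partial norms suffice, so finite inequalities such as Minkowski's pass
  to the whole lattice; many memberships in \<open>l2\<close> below are proved this way.\<close>

lemma l2I:
  assumes "\<And>A. finite A \<Longrightarrow> L2_set a A \<le> M"
  shows "l2 a" "n2 a \<le> M"
proof -
  have M: "0 \<le> M" using assms[of "{}"] by simp
  have b: "(\<Sum>k\<in>A. (a k)\<^sup>2) \<le> M\<^sup>2" if "finite A" for A
    using assms[OF that] unfolding L2_set_def by (rule sqrt_le_D)
  show l: "l2 a" unfolding l2_def
    by (rule nonneg_bdd_above_summable_on) (use b in \<open>auto simp: bdd_above_def\<close>)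
  have "(\<Sum>\<^sub>\<infinity>k. (a k)\<^sup>2) \<le> M\<^sup>2"
    by (rule infsum_le_finite_sums) (use l b in \<open>auto simp: l2_def\<close>)
  then show "n2 a \<le> M" unfolding n2_def using M by (simp add: real_le_lsqrt)
qed

lemma abs_le_n2: "l2 a \<Longrightarrow> \<bar>a k\<bar> \<le> n2 a"
  using L2_set_le_n2[of a "{k}"] by simp

lemma L2_set_mono_abs: "(\<And>k. \<bar>a k\<bar> \<le> \<bar>b k\<bar>) \<Longrightarrow> L2_set a A \<le> L2_set b A"
  unfolding L2_set_def by (intro real_sqrt_le_mono sum_mono) (metis abs_le_square_iff)

lemma l2_mono:
  assumes "l2 b" "\<And>k. \<bar>a k\<bar> \<le> \<bar>b k\<bar>"
  shows "l2 a" "n2 a \<le> n2 b"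
  using l2I[of a "n2 b"] L2_set_mono_abs[of a b] L2_set_le_n2[OF assms(1)] assms(2)
  by (meson order_trans)+

lemma l2_add:
  assumes "l2 a" "l2 b"
  shows "l2 (\<lambda>k. a k + b k)" "n2 (\<lambda>k. a k + b k) \<le> n2 a + n2 b"
proof -
  have "L2_set (\<lambda>k. a k + b k) A \<le> n2 a + n2 b" if "finite A" for A
    using L2_set_triangle_ineq[of a b A] L2_set_le_n2[OF assms(1) that] L2_set_le_n2[OF assms(2) that]
    by linarith
  from l2I[OF this] show "l2 (\<lambda>k. a k + b k)" "n2 (\<lambda>k. a k + b k) \<le> n2 a + n2 b" by auto
qed

lemma l2_cmult:
  assumes "l2 a"
  shows "l2 (\<lambda>k. c * a k)" "n2 (\<lambda>k. c * a k) = \<bar>c\<bar> * n2 a"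
proof -
  show "l2 (\<lambda>k. c * a k)"
    using assms unfolding l2_def power_mult_distrib by (rule summable_on_cmult_right)
  show "n2 (\<lambda>k. c * a k) = \<bar>c\<bar> * n2 a"
    unfolding n2_def power_mult_distrib infsum_cmult_right' by (simp add: real_sqrt_mult)
qed

lemma l2_zero [simp]: "l2 (\<lambda>_. 0)" "n2 (\<lambda>_. 0) = 0"
  by (auto simp: l2_def n2_def)

lemma l2_finite_support:
  assumes "finite A" "\<And>k. k \<notin> A \<Longrightarrow> a k = 0"
  shows "l2 a" "(n2 a)\<^sup>2 = (\<Sum>k\<in>A. (a k)\<^sup>2)"
proof -
  have "((\<lambda>k. (a k)\<^sup>2) has_sum (\<Sum>k\<in>A. (a k)\<^sup>2)) UNIV"
    using assms has_sum_cong_neutral[of UNIV A "\<lambda>k. (a k)\<^sup>2" "\<lambda>k. (a k)\<^sup>2"] has_sum_finite[OF assms(1), of "\<lambda>k. (a k)\<^sup>2"] 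
    by (auto simp: has_sum_finiteI)
  then show "l2 a" "(n2 a)\<^sup>2 = (\<Sum>k\<in>A. (a k)\<^sup>2)"
    by (auto simp: l2_def n2_sq has_sum_iff)
qed

lemma cauchy_schwarz_n2:
  assumes "l2 a" "l2 b" "finite A"
  shows "(\<Sum>k\<in>A. \<bar>a k\<bar> * \<bar>b k\<bar>) \<le> n2 a * n2 b"
  using L2_set_mult_ineq[of a b A] mult_mono[OF L2_set_le_n2[OF assms(1,3)] L2_set_le_n2[OF assms(2,3)]]
  by simp

lemma summable_l2_mult:
  assumes "l2 a" "l2 b"
  shows "(\<lambda>k. a k * b k) summable_on UNIV" "(\<Sum>\<^sub>\<infinity>k. \<bar>a k * b k\<bar>) \<le> n2 a * n2 b"
proof -
  have b: "(\<Sum>k\<in>A. \<bar>a k * b k\<bar>) \<le> n2 a * n2 b" if "finite A" for A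
    using cauchy_schwarz_n2[OF assms that] by (simp add: abs_mult)
  have s: "(\<lambda>k. \<bar>a k * b k\<bar>) summable_on UNIV"
    by (rule nonneg_bdd_above_summable_on) (use b in \<open>auto simp: bdd_above_def\<close>)
  then show "(\<lambda>k. a k * b k) summable_on UNIV"
    using abs_summable_summable[of "\<lambda>k. a k * b k"] by simp
  show "(\<Sum>\<^sub>\<infinity>k. \<bar>a k * b k\<bar>) \<le> n2 a * n2 b"
    by (rule infsum_le_finite_sums[OF s b]) auto
qed

text \<open>Lower semicontinuity of the norm under coefficientwise limits, in the manner of Fatou:
  each finite partial norm converges. The limit of the Euler approximations inherits its bounds from
  here.\<close>

lemma n2_le_pointwise_limit:
  fixes a :: "'a \<Rightarrow> real"
  assumes "\<And>k. (\<lambda>n. x n k) \<longlonglongrightarrow> a k" "eventually (\<lambda>n. l2 (x n) \<and> n2 (x n) \<le> M n) sequentially"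
    and "M \<longlonglongrightarrow> M'"
  shows "l2 a" "n2 a \<le> M'"
proof -
  have "L2_set a A \<le> M'" if "finite A" for A
  proof (rule LIMSEQ_le)
    show "(\<lambda>n. L2_set (x n) A) \<longlonglongrightarrow> L2_set a A"
      unfolding L2_set_def by (intro tendsto_intros assms(1))
    show "M \<longlonglongrightarrow> M'" by fact
    have "eventually (\<lambda>n. L2_set (x n) A \<le> M n) sequentially"
      using assms(2) by eventually_elim (use L2_set_le_n2 that in force)
    then show "\<exists>N. \<forall>n\<ge>N. L2_set (x n) A \<le> M n" by (simp add: eventually_sequentially)
  qed
  from l2I[OF this] show "l2 a" "n2 a \<le> M'" by auto
qed

text \<open>Schur test: the kernel \<alpha> (k - l) is split evenly by a square root between the two
  factors, and both its row sums and its column sums are at most the sum of \<alpha>. The summable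
  factor is the one at k - l.\<close>

lemma young_sum_left:
  fixes \<alpha> B \<beta> :: "'a::ab_group_add \<Rightarrow> real"
  assumes \<alpha>: "\<And>k. 0 \<le> \<alpha> k" "\<alpha> summable_on UNIV" and "l2 B" "l2 \<beta>" and A: "finite A" "finite A'"
  shows "(\<Sum>k\<in>A. \<Sum>l\<in>A'. \<bar>B k\<bar> * \<alpha> (k - l) * \<bar>\<beta> l\<bar>) \<le> infsum \<alpha> UNIV * n2 B * n2 \<beta>"
proof -
  let ?S = "infsum \<alpha> UNIV"
  have S0: "0 \<le> ?S" using \<alpha> by (simp add: infsum_nonneg)
  have i1: "(\<Sum>l\<in>A'. \<alpha> (k - l)) \<le> ?S" for k
  proof -
    have "(\<Sum>l\<in>A'. \<alpha> (k - l)) = sum \<alpha> ((\<lambda>l. k - l) ` A')"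
      by (subst sum.reindex) (auto simp: inj_on_def)
    also have "\<dots> \<le> ?S" by (rule finite_sum_le_infsum) (use \<alpha> A in auto)
    finally show ?thesis .
  qed
  have i2: "(\<Sum>k\<in>A. \<alpha> (k - l)) \<le> ?S" for l
  proof -
    have "(\<Sum>k\<in>A. \<alpha> (k - l)) = sum \<alpha> ((\<lambda>k. k - l) ` A)"
      by (subst sum.reindex) (auto simp: inj_on_def)
    also have "\<dots> \<le> ?S" by (rule finite_sum_le_infsum) (use \<alpha> A in auto)
    finally show ?thesis .
  qed
  let ?u = "\<lambda>(k,l). sqrt (\<alpha> (k - l)) * \<bar>B k\<bar>" and ?v = "\<lambda>(k,l). sqrt (\<alpha> (k - l)) * \<bar>\<beta> l\<bar>"
  have "(\<Sum>k\<in>A. \<Sum>l\<in>A'. \<bar>B k\<bar> * \<alpha> (k - l) * \<bar>\<beta> l\<bar>) = (\<Sum>p\<in>A\<times>A'. \<bar>?u p\<bar> * \<bar>?v p\<bar>)"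
    unfolding sum.cartesian_product
  proof (rule sum.cong, simp, clarify)
    fix k l
    have "\<bar>sqrt (\<alpha> (k - l)) * \<bar>B k\<bar>\<bar> * \<bar>sqrt (\<alpha> (k - l)) * \<bar>\<beta> l\<bar>\<bar> = (sqrt (\<alpha> (k - l)) * sqrt (\<alpha> (k - l))) * \<bar>B k\<bar> * \<bar>\<beta> l\<bar>"
      using \<alpha> by (simp add: abs_mult mult_ac)
    then show "\<bar>B k\<bar> * \<alpha> (k - l) * \<bar>\<beta> l\<bar> = \<bar>sqrt (\<alpha> (k - l)) * \<bar>B k\<bar>\<bar> * \<bar>sqrt (\<alpha> (k - l)) * \<bar>\<beta> l\<bar>\<bar>"
      using \<alpha> by (simp add: mult_ac)
  qed
  also have "\<dots> \<le> L2_set ?u (A\<times>A') * L2_set ?v (A\<times>A')"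
    by (rule L2_set_mult_ineq)
  also have "L2_set ?u (A\<times>A') \<le> sqrt ?S * n2 B"
  proof -
    have "(\<Sum>p\<in>A\<times>A'. (?u p)\<^sup>2) = (\<Sum>k\<in>A. (\<Sum>l\<in>A'. \<alpha> (k - l)) * (B k)\<^sup>2)"
      unfolding sum.cartesian_product[symmetric] sum_distrib_right
      using \<alpha> by (auto simp: power_mult_distrib sum.cartesian_product intro!: sum.cong)
    also have "\<dots> \<le> (\<Sum>k\<in>A. ?S * (B k)\<^sup>2)" by (intro sum_mono mult_right_mono i1) auto
    also have "\<dots> \<le> ?S * (n2 B)\<^sup>2" unfolding sum_distrib_left[symmetric]
      by (intro mult_left_mono sum_le_n2 S0 assms)
    also have "\<dots> = (sqrt ?S * n2 B)\<^sup>2" using S0 by (simp add: power_mult_distrib)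
    finally show ?thesis unfolding L2_set_def by (rule real_le_lsqrt[rotated]) (simp add: S0)
  qed
  also have "L2_set ?v (A\<times>A') \<le> sqrt ?S * n2 \<beta>"
  proof -
    have "(\<Sum>p\<in>A\<times>A'. (?v p)\<^sup>2) = (\<Sum>k\<in>A. \<Sum>l\<in>A'. \<alpha> (k - l) * (\<beta> l)\<^sup>2)"
      using \<alpha> by (auto simp: power_mult_distrib sum.cartesian_product intro!: sum.cong)
    also have "\<dots> = (\<Sum>l\<in>A'. (\<Sum>k\<in>A. \<alpha> (k - l)) * (\<beta> l)\<^sup>2)"
      by (subst sum.swap) (simp add: sum_distrib_right)
    also have "\<dots> \<le> (\<Sum>l\<in>A'. ?S * (\<beta> l)\<^sup>2)" by (intro sum_mono mult_right_mono i2) auto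
    also have "\<dots> \<le> ?S * (n2 \<beta>)\<^sup>2" unfolding sum_distrib_left[symmetric]
      by (intro mult_left_mono sum_le_n2 S0 assms)
    also have "\<dots> = (sqrt ?S * n2 \<beta>)\<^sup>2" using S0 by (simp add: power_mult_distrib)
    finally show ?thesis unfolding L2_set_def by (rule real_le_lsqrt[rotated]) (simp add: S0)
  qed
  finally have "(\<Sum>k\<in>A. \<Sum>l\<in>A'. \<bar>B k\<bar> * \<alpha> (k - l) * \<bar>\<beta> l\<bar>) \<le> (sqrt ?S * n2 B) * (sqrt ?S * n2 \<beta>)"
    by (simp add: S0 mult_right_mono mult_left_mono)
  also have "\<dots> = (sqrt ?S * sqrt ?S) * n2 B * n2 \<beta>" by (simp only: mult_ac)
  also have "\<dots> = ?S * n2 B * n2 \<beta>" using S0 by simp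
  finally show ?thesis .
qed

text \<open>The companion with the summable factor at l: for each fixed l, Cauchy-Schwarz in k and
  translation invariance of the norm leave only the sum of \<beta>.\<close>

lemma young_sum_right:
  fixes \<alpha> B \<beta> :: "'a::ab_group_add \<Rightarrow> real"
  assumes \<beta>: "\<And>k. 0 \<le> \<beta> k" "\<beta> summable_on UNIV" and "l2 B" "l2 \<alpha>" and A: "finite A" "finite A'"
  shows "(\<Sum>k\<in>A. \<Sum>l\<in>A'. \<bar>B k\<bar> * \<bar>\<alpha> (k - l)\<bar> * \<beta> l) \<le> n2 \<alpha> * n2 B * infsum \<beta> UNIV"
proof -
  have i: "(\<Sum>k\<in>A. \<bar>B k\<bar> * \<bar>\<alpha> (k - l)\<bar>) \<le> n2 B * n2 \<alpha>" for l
  proof -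
    have "L2_set (\<lambda>k. \<alpha> (k - l)) A = L2_set \<alpha> ((\<lambda>k. k - l) ` A)"
      unfolding L2_set_def by (subst sum.reindex) (auto simp: inj_on_def)
    also have "\<dots> \<le> n2 \<alpha>" using A assms by (intro L2_set_le_n2) auto
    finally show ?thesis
      using L2_set_mult_ineq[of B "\<lambda>k. \<alpha> (k - l)" A] mult_mono[OF L2_set_le_n2[OF \<open>l2 B\<close> A(1)], of "L2_set (\<lambda>k. \<alpha> (k - l)) A" "n2 \<alpha>"]
      by simp
  qed
  have "(\<Sum>k\<in>A. \<Sum>l\<in>A'. \<bar>B k\<bar> * \<bar>\<alpha> (k - l)\<bar> * \<beta> l) = (\<Sum>l\<in>A'. (\<Sum>k\<in>A. \<bar>B k\<bar> * \<bar>\<alpha> (k - l)\<bar>) * \<beta> l)"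
    by (subst sum.swap) (simp add: sum_distrib_right)
  also have "\<dots> \<le> (\<Sum>l\<in>A'. n2 B * n2 \<alpha> * \<beta> l)"
    by (intro sum_mono mult_right_mono i \<beta>)
  also have "\<dots> \<le> n2 B * n2 \<alpha> * infsum \<beta> UNIV"
    unfolding sum_distrib_left[symmetric]
    by (intro mult_left_mono finite_sum_le_infsum) (use \<beta> A in auto)
  finally show ?thesis by (simp add: mult_ac)
qed

subsection \<open>The frequency lattice\<close>

definition mag :: "freq \<Rightarrow> real" where
  "mag k = norm (real_of_int (fst k), real_of_int (snd k))"

text \<open>The cross product of two frequencies, which is the Fourier symbol of the Jacobian
  determinant up to the factor - 4 pi^2.\<close>

definition sg :: "freq \<Rightarrow> freq \<Rightarrow> real" where
  "sg k l = real_of_int (fst k * snd l - snd k * fst l)"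

lemma mag_sq: "(mag k)\<^sup>2 = (real_of_int (fst k))\<^sup>2 + (real_of_int (snd k))\<^sup>2"
  by (simp add: mag_def norm_Pair)

lemma mag_nonneg [simp]: "0 \<le> mag k" by (simp add: mag_def)

lemma mag_0 [simp]: "mag 0 = 0" by (simp add: mag_def norm_Pair)

lemma mag_uminus [simp]: "mag (- k) = mag k" by (simp add: mag_def norm_Pair)

lemma mag_add_le: "mag (k + l) \<le> mag k + mag l"
  unfolding mag_def using norm_triangle_ineq[of "(real_of_int (fst k), real_of_int (snd k))" "(real_of_int (fst l), real_of_int (snd l))"]
  by simp

lemma mag_diff_le: "\<bar>mag k - mag l\<bar> \<le> mag (k - l)"
  unfolding mag_def using norm_triangle_ineq3[of "(real_of_int (fst k), real_of_int (snd k))" "(real_of_int (fst l), real_of_int (snd l))"]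
  by simp

lemma mag_ge_one: assumes "k \<noteq> 0" shows "1 \<le> mag k"
proof -
  have "1 \<le> (fst k)\<^sup>2 + (snd k)\<^sup>2"
    using assms by (metis (no_types, lifting) add_cancel_right_left add_nonneg_nonneg int_one_le_iff_zero_less less_le
        prod.expand sum_power2_eq_zero_iff fst_zero snd_zero zero_le_power2)
  then have "1 \<le> (mag k)\<^sup>2" unfolding mag_sq by (metis of_int_1_le_iff of_int_add of_int_power)
  then show ?thesis using power2_le_imp_le[of 1 "mag k"] by simp
qed

lemma mag_eq_0 [simp]: "mag k = 0 \<longleftrightarrow> k = 0"
proof
  show "mag k = 0 \<Longrightarrow> k = 0" using mag_ge_one[of k] by linarith
qed simp

lemma mag_pow_mono: "m \<le> n \<Longrightarrow> 0 < m \<Longrightarrow> mag k ^ m \<le> mag k ^ n"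
  by (cases "k = 0") (auto simp: power_increasing mag_ge_one power_0_left)

lemma sg_flip: "sg l k = - sg k l" by (simp add: sg_def algebra_simps)

lemma sg_0 [simp]: "sg 0 l = 0" "sg k 0 = 0" by (auto simp: sg_def)

lemma sg_uminus [simp]: "sg (- k) (- l) = sg k l" by (simp add: sg_def)

text \<open>Lagrange's identity: the difference of the squares is the square of the dot
  product.\<close>

lemma abs_sg_le: "\<bar>sg k l\<bar> \<le> mag k * mag l"
proof -
  have "(sg k l)\<^sup>2 \<le> (mag k * mag l)\<^sup>2"
  proof -
    define a b c d where "a = real_of_int (fst k)" "b = real_of_int (snd k)" "c = real_of_int (fst l)" "d = real_of_int (snd l)"
    have "(mag k * mag l)\<^sup>2 - (sg k l)\<^sup>2 = (a*c+b*d)\<^sup>2"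
      unfolding power_mult_distrib mag_sq sg_def a_b_c_d_def[symmetric]
      by (simp add: a_b_c_d_def[symmetric] power2_eq_square algebra_simps)
    then show ?thesis by (metis diff_ge_0_iff_ge zero_le_power2)
  qed
  then show ?thesis by (metis abs_le_square_iff abs_of_nonneg mag_nonneg mult_nonneg_nonneg)
qed

lemma sg_shift: "sg k l = sg (k - l) l" "sg k l = - sg k (k - l)"
  by (auto simp: sg_def algebra_simps)

text \<open>k and k - l have the same cross product with l, so the two derivatives that the Jacobian
  costs can be charged to any two of k, l and k - l.\<close>

lemma abs_sg_shift_le: "\<bar>sg k l\<bar> \<le> mag (k - l) * mag l" "\<bar>sg k l\<bar> \<le> mag k * mag (k - l)"
  using abs_sg_le[of "k - l" l] abs_sg_le[of k "k - l"] sg_shift[of k l] by auto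

lemma summable_inverse_quad_int: "(\<lambda>i::int. 1 / (1 + (real_of_int i)\<^sup>2)) summable_on UNIV"
proof -
  have s: "summable (\<lambda>n::nat. 1 / (1 + (real n)\<^sup>2))"
  proof (rule summable_comparison_test')
    show "summable (\<lambda>n::nat. 1 / real n ^ 2)" using inverse_power_summable[of 2, where 'a=real] by (simp add: inverse_eq_divide)
    show "norm (1 / (1 + (real n)\<^sup>2)) \<le> 1 / real n ^ 2" if "1 \<le> n" for n
      using that by (simp add: frac_le)
  qed
  then have n: "(\<lambda>n::nat. 1 / (1 + (real n)\<^sup>2)) summable_on UNIV"
    by (subst summable_on_UNIV_nonneg_real_iff) auto
  have "(\<lambda>i::int. 1 / (1 + (real_of_int i)\<^sup>2)) summable_on (range int)"
    by (subst summable_on_reindex) (use n in \<open>auto simp: o_def\<close>)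
  moreover have "(\<lambda>i::int. 1 / (1 + (real_of_int i)\<^sup>2)) summable_on (range (\<lambda>n. - int n))"
    by (subst summable_on_reindex) (use n in \<open>auto simp: o_def inj_on_def\<close>)
  moreover have "range (\<lambda>n. - int n) - range int \<subseteq> range (\<lambda>n. - int n)" by blast
  ultimately have "(\<lambda>i::int. 1 / (1 + (real_of_int i)\<^sup>2)) summable_on (range int \<union> (range (\<lambda>n. - int n) - range int))"
    by (intro summable_on_Un_disjoint) (auto intro: summable_on_subset_banach)
  moreover have "i \<in> range int \<union> (range (\<lambda>n. - int n) - range int)" for i
    by (cases i rule: int_cases2) auto
  then have "range int \<union> (range (\<lambda>n. - int n) - range int) = UNIV" by blast
  ultimately show ?thesis by simp
qed

text \<open>The term at \<open>k = 0\<close> is \<open>1 / 0 = 0\<close>.\<close>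

lemma l2_inverse_mag_sq: "l2 (\<lambda>k. 1 / mag k ^ 2)"
proof -
  let ?g = "\<lambda>i::int. 1 / (1 + (real_of_int i)\<^sup>2)"
  have s: "(\<lambda>(i,j). ?g i * ?g j) summable_on UNIV \<times> UNIV"
  proof (rule summable_on_SigmaI[where g = "\<lambda>i. ?g i * infsum ?g UNIV"])
    show "((\<lambda>j. case (i, j) of (i, j) \<Rightarrow> ?g i * ?g j) has_sum ?g i * infsum ?g UNIV) UNIV" for i
      unfolding prod.case by (intro has_sum_cmult_right has_sum_infsum summable_inverse_quad_int)
    show "(\<lambda>i. ?g i * infsum ?g UNIV) summable_on UNIV"
      by (intro summable_on_cmult_left summable_inverse_quad_int)
  qed auto
  have "(\<lambda>k. (1 / mag k ^ 2)\<^sup>2) summable_on UNIV"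
  proof (rule summable_on_comparison_test)
    show "(\<lambda>k::freq. 4 * (case k of (i,j) \<Rightarrow> ?g i * ?g j)) summable_on UNIV"
      using summable_on_cmult_right[OF s, of 4] by simp
    show "(1 / mag k ^ 2)\<^sup>2 \<le> 4 * (case k of (i,j) \<Rightarrow> ?g i * ?g j)" for k
    proof (cases "k = 0")
      case True then show ?thesis by (simp add: case_prod_beta)
    next
      case False
      define x y where "x = (real_of_int (fst k))\<^sup>2" "y = (real_of_int (snd k))\<^sup>2"
      have n: "0 \<le> x" "0 \<le> y" by (auto simp: x_y_def)
      have m: "1 \<le> x + y" using mag_ge_one[OF False] mag_sq[of k] unfolding x_y_def by (metis one_le_power)
      \<comment> \<open>Away from the origin x + y \<ge> 1, so each factor is at most 2 (x + y); the
        lattice sum is thereby dominated by a product of two one-dimensional sums.\<close>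
      have "(1 + x) * (1 + y) \<le> (2 * (x+y)) * (2*(x+y))"
        using m n by (intro mult_mono) auto
      also have "\<dots> = 4 * (x+y)\<^sup>2" by (simp add: power2_eq_square algebra_simps)
      finally have "4 / (4 * (x+y)\<^sup>2) \<le> 4 / ((1 + x) * (1 + y))" 
        using n m by (intro divide_left_mono) (auto intro!: mult_pos_pos add_pos_nonneg)
      then show ?thesis
        by (simp add: case_prod_beta mag_sq x_y_def[symmetric] power_divide)
    qed
  qed auto
  then show ?thesis by (simp add: l2_def)
qed

text \<open>The constant of the two-dimensional embedding of order 2 into absolutely summable
  coefficients, obtained from Cauchy-Schwarz against |k|^-2.\<close>

definition latK :: real where "latK = n2 (\<lambda>k. 1 / mag k ^ 2)"

lemma latK_nonneg [simp]: "0 \<le> latK" by (simp add: latK_def)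

lemma sum_le_latK:
  assumes "l2 (\<lambda>k. mag k ^ 2 * a k)" "a 0 = 0"
  shows "a summable_on UNIV" "infsum (\<lambda>k. \<bar>a k\<bar>) UNIV \<le> latK * n2 (\<lambda>k. mag k ^ 2 * a k)"
proof -
  have e: "(\<lambda>k. (1 / mag k ^ 2) * (mag k ^ 2 * a k)) = a"
    using assms(2) by (auto simp: fun_eq_iff) 
  show "a summable_on UNIV" "infsum (\<lambda>k. \<bar>a k\<bar>) UNIV \<le> latK * n2 (\<lambda>k. mag k ^ 2 * a k)"
    using summable_l2_mult[OF l2_inverse_mag_sq assms(1)] unfolding latK_def fun_cong[OF e] e by auto
qed

section \<open>Tail weights and energy estimates\<close>

text \<open>For \<open>N = 0\<close> this is \<open>1\<close> except at \<open>r = 0\<close>, where it is \<open>0 / 0 = 0\<close>.\<close>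

definition mu :: "real \<Rightarrow> real \<Rightarrow> real" where
  "mu N r = r / (N + r)"

definition wt :: "real \<Rightarrow> nat \<Rightarrow> freq \<Rightarrow> real" where
  "wt N s k = mu N (mag k) * mag k ^ s"

lemma mu_bounds: assumes "0 \<le> N" "0 \<le> r" shows "0 \<le> mu N r" "mu N r \<le> 1"
  using assms by (auto simp: mu_def divide_le_eq_1)

lemma mu_mono: assumes "0 \<le> N" "0 \<le> r" "r \<le> r'" shows "mu N r \<le> mu N r'"
proof (cases "r = 0")
  case True then show ?thesis using assms mu_bounds by (simp add: mu_def)
next
  case False
  then have p: "0 < N + r" "0 < N + r'" using assms by auto
  have "r * (N + r') \<le> r' * (N + r)" using assms by (simp add: algebra_simps mult_left_mono)
  then show ?thesis unfolding mu_def using p by (simp add: divide_le_eq le_divide_eq field_simps)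
qed

lemma mu_double: assumes "0 \<le> N" "0 \<le> r" shows "mu N (2 * r) \<le> 2 * mu N r"
proof (cases "r = 0")
  case False
  then show ?thesis unfolding mu_def times_divide_eq_right using assms by (intro divide_left_mono) auto
qed (simp add: mu_def)

text \<open>The difference quotient carries a factor N / (N + r) \<le> 1, which makes the bound
  uniform in N.\<close>

lemma mu_lipschitz:
  assumes "0 \<le> N" "0 \<le> r" "0 < r'" shows "\<bar>mu N r - mu N r'\<bar> * r' \<le> \<bar>r - r'\<bar> * mu N r'"
\<comment> \<open>Here \<open>mu 0 0\<close> is 0 / 0 = 0 while \<open>mu 0 r'\<close> is 1; the
  bound holds with equality.\<close>
proof (cases "N + r = 0")
  case True then have "N = 0" "r = 0" using assms by auto
  then show ?thesis using assms by (simp add: mu_def)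
next
  case False
  then have p: "0 < N + r" "0 < N + r'" using assms by auto
  have "mu N r - mu N r' = N * (r - r') / ((N + r) * (N + r'))"
    unfolding mu_def using p by (simp add: diff_frac_eq algebra_simps)
  then have "\<bar>mu N r - mu N r'\<bar> = N / (N + r) * \<bar>r - r'\<bar> / (N + r')"
    using p assms by (simp add: abs_mult)
  also have "\<dots> \<le> 1 * \<bar>r - r'\<bar> / (N + r')"
    using p assms by (intro divide_right_mono mult_right_mono) auto
  finally have "\<bar>mu N r - mu N r'\<bar> * r' \<le> (1 * \<bar>r - r'\<bar> / (N + r')) * r'"
    using assms by (intro mult_right_mono) auto
  then show ?thesis by (simp add: mu_def)
qed

lemma wt_nonneg [simp]: "0 \<le> N \<Longrightarrow> 0 \<le> wt N s k"
  by (simp add: wt_def mu_bounds)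

lemma wt_le: "0 \<le> N \<Longrightarrow> wt N s k \<le> mag k ^ s"
  unfolding wt_def using mu_bounds[of N "mag k"] by (simp add: mult_left_le_one_le)

lemma wt_at_0 [simp]: "wt N s 0 = 0" by (simp add: wt_def mu_def)

lemma wt_Suc: "wt N (Suc s) k = wt N s k * mag k" by (simp add: wt_def)

lemma wt_le_Suc: "0 \<le> N \<Longrightarrow> wt N s k \<le> wt N (Suc s) k"
  using mult_left_mono[OF mag_ge_one[of k] wt_nonneg[of N s k]] by (cases "k = 0") (auto simp: wt_Suc)

lemma wt_double:
  assumes "0 \<le> N" "mag k \<le> 2 * mag l" shows "wt N s k \<le> 2 ^ Suc s * wt N s l"
proof -
  have "mu N (mag k) \<le> 2 * mu N (mag l)"
    using mu_mono[of N "mag k" "2 * mag l"] mu_double[of N "mag l"] assms by simp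
  moreover have "mag k ^ s \<le> (2 * mag l) ^ s" using assms by (intro power_mono) auto
  ultimately have "wt N s k \<le> (2 * mu N (mag l)) * (2 * mag l) ^ s"
    unfolding wt_def using assms mu_bounds by (intro mult_mono) auto
  then show ?thesis by (simp add: wt_def power_mult_distrib mult_ac)
qed

text \<open>|k| is at most twice the larger of |k - l| and |l|, so doubling applies to that
  one.\<close>

lemma wt_triangle:
  assumes "0 \<le> N" shows "wt N s k \<le> 2 ^ Suc s * (wt N s (k - l) + wt N s l)"
proof (cases "mag l \<le> mag (k - l)")
  case True
  then have "mag k \<le> 2 * mag (k - l)" using mag_add_le[of "k - l" l] by simp
  from wt_double[OF assms this, of s] show ?thesis
    by (rule order_trans) (intro mult_left_mono, use assms in auto)
next
  case False
  then have "mag k \<le> 2 * mag l" using mag_add_le[of "k - l" l] by simp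
  from wt_double[OF assms this, of s] show ?thesis
    by (rule order_trans) (intro mult_left_mono, use assms in auto)
qed

text \<open>When the stream function has the lower frequency, the difference of the weights gains
  the factor |k - l| / |l|. It is split into the difference of the powers, with constant 2 * 12, and
  that of \<open>mu\<close>, with constant 1; together 25.\<close>

lemma wt_commutator_low:
  assumes N: "0 \<le> N" and s: "s = 2 \<or> s = 3" and l: "mag (k - l) < mag l"
  shows "\<bar>wt N s k - wt N s l\<bar> * mag l \<le> 25 * mag (k - l) * wt N s l"
proof -
  define r \<rho> m where "r = mag k" "\<rho> = mag l" "m = mu N (mag l)"
  have r: "0 \<le> r" "0 < \<rho>" "\<bar>r - \<rho>\<bar> \<le> mag (k - l)" "r \<le> 2 * \<rho>"
    using mag_diff_le[of k l] l mag_nonneg[of "k - l"] by (auto simp: r_\<rho>_m_def)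
  have m: "0 \<le> m" "mu N r \<le> 2 * m"
    using mu_mono[of N r "2 * \<rho>"] mu_double[of N \<rho>] r N mu_bounds by (auto simp: r_\<rho>_m_def)
  \<comment> \<open>One constant for both exponents: with r \<le> 2 \<rho> the cofactor of r -
    \<rho> is at most 3 \<rho> for s = 2 and 7 \<rho>^2 for s = 3, so 12 is ample.\<close>
  have p: "\<bar>r ^ s - \<rho> ^ s\<bar> * \<rho> \<le> 12 * (\<bar>r - \<rho>\<bar> * \<rho> ^ s)"
    using s
  proof
    assume s: "s = 2"
    have "r ^ s - \<rho> ^ s = (r - \<rho>) * (r + \<rho>)" unfolding s
      by (simp add: power2_eq_square algebra_simps)
    then have "\<bar>r ^ s - \<rho> ^ s\<bar> = \<bar>r - \<rho>\<bar> * (r + \<rho>)"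
      using r by (simp add: abs_mult)
    also have "\<dots> \<le> \<bar>r - \<rho>\<bar> * (12 * \<rho>)" using r by (intro mult_left_mono) auto
    finally have "\<bar>r ^ s - \<rho> ^ s\<bar> * \<rho> \<le> (\<bar>r - \<rho>\<bar> * (12 * \<rho>)) * \<rho>"
      using r by (intro mult_right_mono) auto
    then show ?thesis by (simp add: s power2_eq_square mult_ac)
  next
    assume s: "s = 3"
    have "r ^ s - \<rho> ^ s = (r - \<rho>) * (r * r + r * \<rho> + \<rho> * \<rho>)" unfolding s
      by (simp add: power3_eq_cube algebra_simps)
    then have "\<bar>r ^ s - \<rho> ^ s\<bar> = \<bar>r - \<rho>\<bar> * (r * r + r * \<rho> + \<rho> * \<rho>)"
      using r by (simp add: abs_mult)
    also have "\<dots> \<le> \<bar>r - \<rho>\<bar> * (12 * (\<rho> * \<rho>))"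
    proof (rule mult_left_mono)
      have "r * r \<le> (2 * \<rho>) * (2 * \<rho>)" "r * \<rho> \<le> (2 * \<rho>) * \<rho>" "0 \<le> \<rho> * \<rho>"
        using mult_mono[of r "2 * \<rho>" r "2 * \<rho>"] mult_right_mono[of r "2 * \<rho>" \<rho>] r by auto
      then show "r * r + r * \<rho> + \<rho> * \<rho> \<le> 12 * (\<rho> * \<rho>)" by linarith
    qed simp
    finally have "\<bar>r ^ s - \<rho> ^ s\<bar> * \<rho> \<le> (\<bar>r - \<rho>\<bar> * (12 * (\<rho> * \<rho>))) * \<rho>"
      using r by (intro mult_right_mono) auto
    then show ?thesis by (simp add: s power3_eq_cube mult_ac)
  qed
  have "wt N s k - wt N s l = mu N r * (r ^ s - \<rho> ^ s) + (mu N r - m) * \<rho> ^ s"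
    unfolding wt_def r_\<rho>_m_def by (simp add: algebra_simps)
  then have "\<bar>wt N s k - wt N s l\<bar> \<le> mu N r * \<bar>r ^ s - \<rho> ^ s\<bar> + \<bar>mu N r - m\<bar> * \<rho> ^ s"
    using abs_triangle_ineq[of "mu N r * (r ^ s - \<rho> ^ s)" "(mu N r - m) * \<rho> ^ s"] r mu_bounds[of N r] N
    by (simp add: abs_mult)
  then have "\<bar>wt N s k - wt N s l\<bar> * \<rho> \<le> (mu N r * \<bar>r ^ s - \<rho> ^ s\<bar> + \<bar>mu N r - m\<bar> * \<rho> ^ s) * \<rho>"
    using r by (intro mult_right_mono) auto
  also have "\<dots> = mu N r * (\<bar>r ^ s - \<rho> ^ s\<bar> * \<rho>) + (\<bar>mu N r - m\<bar> * \<rho>) * \<rho> ^ s"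
    by (simp add: algebra_simps)
  also have "\<dots> \<le> (2 * m) * (12 * (\<bar>r - \<rho>\<bar> * \<rho> ^ s)) + (\<bar>r - \<rho>\<bar> * m) * \<rho> ^ s"
  proof (rule add_mono)
    show "mu N r * (\<bar>r ^ s - \<rho> ^ s\<bar> * \<rho>) \<le> (2 * m) * (12 * (\<bar>r - \<rho>\<bar> * \<rho> ^ s))"
      by (rule mult_mono) (use m p r in auto)
    have "\<bar>mu N r - m\<bar> * \<rho> \<le> \<bar>r - \<rho>\<bar> * m"
      using mu_lipschitz[of N r \<rho>] N r by (simp add: r_\<rho>_m_def)
    then show "(\<bar>mu N r - m\<bar> * \<rho>) * \<rho> ^ s \<le> (\<bar>r - \<rho>\<bar> * m) * \<rho> ^ s"
      by (rule mult_right_mono) (use r in auto)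
  qed
  also have "\<dots> = 25 * \<bar>r - \<rho>\<bar> * (m * \<rho> ^ s)" by simp
  also have "\<dots> \<le> 25 * mag (k - l) * (m * \<rho> ^ s)"
    using r m by (intro mult_right_mono) auto
  finally show ?thesis unfolding wt_def r_\<rho>_m_def .
qed

text \<open>Two frequency regimes. If |k - l| < |l|, the commutator moves a derivative from l to the
  stream function. Otherwise |k| and |l| are at most 2 |k - l|, the stream function can carry the
  whole weight, and crude bounds on the two weights are enough.\<close>

lemma wt_commutator:
  assumes N: "0 \<le> N" and s: "s = 2 \<or> s = 3"
  shows "\<bar>wt N s k - wt N s l\<bar> * \<bar>sg k l\<bar>
    \<le> 25 * (wt N 4 (k - l) * mag l ^ (s - 2) + (mag (k - l))\<^sup>2 * wt N s l)"
proof (cases "mag (k - l) < mag l")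
  case True
  have "\<bar>wt N s k - wt N s l\<bar> * \<bar>sg k l\<bar> \<le> \<bar>wt N s k - wt N s l\<bar> * (mag (k - l) * mag l)"
    by (intro mult_left_mono abs_sg_shift_le) auto
  also have "\<dots> = (\<bar>wt N s k - wt N s l\<bar> * mag l) * mag (k - l)" by simp
  also have "\<dots> \<le> (25 * mag (k - l) * wt N s l) * mag (k - l)"
    by (intro mult_right_mono wt_commutator_low N s True) auto
  also have "\<dots> = 25 * ((mag (k - l))\<^sup>2 * wt N s l)" by (simp add: power2_eq_square)
  also have "\<dots> \<le> 25 * (wt N 4 (k - l) * mag l ^ (s - 2) + (mag (k - l))\<^sup>2 * wt N s l)"
    using N by simp
  finally show ?thesis .
next
  case False
  then have d: "mag k \<le> 2 * mag (k - l)" using mag_add_le[of "k - l" l] by simp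
  have k: "wt N s k \<le> 16 * wt N s (k - l)" "wt N s l \<le> 16 * wt N s (k - l)"
  proof -
    have l: "mag l \<le> 2 * mag (k - l)" using False mag_nonneg[of "k - l"] by linarith
    have "(2::real) ^ Suc s \<le> 16" using s by auto
    then have "2 ^ Suc s * wt N s (k - l) \<le> 16 * wt N s (k - l)" using N by (intro mult_right_mono) auto
    then show "wt N s k \<le> 16 * wt N s (k - l)" "wt N s l \<le> 16 * wt N s (k - l)"
      using wt_double[OF N d, of s] wt_double[OF N l, of s] by linarith+
  qed
  then have "\<bar>wt N s k - wt N s l\<bar> \<le> 25 * wt N s (k - l)"
    using wt_nonneg[OF N, of s k] wt_nonneg[OF N, of s l] wt_nonneg[OF N, of s "k - l"] by linarith
  then have "\<bar>wt N s k - wt N s l\<bar> * \<bar>sg k l\<bar> \<le> (25 * wt N s (k - l)) * (mag (k - l) * mag l)"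
    by (intro mult_mono abs_sg_shift_le) (use N in auto)
  also have "\<dots> = 25 * (wt N s (k - l) * mag (k - l) * mag l)" by simp
  \<comment> \<open>The target leaves s - 2 powers on |l|: for s = 3 the factor |l| stays, for s = 2
    it is replaced by |k - l|.\<close>
  also have "wt N s (k - l) * mag (k - l) * mag l \<le> wt N 4 (k - l) * mag l ^ (s - 2)"
    using s
  proof
    assume s: "s = 2"
    have "wt N s (k - l) * mag (k - l) * mag l \<le> wt N s (k - l) * mag (k - l) * mag (k - l)"
      using False N by (intro mult_left_mono) auto
    then show ?thesis by (simp add: s wt_Suc numeral_eq_Suc)
  next
    assume s: "s = 3"
    then show ?thesis by (simp add: s wt_Suc numeral_eq_Suc)
  qed
  also have "25 * (wt N 4 (k - l) * mag l ^ (s - 2)) \<le> 25 * (wt N 4 (k - l) * mag l ^ (s - 2) + (mag (k - l))\<^sup>2 * wt N s l)"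
    using N by simp
  finally show ?thesis by simp
qed

text \<open>The weight has order 2 but the bound may use order 3 on l, so the triangle inequality
  for the weight and the cross product bound already balance. The last relaxation matches the shape
  of \<open>trilinear_bound\<close>.\<close>

lemma wt_source:
  assumes N: "0 \<le> N"
  shows "wt N 2 k * \<bar>sg k l\<bar> \<le> 8 * (wt N 4 (k - l) * mag l + (mag (k - l))\<^sup>2 * wt N 3 l)"
proof -
  have "wt N 2 k * \<bar>sg k l\<bar> \<le> (8 * (wt N 2 (k - l) + wt N 2 l)) * (mag (k - l) * mag l)"
    using wt_triangle[OF N, of 2 k l] abs_sg_shift_le(1)[of k l] N
    by (intro mult_mono) (auto intro!: add_nonneg_nonneg)
  also have "\<dots> = 8 * (wt N 3 (k - l) * mag l + mag (k - l) * wt N 3 l)"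
    by (simp add: wt_Suc numeral_eq_Suc algebra_simps)
  also have "\<dots> \<le> 8 * (wt N 4 (k - l) * mag l + (mag (k - l))\<^sup>2 * wt N 3 l)"
    using wt_le_Suc[OF N, of 3 "k - l"] mag_pow_mono[of 1 2 "k - l"] N
    by (intro mult_left_mono add_mono mult_right_mono) auto
  finally show ?thesis .
qed

section \<open>Norms of coefficient families and the trilinear energy terms\<close>

definition hermitian :: "(freq \<Rightarrow> complex) \<Rightarrow> bool" where
  "hermitian a \<longleftrightarrow> (\<forall>k. a (- k) = cnj (a k))"

text \<open>\<open>hs s\<close> collects the Fourier coefficients of mean-free functions in \<open>W\<^bsup>s,2\<^esup>\<close>;
  as \<open>N\<close> grows, \<open>nw N s\<close> measures the tail of the \<open>W\<^bsup>s,2\<^esup>\<close> norm.\<close>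

definition hs :: "nat \<Rightarrow> (freq \<Rightarrow> complex) \<Rightarrow> bool" where
  "hs s a \<longleftrightarrow> a 0 = 0 \<and> l2 (\<lambda>k. mag k ^ s * cmod (a k))"

definition nw :: "real \<Rightarrow> nat \<Rightarrow> (freq \<Rightarrow> complex) \<Rightarrow> real" where
  "nw N s a = n2 (\<lambda>k. wt N s k * cmod (a k))"

lemma nw_nonneg [simp]: "0 \<le> nw N s a" by (simp add: nw_def)

lemma hs_l2_wt: assumes "hs s a" "0 \<le> N"
  shows "l2 (\<lambda>k. wt N s k * cmod (a k))"
proof (rule l2_mono)
  show "l2 (\<lambda>k. mag k ^ s * cmod (a k))" using assms by (simp add: hs_def)
  show "\<bar>wt N s k * cmod (a k)\<bar> \<le> \<bar>mag k ^ s * cmod (a k)\<bar>" for k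
    using wt_le[OF assms(2), of s k] assms by (simp add: abs_mult mult_right_mono)
qed

lemma nw_0: "hs s a \<Longrightarrow> nw 0 s a = n2 (\<lambda>k. mag k ^ s * cmod (a k))"
  unfolding nw_def
  by (rule arg_cong[where f = n2]) (auto simp: fun_eq_iff wt_def mu_def hs_def)

lemma hs_lower: assumes "hs s a" "r \<le> s"
  shows "hs r a" "nw 0 r a \<le> nw 0 s a"
proof -
  have b: "\<bar>mag k ^ r * cmod (a k)\<bar> \<le> \<bar>mag k ^ s * cmod (a k)\<bar>" for k
    using assms mag_ge_one[of k] 
    by (cases "k = 0") (auto simp: hs_def abs_mult intro!: mult_right_mono power_increasing)
  have l: "l2 (\<lambda>k. mag k ^ s * cmod (a k))" using assms by (simp add: hs_def)
  show "hs r a" using l2_mono(1)[OF l b] assms by (simp add: hs_def)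
  then show "nw 0 r a \<le> nw 0 s a"
    using l2_mono(2)[OF l b] by (simp add: nw_0 assms)
qed

lemma hs_l1:
  assumes "hs (s + 2) a"
  shows "(\<lambda>k. mag k ^ s * cmod (a k)) summable_on UNIV"
    "(\<Sum>\<^sub>\<infinity>k. mag k ^ s * cmod (a k)) \<le> latK * nw 0 (s + 2) a"
proof -
  have e: "(\<lambda>k. (mag k)\<^sup>2 * (mag k ^ s * cmod (a k))) = (\<lambda>k. mag k ^ (s + 2) * cmod (a k))"
    by (simp add: power_add power2_eq_square mult_ac)
  have "l2 (\<lambda>k. (mag k)\<^sup>2 * (mag k ^ s * cmod (a k)))" "mag 0 ^ s * cmod (a 0) = 0"
    using assms unfolding e by (auto simp: hs_def)
  from sum_le_latK[OF this] show "(\<lambda>k. mag k ^ s * cmod (a k)) summable_on UNIV"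
    "(\<Sum>\<^sub>\<infinity>k. mag k ^ s * cmod (a k)) \<le> latK * nw 0 (s + 2) a"
    unfolding e nw_0[OF assms] by simp_all
qed

text \<open>Only the input frequency l is restricted to A; the projection of the output onto A is
  made in \<open>rhsb\<close> and \<open>rhsw\<close>.\<close>

definition jacA :: "freq set \<Rightarrow> (freq \<Rightarrow> complex) \<Rightarrow> (freq \<Rightarrow> complex) \<Rightarrow> freq \<Rightarrow> complex" where
  "jacA A \<xi> a k = of_real (4 * pi\<^sup>2) * (\<Sum>l\<in>A. of_real (sg k l) * \<xi> (k - l) * a l)"

text \<open>In each of the two terms one of \<xi> and a carries the tail weight and is measured in
  l2, while the other enters with summable coefficients, bounded by its unweighted norm. Hence the
  result is linear in the weighted norms of \<xi> and a.\<close>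

lemma trilinear_bound:
  assumes N: "0 \<le> N" and A: "finite A" and B: "l2 B" and \<xi>: "hs 4 \<xi>" and a: "hs s a"
    and s: "2 \<le> s"
  shows "(\<Sum>k\<in>A. \<Sum>l\<in>A. \<bar>B k\<bar> * cmod (\<xi> (k - l)) * cmod (a l) *
            (wt N 4 (k - l) * mag l ^ (s - 2) + (mag (k - l))\<^sup>2 * wt N s l))
    \<le> latK * n2 B * (nw N 4 \<xi> * nw 0 s a + nw 0 4 \<xi> * nw N s a)"
proof -
  let ?\<alpha>1 = "\<lambda>j. wt N 4 j * cmod (\<xi> j)" and ?\<beta>1 = "\<lambda>l. mag l ^ (s - 2) * cmod (a l)"
  let ?\<alpha>2 = "\<lambda>j. (mag j)\<^sup>2 * cmod (\<xi> j)" and ?\<beta>2 = "\<lambda>l. wt N s l * cmod (a l)"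
  have s': "s - 2 + 2 = s" "2 + 2 = (4::nat)" using s by auto
  have "(\<Sum>k\<in>A. \<Sum>l\<in>A. \<bar>B k\<bar> * cmod (\<xi> (k - l)) * cmod (a l) *
            (wt N 4 (k - l) * mag l ^ (s - 2) + (mag (k - l))\<^sup>2 * wt N s l))
     = (\<Sum>k\<in>A. \<Sum>l\<in>A. \<bar>B k\<bar> * \<bar>?\<alpha>1 (k - l)\<bar> * ?\<beta>1 l) + (\<Sum>k\<in>A. \<Sum>l\<in>A. \<bar>B k\<bar> * ?\<alpha>2 (k - l) * \<bar>?\<beta>2 l\<bar>)"
    unfolding sum.distrib[symmetric] using N by (simp add: abs_mult algebra_simps)
  also have "(\<Sum>k\<in>A. \<Sum>l\<in>A. \<bar>B k\<bar> * \<bar>?\<alpha>1 (k - l)\<bar> * ?\<beta>1 l) \<le> n2 ?\<alpha>1 * n2 B * infsum ?\<beta>1 UNIV"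
    by (rule young_sum_right) (use hs_l1[of "s - 2" a] a s s' A B hs_l2_wt[OF \<xi> N] in auto)
  also have "\<dots> \<le> n2 ?\<alpha>1 * n2 B * (latK * nw 0 s a)"
    using hs_l1[of "s - 2" a] a s' by (intro mult_left_mono) auto
  also have "(\<Sum>k\<in>A. \<Sum>l\<in>A. \<bar>B k\<bar> * ?\<alpha>2 (k - l) * \<bar>?\<beta>2 l\<bar>) \<le> infsum ?\<alpha>2 UNIV * n2 B * n2 ?\<beta>2"
    by (rule young_sum_left) (use hs_l1[of 2 \<xi>] \<xi> s' A B hs_l2_wt[OF a N] in auto)
  also have "\<dots> \<le> (latK * nw 0 4 \<xi>) * n2 B * n2 ?\<beta>2"
    using hs_l1[of 2 \<xi>] \<xi> s' by (intro mult_right_mono) auto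
  finally show ?thesis by (simp add: nw_def algebra_simps)
qed

text \<open>Exchanging k and l flips the sign of \<open>sg\<close> and conjugates \<xi>, so the
  double sum S satisfies cnj S = - S. This is the truncated form of the vanishing integral of c u .
  grad c for divergence-free u; it survives truncation because k and l range over the same
  set.\<close>

lemma jacobian_antisym:
  fixes c :: "freq \<Rightarrow> complex"
  assumes "hermitian \<xi>"
  shows "Re (\<Sum>k\<in>A. \<Sum>l\<in>A. cnj (c k) * of_real (sg k l) * \<xi> (k - l) * c l) = 0"
proof -
  let ?S = "\<Sum>k\<in>A. \<Sum>l\<in>A. cnj (c k) * of_real (sg k l) * \<xi> (k - l) * c l"
  have "cnj ?S = (\<Sum>k\<in>A. \<Sum>l\<in>A. c k * of_real (sg k l) * cnj (\<xi> (k - l)) * cnj (c l))"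
    by simp
  also have "\<dots> = (\<Sum>k\<in>A. \<Sum>l\<in>A. - (cnj (c l) * of_real (sg l k) * \<xi> (l - k) * c k))"
  proof (intro sum.cong refl)
    fix k l
    have "cnj (\<xi> (k - l)) = \<xi> (l - k)" using assms unfolding hermitian_def by (metis minus_diff_eq)
    then show "c k * of_real (sg k l) * cnj (\<xi> (k - l)) * cnj (c l) = - (cnj (c l) * of_real (sg l k) * \<xi> (l - k) * c k)"
      using sg_flip[of l k] by simp
  qed
  also have "\<dots> = - ?S" by (subst sum.swap) (simp add: sum_negf)
  finally have "Re (cnj ?S) = Re (- ?S)" by (rule arg_cong)
  then have "Re ?S = - Re ?S" by (simp only: cnj.simps uminus_complex.sel)
  then show ?thesis by linarith
qed

text \<open>The sum in which one weight is moved from \<open>k\<close> to \<open>l\<close> vanishes by antisymmetry;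
  the difference of the weights gains the derivative that the Jacobian costs.\<close>

lemma transport_estimate:
  assumes N: "0 \<le> N" and s: "s = 2 \<or> s = 3" and A: "finite A" and \<xi>: "hs 4 \<xi>" "hermitian \<xi>" and a: "hs s a"
  shows "\<bar>Re (\<Sum>k\<in>A. of_real ((wt N s k)\<^sup>2) * (cnj (a k) * jacA A \<xi> a k))\<bar>
    \<le> 100 * pi\<^sup>2 * latK * nw N s a * (nw N 4 \<xi> * nw 0 s a + nw 0 4 \<xi> * nw N s a)"
proof -
  let ?w = "wt N s"
  let ?t = "\<lambda>k l. cnj (a k) * of_real (sg k l) * \<xi> (k - l) * a l"
  let ?R = "\<Sum>k\<in>A. \<Sum>l\<in>A. of_real (?w k * (?w k - ?w l)) * ?t k l"
  let ?S = "\<Sum>k\<in>A. \<Sum>l\<in>A. cnj (of_real (?w k) * a k) * of_real (sg k l) * \<xi> (k - l) * (of_real (?w l) * a l)"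
  have "(\<Sum>k\<in>A. of_real ((?w k)\<^sup>2) * (cnj (a k) * jacA A \<xi> a k))
      = of_real (4 * pi\<^sup>2) * (\<Sum>k\<in>A. \<Sum>l\<in>A. of_real ((?w k)\<^sup>2) * ?t k l)"
    unfolding jacA_def by (simp add: sum_distrib_left mult_ac)
  also have "(\<Sum>k\<in>A. \<Sum>l\<in>A. of_real ((?w k)\<^sup>2) * ?t k l) = ?R + ?S"
    unfolding sum.distrib[symmetric] by (intro sum.cong refl) (simp add: algebra_simps power2_eq_square)
  finally have "Re (\<Sum>k\<in>A. of_real ((?w k)\<^sup>2) * (cnj (a k) * jacA A \<xi> a k)) = (4 * pi\<^sup>2) * (Re ?R + Re ?S)"
    by simp
  also have "Re ?S = 0" by (rule jacobian_antisym) fact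
  finally have e: "\<bar>Re (\<Sum>k\<in>A. of_real ((?w k)\<^sup>2) * (cnj (a k) * jacA A \<xi> a k))\<bar> = 4 * pi\<^sup>2 * \<bar>Re ?R\<bar>"
    by (simp add: abs_mult)
  have "\<bar>Re ?R\<bar> \<le> (\<Sum>k\<in>A. \<Sum>l\<in>A. cmod (of_real (?w k * (?w k - ?w l)) * ?t k l))"
    by (intro order_trans[OF abs_Re_le_cmod] order_trans[OF norm_sum] sum_mono norm_sum)
  also have "\<dots> \<le> (\<Sum>k\<in>A. \<Sum>l\<in>A. 25 * (\<bar>?w k * cmod (a k)\<bar> * cmod (\<xi> (k - l)) * cmod (a l) *
            (wt N 4 (k - l) * mag l ^ (s - 2) + (mag (k - l))\<^sup>2 * wt N s l)))"
  proof (intro sum_mono)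
    fix k l
    let ?P = "?w k * cmod (a k) * cmod (\<xi> (k - l)) * cmod (a l)"
    have "cmod (of_real (?w k * (?w k - ?w l)) * ?t k l) = ?P * (\<bar>?w k - ?w l\<bar> * \<bar>sg k l\<bar>)"
      unfolding norm_mult using N by (simp add: abs_mult norm_mult del: of_real_diff of_real_mult)
    also have "\<dots> \<le> ?P * (25 * (wt N 4 (k - l) * mag l ^ (s - 2) + (mag (k - l))\<^sup>2 * wt N s l))"
      by (intro mult_left_mono wt_commutator N s) (use N in auto)
    finally show "cmod (of_real (?w k * (?w k - ?w l)) * ?t k l) \<le> 25 * (\<bar>?w k * cmod (a k)\<bar> * cmod (\<xi> (k - l)) * cmod (a l) *
            (wt N 4 (k - l) * mag l ^ (s - 2) + (mag (k - l))\<^sup>2 * wt N s l))"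
      using N by (simp add: abs_mult mult_ac)
  qed
  also have "\<dots> \<le> 25 * (latK * n2 (\<lambda>k. ?w k * cmod (a k)) * (nw N 4 \<xi> * nw 0 s a + nw 0 4 \<xi> * nw N s a))"
    unfolding sum_distrib_left[symmetric]
    by (intro mult_left_mono trilinear_bound) (use N A \<xi> a s hs_l2_wt[OF a N] in auto)
  finally have f: "\<bar>Re ?R\<bar> \<le> 25 * (latK * n2 (\<lambda>k. ?w k * cmod (a k)) * (nw N 4 \<xi> * nw 0 s a + nw 0 4 \<xi> * nw N s a))" .
  have "4 * pi\<^sup>2 * X \<le> 100 * pi\<^sup>2 * latK * Y * Z" if "X \<le> 25 * (latK * Y * Z)" for X Y Z :: real
    using mult_left_mono[OF that, of "4 * pi\<^sup>2"] by (simp add: mult_ac)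
  from this[OF f] show ?thesis unfolding e nw_def[symmetric] .
qed

text \<open>Here w and b are different families, so antisymmetry is of no help; the extra order of b
  replaces it through \<open>wt_source\<close>.\<close>

lemma source_estimate:
  assumes N: "0 \<le> N" and A: "finite A" and \<xi>: "hs 4 \<xi>" and w: "hs 2 w" and b: "hs 3 b"
  shows "\<bar>Re (\<Sum>k\<in>A. of_real ((wt N 2 k)\<^sup>2) * (cnj (w k) * jacA A \<xi> b k))\<bar>
    \<le> 100 * pi\<^sup>2 * latK * nw N 2 w * (nw N 4 \<xi> * nw 0 3 b + nw 0 4 \<xi> * nw N 3 b)"
proof -
  let ?w = "wt N 2"
  let ?R = "\<Sum>k\<in>A. \<Sum>l\<in>A. of_real ((?w k)\<^sup>2) * (cnj (w k) * of_real (sg k l) * \<xi> (k - l) * b l)"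
  have "(\<Sum>k\<in>A. of_real ((?w k)\<^sup>2) * (cnj (w k) * jacA A \<xi> b k)) = of_real (4 * pi\<^sup>2) * ?R"
    unfolding jacA_def by (simp add: sum_distrib_left mult_ac)
  then have e: "\<bar>Re (\<Sum>k\<in>A. of_real ((?w k)\<^sup>2) * (cnj (w k) * jacA A \<xi> b k))\<bar> = 4 * pi\<^sup>2 * \<bar>Re ?R\<bar>"
    by (simp add: abs_mult)
  have "\<bar>Re ?R\<bar> \<le> (\<Sum>k\<in>A. \<Sum>l\<in>A. cmod (of_real ((?w k)\<^sup>2) * (cnj (w k) * of_real (sg k l) * \<xi> (k - l) * b l)))"
    by (intro order_trans[OF abs_Re_le_cmod] order_trans[OF norm_sum] sum_mono norm_sum)
  also have "\<dots> \<le> (\<Sum>k\<in>A. \<Sum>l\<in>A. 25 * (\<bar>?w k * cmod (w k)\<bar> * cmod (\<xi> (k - l)) * cmod (b l) *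
            (wt N 4 (k - l) * mag l ^ (3 - 2) + (mag (k - l))\<^sup>2 * wt N 3 l)))"
  proof (intro sum_mono)
    fix k l
    let ?P = "?w k * cmod (w k) * cmod (\<xi> (k - l)) * cmod (b l)"
    have P: "0 \<le> ?P" using N by simp
    have "cmod (of_real ((?w k)\<^sup>2) * (cnj (w k) * of_real (sg k l) * \<xi> (k - l) * b l)) = ?P * (?w k * \<bar>sg k l\<bar>)"
      unfolding norm_mult using N by (simp add: abs_mult norm_mult power2_eq_square del: of_real_diff of_real_mult)
    also have "\<dots> \<le> ?P * (8 * (wt N 4 (k - l) * mag l + (mag (k - l))\<^sup>2 * wt N 3 l))"
      by (intro mult_left_mono wt_source N P)
    \<comment> \<open>The constant 8 is raised to 25 so that all four energy terms obey the same
      bound.\<close>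
    also have "\<dots> \<le> ?P * (25 * (wt N 4 (k - l) * mag l + (mag (k - l))\<^sup>2 * wt N 3 l))"
      by (intro mult_left_mono mult_right_mono P) (use N in auto)
    also have "\<dots> = 25 * (\<bar>?w k * cmod (w k)\<bar> * cmod (\<xi> (k - l)) * cmod (b l) *
            (wt N 4 (k - l) * mag l + (mag (k - l))\<^sup>2 * wt N 3 l))"
      using N by (simp only: abs_of_nonneg wt_nonneg mult_nonneg_nonneg norm_ge_zero mult.assoc mult.left_commute[of _ 25])
    also have "mag l = mag l ^ (3 - 2)" by simp
    finally show "cmod (of_real ((?w k)\<^sup>2) * (cnj (w k) * of_real (sg k l) * \<xi> (k - l) * b l)) \<le> 25 * (\<bar>?w k * cmod (w k)\<bar> * cmod (\<xi> (k - l)) * cmod (b l) *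
            (wt N 4 (k - l) * mag l ^ (3 - 2) + (mag (k - l))\<^sup>2 * wt N 3 l))" .
  qed
  also have "\<dots> \<le> 25 * (latK * n2 (\<lambda>k. ?w k * cmod (w k)) * (nw N 4 \<xi> * nw 0 3 b + nw 0 4 \<xi> * nw N 3 b))"
    unfolding sum_distrib_left[symmetric]
    by (intro mult_left_mono trilinear_bound) (use N A \<xi> b hs_l2_wt[OF w N] in auto)
  finally have f: "\<bar>Re ?R\<bar> \<le> 25 * (latK * n2 (\<lambda>k. ?w k * cmod (w k)) * (nw N 4 \<xi> * nw 0 3 b + nw 0 4 \<xi> * nw N 3 b))" .
  have "4 * pi\<^sup>2 * X \<le> 100 * pi\<^sup>2 * latK * Y * Z" if "X \<le> 25 * (latK * Y * Z)" for X Y Z :: real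
    using mult_left_mono[OF that, of "4 * pi\<^sup>2"] by (simp add: mult_ac)
  from this[OF f] show ?thesis unfolding e nw_def[symmetric] .
qed

section \<open>Explicit Euler steps for the Galerkin system\<close>

lemma hs_add: assumes "hs s a" "hs s b"
  shows "hs s (\<lambda>k. a k + b k)"
  unfolding hs_def
proof
  show "a 0 + b 0 = 0" using assms by (simp add: hs_def)
  have l: "l2 (\<lambda>k. mag k ^ s * cmod (a k) + mag k ^ s * cmod (b k))"
    using assms by (intro l2_add) (auto simp: hs_def)
  have "\<bar>mag k ^ s * cmod (a k + b k)\<bar> \<le> \<bar>mag k ^ s * cmod (a k) + mag k ^ s * cmod (b k)\<bar>" for k
    using mult_left_mono[OF norm_triangle_ineq[of "a k" "b k"], of "mag k ^ s"] by (simp add: distrib_left)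
  then show "l2 (\<lambda>k. mag k ^ s * cmod (a k + b k))" by (rule l2_mono[OF l])
qed

lemma nw_add_le: assumes "hs s a" "hs s b" "0 \<le> N"
  shows "nw N s (\<lambda>k. a k + b k) \<le> nw N s a + nw N s b"
proof -
  have l: "l2 (\<lambda>k. wt N s k * cmod (a k) + wt N s k * cmod (b k))"
    using assms by (intro l2_add hs_l2_wt)
  have "\<bar>wt N s k * cmod (a k + b k)\<bar> \<le> \<bar>wt N s k * cmod (a k) + wt N s k * cmod (b k)\<bar>" for k
    using mult_left_mono[OF norm_triangle_ineq[of "a k" "b k"], of "wt N s k"] assms by (simp add: distrib_left)
  then have "nw N s (\<lambda>k. a k + b k) \<le> n2 (\<lambda>k. wt N s k * cmod (a k) + wt N s k * cmod (b k))"
    unfolding nw_def by (rule l2_mono[OF l])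
  also have "\<dots> \<le> nw N s a + nw N s b"
    unfolding nw_def using assms by (intro l2_add hs_l2_wt)
  finally show ?thesis .
qed

lemma nw_mono: assumes "hs s b" "\<And>k. cmod (a k) \<le> cmod (b k)" "0 \<le> N" shows "nw N s a \<le> nw N s b"
  unfolding nw_def
  by (rule l2_mono(2)[OF hs_l2_wt[OF assms(1,3)]])
    (use assms in \<open>auto simp: abs_mult intro!: mult_left_mono\<close>)

lemma hs_uminus: "hs s a \<Longrightarrow> hs s (\<lambda>k. - a k)" "nw N s (\<lambda>k. - a k) = nw N s a"
  by (auto simp: hs_def nw_def)

lemma hs_diff: assumes "hs s a" "hs s b" shows "hs s (\<lambda>k. a k - b k)"
  using hs_add[OF assms(1) hs_uminus(1)[OF assms(2)]] by simp

lemma nw_diff_le: assumes "hs s a" "hs s b" "0 \<le> N"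
  shows "nw N s (\<lambda>k. a k - b k) \<le> nw N s a + nw N s b"
  using nw_add_le[OF assms(1) hs_uminus(1)[OF assms(2)] assms(3)] by (simp add: hs_uminus)

lemma cauchy_schwarz_shift:
  fixes \<alpha> \<beta> :: "'a::ab_group_add \<Rightarrow> real"
  assumes "l2 \<alpha>" "l2 \<beta>" "finite A"
  shows "(\<Sum>l\<in>A. \<bar>\<alpha> (k - l)\<bar> * \<bar>\<beta> l\<bar>) \<le> n2 \<alpha> * n2 \<beta>"
proof -
  have "L2_set (\<lambda>l. \<alpha> (k - l)) A = L2_set \<alpha> ((\<lambda>l. k - l) ` A)"
    unfolding L2_set_def by (subst sum.reindex) (auto simp: inj_on_def)
  also have "\<dots> \<le> n2 \<alpha>" using assms by (intro L2_set_le_n2) auto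
  finally show ?thesis
    using L2_set_mult_ineq[of "\<lambda>l. \<alpha> (k - l)" \<beta> A] mult_mono[OF _ L2_set_le_n2[OF assms(2,3)], of "L2_set (\<lambda>l. \<alpha> (k - l)) A" "n2 \<alpha>"]
    by simp
qed

text \<open>Cauchy-Schwarz with one derivative on each factor bounds every coefficient of the
  Jacobian, uniformly in k and in the truncation. It serves the time-Lipschitz bound of the scheme
  and the summability of the full series.\<close>

lemma jacobian_sum_le:
  assumes "hs 4 \<xi>" "hs 2 a" "finite A"
  shows "(\<Sum>l\<in>A. cmod (of_real (sg k l) * \<xi> (k - l) * a l)) \<le> nw 0 4 \<xi> * nw 0 2 a"
proof -
  have h: "hs 1 \<xi>" "hs 1 a" "nw 0 1 \<xi> \<le> nw 0 4 \<xi>" "nw 0 1 a \<le> nw 0 2 a"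
    using hs_lower[OF assms(1), of 1] hs_lower[OF assms(2), of 1] by auto
  have "(\<Sum>l\<in>A. cmod (of_real (sg k l) * \<xi> (k - l) * a l))
      \<le> (\<Sum>l\<in>A. \<bar>mag (k - l) ^ 1 * cmod (\<xi> (k - l))\<bar> * \<bar>mag l ^ 1 * cmod (a l)\<bar>)"
  proof (intro sum_mono)
    fix l
    have "cmod (of_real (sg k l) * \<xi> (k - l) * a l) = \<bar>sg k l\<bar> * (cmod (\<xi> (k - l)) * cmod (a l))"
      by (simp add: norm_mult)
    also have "\<dots> \<le> (mag (k - l) * mag l) * (cmod (\<xi> (k - l)) * cmod (a l))"
      by (intro mult_right_mono abs_sg_shift_le) auto
    finally show "cmod (of_real (sg k l) * \<xi> (k - l) * a l) \<le> \<bar>mag (k - l) ^ 1 * cmod (\<xi> (k - l))\<bar> * \<bar>mag l ^ 1 * cmod (a l)\<bar>"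
      by (simp add: abs_mult mult_ac)
  qed
  also have "\<dots> \<le> nw 0 1 \<xi> * nw 0 1 a"
    unfolding nw_0[OF h(1)] nw_0[OF h(2)] using h assms by (intro cauchy_schwarz_shift) (auto simp: hs_def)
  also have "\<dots> \<le> nw 0 4 \<xi> * nw 0 2 a" using h by (intro mult_mono) auto
  finally show ?thesis .
qed

lemma cmod_jacA_le:
  assumes "hs 4 \<xi>" "hs 2 a" "finite A"
  shows "cmod (jacA A \<xi> a k) \<le> 4 * pi\<^sup>2 * (nw 0 4 \<xi> * nw 0 2 a)"
proof -
  have "cmod (jacA A \<xi> a k) \<le> 4 * pi\<^sup>2 * (\<Sum>l\<in>A. cmod (of_real (sg k l) * \<xi> (k - l) * a l))"
    unfolding jacA_def norm_mult[of "of_real _"] by (intro mult_mono norm_sum) (auto simp: norm_mult norm_power)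
  also have "\<dots> \<le> 4 * pi\<^sup>2 * (nw 0 4 \<xi> * nw 0 2 a)"
    by (intro mult_left_mono jacobian_sum_le assms) auto
  finally show ?thesis .
qed

text \<open>The substitution of - l for l uses the symmetry of the truncation set; this keeps the
  Galerkin scheme within real functions.\<close>

lemma hermitian_jacA:
  assumes "hermitian \<xi>" "hermitian a" "uminus ` A = A"
  shows "jacA A \<xi> a (- k) = cnj (jacA A \<xi> a k)"
proof -
  have "(\<Sum>l\<in>A. of_real (sg (- k) l) * \<xi> (- k - l) * a l) = (\<Sum>l\<in>uminus ` A. of_real (sg (- k) l) * \<xi> (- k - l) * a l)"
    using assms by simp
  also have "\<dots> = (\<Sum>l\<in>A. of_real (sg (- k) (- l)) * \<xi> (- (k - l)) * a (- l))"
    by (subst sum.reindex) (auto simp: algebra_simps)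
  also have "\<dots> = (\<Sum>l\<in>A. of_real (sg k l) * cnj (\<xi> (k - l)) * cnj (a l))"
  proof (intro sum.cong refl)
    fix l
    have "\<xi> (- (k - l)) = cnj (\<xi> (k - l))" "a (- l) = cnj (a l)" using assms unfolding hermitian_def by blast+
    then show "of_real (sg (- k) (- l)) * \<xi> (- (k - l)) * a (- l) = of_real (sg k l) * cnj (\<xi> (k - l)) * cnj (a l)"
      by (simp only: sg_uminus)
  qed
  also have "\<dots> = cnj (\<Sum>l\<in>A. of_real (sg k l) * \<xi> (k - l) * a l)" by simp
  finally show ?thesis unfolding jacA_def by simp
qed

section \<open>The Galerkin system and its energy balance\<close>

locale tqg =
  fixes b0 w0 f \<xi> :: "freq \<Rightarrow> complex"
  assumes b0: "hs 3 b0" "hermitian b0" and w0: "hs 2 w0" "hermitian w0"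
    and f: "hs 2 f" "hermitian f" and \<xi>: "hs 4 \<xi>" "hermitian \<xi>"
begin

text \<open>The stream function \<open>(\<Delta> - 1)\<^sup>-\<^sup>1 (\<omega> - f)\<close>.\<close>

definition psi :: "(freq \<Rightarrow> complex) \<Rightarrow> freq \<Rightarrow> complex" where
  "psi w k = - (w k - f k) / of_real (1 + 4 * pi\<^sup>2 * (mag k)\<^sup>2)"

text \<open>The inverse Helmholtz operator gains two derivatives, with constant 1 since 4 pi^2 \<ge>
  1.\<close>

lemma cmod_psi_le: "(mag k)\<^sup>2 * cmod (psi w k) \<le> cmod (w k - f k)"
proof -
  have p: "1 \<le> pi" using pi_gt3 by linarith
  then have "1 \<le> pi\<^sup>2" by (simp add: power2_eq_square mult_ge1_I)
  then have "1 * (mag k)\<^sup>2 \<le> (4 * pi\<^sup>2) * (mag k)\<^sup>2" by (intro mult_right_mono) auto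
  then have q: "(mag k)\<^sup>2 \<le> 1 + 4 * pi\<^sup>2 * (mag k)\<^sup>2" "0 < 1 + 4 * pi\<^sup>2 * (mag k)\<^sup>2" 
    by (auto intro: add_pos_nonneg)
  have c: "cmod (of_real (1 + 4 * pi\<^sup>2 * (mag k)\<^sup>2)) = 1 + 4 * pi\<^sup>2 * (mag k)\<^sup>2"
    using q(2) by (simp only: norm_of_real abs_of_pos)
  have "cmod (psi w k) = cmod (w k - f k) / (1 + 4 * pi\<^sup>2 * (mag k)\<^sup>2)"
    unfolding psi_def norm_divide c by (simp only: norm_minus_cancel)
  then have "(mag k)\<^sup>2 * cmod (psi w k) = cmod (w k - f k) * ((mag k)\<^sup>2 / (1 + 4 * pi\<^sup>2 * (mag k)\<^sup>2))"
    by simp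
  also have "\<dots> \<le> cmod (w k - f k) * 1"
    using q by (intro mult_left_mono) auto
  finally show ?thesis by simp
qed

lemma psi_bounds:
  assumes "hs 2 w" "0 \<le> N"
  shows "hs 4 (psi w)" "nw N 4 (psi w) \<le> nw N 2 w + nw N 2 f"
proof -
  have d: "hs 2 (\<lambda>k. w k - f k)" by (intro hs_diff assms f)
  have e: "mag k ^ 4 * c = (mag k)\<^sup>2 * ((mag k)\<^sup>2 * c)" for k c
    by (simp add: power2_eq_square power4_eq_xxxx mult_ac)
  show "hs 4 (psi w)" unfolding hs_def
  proof
    show "psi w 0 = 0" using assms f by (simp add: psi_def hs_def)
    show "l2 (\<lambda>k. mag k ^ 4 * cmod (psi w k))"
    proof (rule l2_mono(1))
      show "l2 (\<lambda>k. (mag k)\<^sup>2 * cmod (w k - f k))" using d by (simp add: hs_def)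
      show "\<bar>mag k ^ 4 * cmod (psi w k)\<bar> \<le> \<bar>(mag k)\<^sup>2 * cmod (w k - f k)\<bar>" for k
        using mult_left_mono[OF cmod_psi_le[of k w], of "(mag k)\<^sup>2"] by (simp add: abs_mult)
    qed
  qed
  have "wt N 4 k = wt N 2 k * (mag k)\<^sup>2" for k
    by (simp add: wt_def power2_eq_square power4_eq_xxxx mult_ac)
  then have "\<bar>wt N 4 k * cmod (psi w k)\<bar> \<le> \<bar>wt N 2 k * cmod (w k - f k)\<bar>" for k
    using mult_left_mono[OF cmod_psi_le[of k w], of "wt N 2 k"] assms by (simp add: abs_mult)
  then have "nw N 4 (psi w) \<le> nw N 2 (\<lambda>k. w k - f k)"
    unfolding nw_def by (rule l2_mono(2)[OF hs_l2_wt[OF d assms(2)]])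
  also have "\<dots> \<le> nw N 2 w + nw N 2 f" by (intro nw_diff_le assms f)
  finally show "nw N 4 (psi w) \<le> nw N 2 w + nw N 2 f" .
qed

lemma hermitian_psi: "hermitian w \<Longrightarrow> hermitian (psi w)"
  using f unfolding hermitian_def psi_def by simp

definition En :: "real \<Rightarrow> (freq \<Rightarrow> complex) \<Rightarrow> (freq \<Rightarrow> complex) \<Rightarrow> real" where
  "En N b w = (nw N 3 b)\<^sup>2 + (nw N 2 w)\<^sup>2"

text \<open>Size of the given data at tail level N. Both stream functions, \<psi> and \<xi>, are
  bounded at order 4 by \<open>sqrt (En N b w) + D N\<close>.\<close>

definition D :: "real \<Rightarrow> real" where
  "D N = nw N 2 f + nw N 4 \<xi>"

definition rhsb :: "freq set \<Rightarrow> (freq \<Rightarrow> complex) \<Rightarrow> (freq \<Rightarrow> complex) \<Rightarrow> freq \<Rightarrow> complex" where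
  "rhsb A b w k = (if k \<in> A then jacA A (psi w) b k else 0)"

definition rhsw :: "freq set \<Rightarrow> (freq \<Rightarrow> complex) \<Rightarrow> (freq \<Rightarrow> complex) \<Rightarrow> freq \<Rightarrow> complex" where
  "rhsw A b w k = (if k \<in> A then jacA A (psi w) (\<lambda>k. w k - b k) k + jacA A \<xi> b k else 0)"

definition good :: "freq set \<Rightarrow> (freq \<Rightarrow> complex) \<Rightarrow> (freq \<Rightarrow> complex) \<Rightarrow> bool" where
  "good A b w \<longleftrightarrow> (\<forall>k. k \<notin> A \<longrightarrow> b k = 0 \<and> w k = 0) \<and> b 0 = 0 \<and> w 0 = 0 \<and> hermitian b \<and> hermitian w"

lemma En_nonneg [simp]: "0 \<le> En N b w" by (simp add: En_def)

lemma D_nonneg [simp]: "0 \<le> D N" by (simp add: D_def)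

lemma nw_le_sqrt_En: "nw N 3 b \<le> sqrt (En N b w)" "nw N 2 w \<le> sqrt (En N b w)"
  unfolding En_def by (auto intro!: real_le_rsqrt)

lemma good_hs: assumes "finite A" "good A b w" shows "hs s b" "hs s w"
  using assms by (auto simp: hs_def good_def intro!: l2_finite_support(1)[of A])

lemma En_finite: assumes "finite A" "\<forall>k. k \<notin> A \<longrightarrow> b k = 0 \<and> w k = 0"
  shows "En N b w = (\<Sum>k\<in>A. (wt N 3 k)\<^sup>2 * (cmod (b k))\<^sup>2 + (wt N 2 k)\<^sup>2 * (cmod (w k))\<^sup>2)"
  unfolding En_def nw_def sum.distrib
  using assms by (subst (1 2) l2_finite_support(2)[of A]) (simp_all add: power_mult_distrib del: split_paired_All)

text \<open>Four energy terms, each bounded by 100 pi^2 \<open>latK\<close> times a sum of two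
  products: 800 = 4 * 2 * 100.\<close>

definition K0 :: real where "K0 = 800 * pi\<^sup>2 * latK"

lemma K0_nonneg [simp]: "0 \<le> K0" by (simp add: K0_def)

text \<open>Half the time derivative of \<open>En N\<close> along the Galerkin system.\<close>

definition form :: "real \<Rightarrow> freq set \<Rightarrow> (freq \<Rightarrow> complex) \<Rightarrow> (freq \<Rightarrow> complex) \<Rightarrow> real" where
  "form N A b w = (\<Sum>k\<in>A. (wt N 3 k)\<^sup>2 * Re (cnj (b k) * rhsb A b w k) + (wt N 2 k)\<^sup>2 * Re (cnj (w k) * rhsw A b w k))"

text \<open>One factor of each triple product is at level 0 and two are at level N. With N = 0 this
  is a cubic bound on the growth of the energy; once level 0 is bounded it is quadratic in the level
  N quantities.\<close>

lemma energy_estimate: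
  assumes N: "0 \<le> N" and A: "finite A" and g: "good A b w"
  shows "form N A b w \<le> K0 * (sqrt (En N b w) * ((sqrt (En 0 b w) + D 0) * (sqrt (En N b w) + D N)))"
proof -
  define X X0 where "X = sqrt (En N b w)" and "X0 = sqrt (En 0 b w)"
  have hb: "hs 3 b" and hw: "hs 2 w" using good_hs[OF A g] by auto
  have X: "0 \<le> X" "0 \<le> X0" "nw N 3 b \<le> X" "nw N 2 w \<le> X" "nw 0 3 b \<le> X0" "nw 0 2 w \<le> X0"
    unfolding X_def X0_def by (auto simp: nw_le_sqrt_En)
  have P: "hs 4 (psi w)" "nw N 4 (psi w) \<le> X + D N" "nw 0 4 (psi w) \<le> X0 + D 0"
    using psi_bounds[OF hw N] psi_bounds[OF hw order_refl] X nw_nonneg[of N 4 \<xi>] nw_nonneg[of 0 4 \<xi>]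
    unfolding D_def by (assumption | linarith)+
  have Q: "nw N 4 \<xi> \<le> X + D N" "nw 0 4 \<xi> \<le> X0 + D 0"
    using X unfolding D_def by (auto simp: add_nonneg_nonneg)
  have hp: "hermitian (psi w)" using g by (auto simp: good_def hermitian_psi)
  define G where "G = 100 * pi\<^sup>2 * latK * (X * (2 * ((X0 + D 0) * (X + D N))))"
  have core: "100 * pi\<^sup>2 * latK * x * (p * y0 + p0 * y) \<le> G"
    if "x \<le> X" "0 \<le> x" "p \<le> X + D N" "0 \<le> p" "p0 \<le> X0 + D 0" "0 \<le> p0" "y0 \<le> X0" "0 \<le> y0" "y \<le> X" "0 \<le> y" for x p p0 y0 y
  proof -
    have "p * y0 \<le> (X + D N) * (X0 + D 0)" using that X D_nonneg[of 0] by (intro mult_mono) linarith+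
    moreover have "p0 * y \<le> (X0 + D 0) * (X + D N)" using that X D_nonneg[of N] by (intro mult_mono) linarith+
    ultimately have "p * y0 + p0 * y \<le> 2 * ((X0 + D 0) * (X + D N))" by (simp add: mult.commute)
    then have "x * (p * y0 + p0 * y) \<le> X * (2 * ((X0 + D 0) * (X + D N)))"
      using that X by (intro mult_mono) (auto simp: add_nonneg_nonneg)
    then have "(100 * pi\<^sup>2 * latK) * (x * (p * y0 + p0 * y)) \<le> G"
      unfolding G_def by (intro mult_left_mono) auto
    then show ?thesis by (simp only: mult.assoc)
  qed
  let ?I = "\<lambda>s c d. Re (\<Sum>k\<in>A. of_real ((wt N s k)\<^sup>2) * (cnj (c k) * d k))"
  have t1: "\<bar>?I 3 b (jacA A (psi w) b)\<bar> \<le> G"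
    by (rule order_trans[OF transport_estimate core]) (use N A P hp hb X in auto)
  have t2: "\<bar>?I 2 w (jacA A (psi w) w)\<bar> \<le> G"
    by (rule order_trans[OF transport_estimate core]) (use N A P hp hw X in auto)
  \<comment> \<open>The flow of \<open>psi w\<close> acts on b but is tested against w, so this term
    counts as a source.\<close>
  have t3: "\<bar>?I 2 w (jacA A (psi w) b)\<bar> \<le> G"
    by (rule order_trans[OF source_estimate core]) (use N A P hp hw hb X in auto)
  have t4: "\<bar>?I 2 w (jacA A \<xi> b)\<bar> \<le> G"
    by (rule order_trans[OF source_estimate core]) (use N A Q \<xi> hw hb X in auto)
  have "form N A b w = ?I 3 b (rhsb A b w) + ?I 2 w (rhsw A b w)"
    unfolding form_def sum.distrib Re_sum by (simp del: of_real_power)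
  also have "?I 3 b (rhsb A b w) = ?I 3 b (jacA A (psi w) b)"
    by (intro arg_cong[where f = Re] sum.cong) (auto simp: rhsb_def)
  also have "?I 2 w (rhsw A b w) = ?I 2 w (jacA A (psi w) w) - ?I 2 w (jacA A (psi w) b) + ?I 2 w (jacA A \<xi> b)"
  proof -
    have "(\<Sum>k\<in>A. of_real ((wt N 2 k)\<^sup>2) * (cnj (w k) * rhsw A b w k))
      = (\<Sum>k\<in>A. of_real ((wt N 2 k)\<^sup>2) * (cnj (w k) * jacA A (psi w) w k))
        - (\<Sum>k\<in>A. of_real ((wt N 2 k)\<^sup>2) * (cnj (w k) * jacA A (psi w) b k))
        + (\<Sum>k\<in>A. of_real ((wt N 2 k)\<^sup>2) * (cnj (w k) * jacA A \<xi> b k))"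
      unfolding sum_subtractf[symmetric] sum.distrib[symmetric]
      by (intro sum.cong refl) (simp add: rhsw_def jacA_def algebra_simps sum_subtractf)
    then show ?thesis by (simp only: minus_complex.sel plus_complex.sel)
  qed
  finally have "form N A b w \<le> 4 * G" using t1 t2 t3 t4 by linarith
  also have "\<dots> = K0 * (X * ((X0 + D 0) * (X + D N)))" unfolding G_def K0_def by simp
  finally show ?thesis unfolding X_def X0_def .
qed

text \<open>12 = 4 (2 + 1): in the second equation w - b has norm at most 2 R, and b contributes a
  further R in the term with \<xi>.\<close>

lemma rhs_bounds:
  assumes A: "finite A" and g: "good A b w" and R: "sqrt (En 0 b w) \<le> R"
  shows "cmod (rhsb A b w k) \<le> 12 * pi\<^sup>2 * ((R + D 0) * R)" "cmod (rhsw A b w k) \<le> 12 * pi\<^sup>2 * ((R + D 0) * R)"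
proof -
  have hb: "hs 2 b" "hs 3 b" and hw: "hs 2 w" using good_hs[OF A g] by auto
  have R0: "0 \<le> R" using R real_sqrt_ge_zero[of "En 0 b w", OF En_nonneg] by linarith
  have b: "nw 0 2 b \<le> R" using hs_lower(2)[OF hb(2), of 2] nw_le_sqrt_En(1)[of 0 b w] R by simp
  have w: "nw 0 2 w \<le> R" using nw_le_sqrt_En(2)[of 0 w b] R by simp
  have P: "hs 4 (psi w)" "nw 0 4 (psi w) \<le> R + D 0"
    using psi_bounds[OF hw order_refl] w nw_nonneg[of 0 4 \<xi>] unfolding D_def by (assumption | linarith)+
  have Q: "nw 0 4 \<xi> \<le> R + D 0" using R0 unfolding D_def by simp
  have wb: "hs 2 (\<lambda>k. w k - b k)" "nw 0 2 (\<lambda>k. w k - b k) \<le> 2 * R"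
    using hs_diff[OF hw hb(1)] nw_diff_le[OF hw hb(1), of 0] b w by auto
  have core: "4 * pi\<^sup>2 * (p * a) \<le> 4 * pi\<^sup>2 * ((R + D 0) * (c * R))"
    if "p \<le> R + D 0" "0 \<le> p" "a \<le> c * R" "0 \<le> a" for p a c
    using that R0 by (intro mult_left_mono mult_mono) auto
  have 1: "cmod (jacA A (psi w) b k) \<le> 4 * pi\<^sup>2 * ((R + D 0) * (1 * R))"
    by (rule order_trans[OF cmod_jacA_le core]) (use P hb A b in auto)
  have 2: "cmod (jacA A (psi w) (\<lambda>k. w k - b k) k) \<le> 4 * pi\<^sup>2 * ((R + D 0) * (2 * R))"
    by (rule order_trans[OF cmod_jacA_le core]) (use P wb A in auto)
  have 3: "cmod (jacA A \<xi> b k) \<le> 4 * pi\<^sup>2 * ((R + D 0) * (1 * R))"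
    by (rule order_trans[OF cmod_jacA_le core]) (use Q \<xi> hb A b in auto)
  have nn: "0 \<le> pi\<^sup>2 * ((R + D 0) * R)" using R0 by simp
  show "cmod (rhsb A b w k) \<le> 12 * pi\<^sup>2 * ((R + D 0) * R)"
  proof (cases "k \<in> A")
    case True
    then have "cmod (rhsb A b w k) \<le> 4 * pi\<^sup>2 * ((R + D 0) * R)" using 1 by (simp add: rhsb_def)
    also have "\<dots> \<le> 12 * pi\<^sup>2 * ((R + D 0) * R)" by (intro mult_right_mono) (use R0 in auto)
    finally show ?thesis .
  qed (simp add: rhsb_def R0)
  show "cmod (rhsw A b w k) \<le> 12 * pi\<^sup>2 * ((R + D 0) * R)"
    using 2 3 nn norm_triangle_ineq[of "jacA A (psi w) (\<lambda>k. w k - b k) k" "jacA A \<xi> b k"] 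
    by (simp add: rhsw_def R0)
qed

lemma good_step:
  assumes "good A b w" "uminus ` A = A"
  shows "good A (\<lambda>k. b k + of_real \<delta> * rhsb A b w k) (\<lambda>k. w k + of_real \<delta> * rhsw A b w k)"
proof -
  have m: "- k \<in> A \<longleftrightarrow> k \<in> A" for k using assms(2) by (metis image_iff minus_minus)
  have h: "hermitian b" "hermitian w" "hermitian (\<lambda>k. w k - b k)" "hermitian (psi w)"
    using assms hermitian_psi by (auto simp: good_def hermitian_def)
  have z: "jacA A x y 0 = 0" for x y by (simp add: jacA_def)
  show ?thesis unfolding good_def
  proof (intro conjI)
    show "hermitian (\<lambda>k. b k + of_real \<delta> * rhsb A b w k)"
      using h(1) m hermitian_jacA[OF h(4) h(1) assms(2)] unfolding hermitian_def rhsb_def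
      by (simp del: split_paired_All)
    show "hermitian (\<lambda>k. w k + of_real \<delta> * rhsw A b w k)"
      using h(2) m hermitian_jacA[OF h(4) h(3) assms(2)] hermitian_jacA[OF \<xi>(2) h(1) assms(2)]
      unfolding hermitian_def rhsw_def by (simp del: split_paired_All)
  qed (use assms in \<open>auto simp: good_def rhsb_def rhsw_def z\<close>)
qed

text \<open>\<open>En\<close> is a quadratic form, so an Euler step expands exactly and only the
  term in \<delta>^2 is estimated. Its bound may grow with A, which is why the step size has to
  depend on the box.\<close>

lemma energy_step:
  assumes N: "0 \<le> N" and A: "finite A" and g: "good A b w" and R: "sqrt (En 0 b w) \<le> R" and \<delta>: "0 \<le> \<delta>"
  shows "En N (\<lambda>k. b k + of_real \<delta> * rhsb A b w k) (\<lambda>k. w k + of_real \<delta> * rhsw A b w k)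
    \<le> En N b w + 2 * \<delta> * form N A b w + \<delta>\<^sup>2 * (\<Sum>k\<in>A. 2 * mag k ^ 6 * (12 * pi\<^sup>2 * ((R + D 0) * R))\<^sup>2)"
proof -
  let ?L = "12 * pi\<^sup>2 * ((R + D 0) * R)"
  have sup: "\<forall>k. k \<notin> A \<longrightarrow> b k = 0 \<and> w k = 0"
    "\<forall>k. k \<notin> A \<longrightarrow> b k + of_real \<delta> * rhsb A b w k = 0 \<and> w k + of_real \<delta> * rhsw A b w k = 0"
    using g by (simp_all add: good_def rhsb_def rhsw_def del: split_paired_All)
  have sq: "(cmod (x + of_real \<delta> * y))\<^sup>2 = (cmod x)\<^sup>2 + 2 * \<delta> * Re (cnj x * y) + \<delta>\<^sup>2 * (cmod y)\<^sup>2" for x y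
    unfolding cmod_power2 by (simp add: power2_eq_square algebra_simps)
  have "En N (\<lambda>k. b k + of_real \<delta> * rhsb A b w k) (\<lambda>k. w k + of_real \<delta> * rhsw A b w k)
     = En N b w + 2 * \<delta> * form N A b w + \<delta>\<^sup>2 * (\<Sum>k\<in>A. (wt N 3 k)\<^sup>2 * (cmod (rhsb A b w k))\<^sup>2 + (wt N 2 k)\<^sup>2 * (cmod (rhsw A b w k))\<^sup>2)"
    unfolding En_finite[OF A sup(1)] En_finite[OF A sup(2)] form_def sum_distrib_left sq
    by (simp add: sum.distrib[symmetric] algebra_simps)
  also have "(\<Sum>k\<in>A. (wt N 3 k)\<^sup>2 * (cmod (rhsb A b w k))\<^sup>2 + (wt N 2 k)\<^sup>2 * (cmod (rhsw A b w k))\<^sup>2)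
      \<le> (\<Sum>k\<in>A. 2 * mag k ^ 6 * ?L\<^sup>2)"
  proof (rule sum_mono)
    fix k
    have "(wt N 3 k)\<^sup>2 \<le> mag k ^ 6"
      using power_mono[OF wt_le[OF N, of 3 k] wt_nonneg[OF N], of 2] by (simp add: power_mult[symmetric])
    moreover have "(wt N 2 k)\<^sup>2 \<le> mag k ^ 6"
      using power_mono[OF wt_le[OF N, of 2 k] wt_nonneg[OF N], of 2] mag_pow_mono[of 4 6 k] by (simp add: power_mult[symmetric])
    moreover have "(cmod (rhsb A b w k))\<^sup>2 \<le> ?L\<^sup>2" "(cmod (rhsw A b w k))\<^sup>2 \<le> ?L\<^sup>2"
      using rhs_bounds[OF A g R, of k] by (auto intro!: power_mono)
    ultimately have "(wt N 3 k)\<^sup>2 * (cmod (rhsb A b w k))\<^sup>2 \<le> mag k ^ 6 * ?L\<^sup>2" "(wt N 2 k)\<^sup>2 * (cmod (rhsw A b w k))\<^sup>2 \<le> mag k ^ 6 * ?L\<^sup>2"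
      by (auto intro!: mult_mono)
    then show "(wt N 3 k)\<^sup>2 * (cmod (rhsb A b w k))\<^sup>2 + (wt N 2 k)\<^sup>2 * (cmod (rhsw A b w k))\<^sup>2 \<le> 2 * mag k ^ 6 * ?L\<^sup>2"
      by linarith
  qed
  finally show ?thesis by (simp add: mult_left_mono)
qed

section \<open>The Euler scheme and its uniform bounds\<close>

primrec euler :: "freq set \<Rightarrow> real \<Rightarrow> nat \<Rightarrow> (freq \<Rightarrow> complex) \<times> (freq \<Rightarrow> complex)" where
  "euler A \<delta> 0 = (\<lambda>k. if k \<in> A then b0 k else 0, \<lambda>k. if k \<in> A then w0 k else 0)"
| "euler A \<delta> (Suc i) =
    (\<lambda>k. fst (euler A \<delta> i) k + of_real \<delta> * rhsb A (fst (euler A \<delta> i)) (snd (euler A \<delta> i)) k,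
     \<lambda>k. snd (euler A \<delta> i) k + of_real \<delta> * rhsw A (fst (euler A \<delta> i)) (snd (euler A \<delta> i)) k)"

lemma good_euler:
  assumes "uminus ` A = A" shows "good A (fst (euler A \<delta> i)) (snd (euler A \<delta> i))"
proof (induction i)
  case 0
  have m: "- k \<in> A \<longleftrightarrow> k \<in> A" for k using assms by (metis image_iff minus_minus)
  then show ?case using b0 w0 by (auto simp: good_def hermitian_def hs_def)
next
  case (Suc i)
  from good_step[OF this assms, of \<delta>] show ?case by simp
qed

text \<open>The norm reached once the energy has grown by 1; the bootstrap keeps the scheme inside
  this ball up to time 1 / \<open>rate\<close>.\<close>

definition radius :: real where "radius = sqrt (En 0 b0 w0 + 1)"

text \<open>Bound on the growth of the energy per unit time inside the ball; the summand 1 absorbs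
  the quadratic Euler error.\<close>

definition rate :: real where "rate = 2 * K0 * (radius * ((radius + D 0) * (radius + D 0))) + 1"

definition tail_rate :: real where "tail_rate = 2 * K0 * (radius + D 0)"

definition lip :: real where "lip = 12 * pi\<^sup>2 * ((radius + D 0) * radius)"

lemma radius_nonneg [simp]: "0 \<le> radius" by (simp add: radius_def)

lemma rate_ge_1: "1 \<le> rate" by (simp add: rate_def)

lemma tail_rate_nonneg [simp]: "0 \<le> tail_rate" by (simp add: tail_rate_def)

lemma lip_nonneg [simp]: "0 \<le> lip" by (simp add: lip_def)

lemma En_euler_0: assumes "0 \<le> N" shows "En N (fst (euler A \<delta> 0)) (snd (euler A \<delta> 0)) \<le> En N b0 w0"
  unfolding En_def using assms b0 w0 by (intro add_mono power_mono nw_mono) auto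

text \<open>Bootstrap: as long as the norm is at most \<open>radius\<close>, the energy grows with
  slope at most \<open>rate\<close>. Up to time 1 / \<open>rate\<close> it therefore grows by at
  most 1, so the assumption reproduces itself at the next step.\<close>

lemma euler_bounded:
  assumes A: "finite A" "uminus ` A = A" and \<delta>: "0 < \<delta>" "\<delta> * (\<Sum>k\<in>A. 2 * mag k ^ 6 * lip\<^sup>2) \<le> 1"
    and i: "real i * \<delta> \<le> 1 / rate"
  shows "sqrt (En 0 (fst (euler A \<delta> i)) (snd (euler A \<delta> i))) \<le> radius"
proof -
  have "En 0 (fst (euler A \<delta> i)) (snd (euler A \<delta> i)) \<le> En 0 b0 w0 + real i * \<delta> * rate" using i
  proof (induction i)
    case 0
    then show ?case using En_euler_0[of 0 A \<delta>] by simp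
  next
    case (Suc i)
    define b w where "b = fst (euler A \<delta> i)" and "w = snd (euler A \<delta> i)"
    have i: "real i * \<delta> \<le> 1 / rate" using Suc.prems \<delta> by (simp add: algebra_simps)
    have E: "En 0 b w \<le> En 0 b0 w0 + real i * \<delta> * rate" using Suc.IH[OF i] by (simp add: b_def w_def)
    also have "real i * \<delta> * rate \<le> 1" using i rate_ge_1 by (simp add: pos_le_divide_eq)
    finally have X: "sqrt (En 0 b w) \<le> radius" unfolding radius_def by simp
    have g: "good A b w" unfolding b_def w_def by (rule good_euler[OF A(2)])
    have "En 0 (fst (euler A \<delta> (Suc i))) (snd (euler A \<delta> (Suc i))) \<le> En 0 b w + 2 * \<delta> * form 0 A b w + \<delta>\<^sup>2 * (\<Sum>k\<in>A. 2 * mag k ^ 6 * lip\<^sup>2)"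
      using energy_step[of 0 A b w radius \<delta>] A g X \<delta> by (simp add: b_def w_def lip_def)
    also have "form 0 A b w \<le> K0 * (sqrt (En 0 b w) * ((sqrt (En 0 b w) + D 0) * (sqrt (En 0 b w) + D 0)))"
      by (rule energy_estimate) (use A g in auto)
    also have "\<dots> \<le> K0 * (radius * ((radius + D 0) * (radius + D 0)))"
      using X by (intro mult_left_mono mult_mono) (auto simp: add_nonneg_nonneg)
    also have "\<delta>\<^sup>2 * (\<Sum>k\<in>A. 2 * mag k ^ 6 * lip\<^sup>2) = \<delta> * (\<delta> * (\<Sum>k\<in>A. 2 * mag k ^ 6 * lip\<^sup>2))"
      by (simp only: power2_eq_square mult.assoc)
    also have "\<dots> \<le> \<delta> * 1" using \<delta> by (intro mult_left_mono) auto
    finally have "En 0 (fst (euler A \<delta> (Suc i))) (snd (euler A \<delta> (Suc i))) \<le> En 0 b w + \<delta> * rate"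
      using \<delta> by (simp add: mult_left_mono rate_def algebra_simps)
    with E show ?case by (simp add: algebra_simps)
  qed
  also have "real i * \<delta> * rate \<le> 1" using i rate_ge_1 by (simp add: pos_le_divide_eq)
  finally show ?thesis unfolding radius_def by simp
qed

text \<open>Discrete Gronwall inequality. Once \<open>euler_bounded\<close> controls level 0, the
  level N energy obeys a linear recursion whose only sources are the data term in D N and the Euler
  error \<epsilon>.\<close>

lemma euler_tail:
  assumes N: "0 \<le> N" and A: "finite A" "uminus ` A = A"
    and \<delta>: "0 < \<delta>" "\<delta> * (\<Sum>k\<in>A. 2 * mag k ^ 6 * lip\<^sup>2) \<le> \<epsilon>" "\<epsilon> \<le> 1"
    and i: "real i * \<delta> \<le> 1 / rate"
  shows "En N (fst (euler A \<delta> i)) (snd (euler A \<delta> i)) \<le> exp (2 * tail_rate) * (En N b0 w0 + (tail_rate * (D N)\<^sup>2 + \<epsilon>))"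
proof -
  have "0 \<le> (\<Sum>k\<in>A. 2 * mag k ^ 6 * lip\<^sup>2)" by (intro sum_nonneg) auto
  then have \<epsilon>: "0 \<le> \<epsilon>" using \<delta> by (meson less_imp_le mult_nonneg_nonneg order_trans)
  define c where "c = tail_rate * (D N)\<^sup>2 + \<epsilon>"
  have c: "0 \<le> c" unfolding c_def using \<epsilon> by simp
  have "En N (fst (euler A \<delta> i)) (snd (euler A \<delta> i)) \<le> exp (2 * tail_rate * (real i * \<delta>)) * (En N b0 w0 + real i * \<delta> * c)" using i
  proof (induction i)
    case 0
    then show ?case using En_euler_0[OF N, of A \<delta>] by simp
  next
    case (Suc i)
    define b w where "b = fst (euler A \<delta> i)" and "w = snd (euler A \<delta> i)"
    have i: "real i * \<delta> \<le> 1 / rate" using Suc.prems \<delta> by (simp add: algebra_simps)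
    have E: "En N b w \<le> exp (2 * tail_rate * (real i * \<delta>)) * (En N b0 w0 + real i * \<delta> * c)" using Suc.IH[OF i] by (simp add: b_def w_def)
    have X: "sqrt (En 0 b w) \<le> radius"
      unfolding b_def w_def by (rule euler_bounded) (use A \<delta> i in auto)
    have g: "good A b w" unfolding b_def w_def by (rule good_euler[OF A(2)])
    define x where "x = sqrt (En N b w)"
    have x: "0 \<le> x" "x\<^sup>2 = En N b w" unfolding x_def by auto
    \<comment> \<open>Absorbing x D into x^2 + D^2 gives a recursion linear in the energy; this is
      the origin of the factor 2 in the exponent.\<close>
    have "x * (x + D N) \<le> 2 * x\<^sup>2 + (D N)\<^sup>2"
      using zero_le_power2[of "x - D N"] mult_nonneg_nonneg[OF x(1) D_nonneg[of N]] by (simp add: power2_eq_square algebra_simps)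
    then have xD: "x * (x + D N) \<le> 2 * En N b w + (D N)\<^sup>2" by (simp add: x)
    have "form N A b w \<le> K0 * (x * ((sqrt (En 0 b w) + D 0) * (x + D N)))"
      unfolding x_def by (rule energy_estimate) (use N A g in auto)
    also have "\<dots> \<le> K0 * (x * ((radius + D 0) * (x + D N)))"
      using X x by (intro mult_left_mono mult_right_mono) (auto simp: add_nonneg_nonneg)
    finally have "2 * form N A b w \<le> 2 * (K0 * (x * ((radius + D 0) * (x + D N))))" by linarith
    also have "\<dots> = tail_rate * (x * (x + D N))" unfolding tail_rate_def by (simp only: mult_ac)
    also have "\<dots> \<le> tail_rate * (2 * En N b w + (D N)\<^sup>2)" by (intro mult_left_mono xD) auto
    finally have F: "2 * form N A b w \<le> tail_rate * (2 * En N b w + (D N)\<^sup>2)" .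
    have "En N (fst (euler A \<delta> (Suc i))) (snd (euler A \<delta> (Suc i))) \<le> En N b w + 2 * \<delta> * form N A b w + \<delta>\<^sup>2 * (\<Sum>k\<in>A. 2 * mag k ^ 6 * lip\<^sup>2)"
      using energy_step[of N A b w radius \<delta>] A N g X \<delta> by (simp add: b_def w_def lip_def)
    also have "\<dots> = En N b w + \<delta> * (2 * form N A b w + \<delta> * (\<Sum>k\<in>A. 2 * mag k ^ 6 * lip\<^sup>2))"
      by (simp only: power2_eq_square algebra_simps)
    also have "\<dots> \<le> En N b w + \<delta> * (tail_rate * (2 * En N b w + (D N)\<^sup>2) + \<epsilon>)"
      using \<delta> F by (intro add_left_mono mult_left_mono add_mono) auto
    also have "\<dots> = (1 + 2 * tail_rate * \<delta>) * En N b w + \<delta> * c" by (simp add: c_def algebra_simps)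
    also have "\<dots> \<le> exp (2 * tail_rate * \<delta>) * (exp (2 * tail_rate * (real i * \<delta>)) * (En N b0 w0 + real i * \<delta> * c))
        + exp (2 * tail_rate * (real (Suc i) * \<delta>)) * (\<delta> * c)"
    proof (rule add_mono)
      show "(1 + 2 * tail_rate * \<delta>) * En N b w \<le> exp (2 * tail_rate * \<delta>) * (exp (2 * tail_rate * (real i * \<delta>)) * (En N b0 w0 + real i * \<delta> * c))"
        by (rule mult_mono[OF exp_ge_add_one_self E]) auto
      have "1 * (\<delta> * c) \<le> exp (2 * tail_rate * (real (Suc i) * \<delta>)) * (\<delta> * c)"
        using \<delta> c by (intro mult_right_mono) auto
      then show "\<delta> * c \<le> exp (2 * tail_rate * (real (Suc i) * \<delta>)) * (\<delta> * c)" by simp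
    qed
    also have "\<dots> = exp (2 * tail_rate * (real (Suc i) * \<delta>)) * (En N b0 w0 + real (Suc i) * \<delta> * c)"
    proof -
      have "exp (2 * tail_rate * (real (Suc i) * \<delta>)) = exp (2 * tail_rate * \<delta>) * exp (2 * tail_rate * (real i * \<delta>))"
        by (simp add: exp_add[symmetric] algebra_simps)
      then show ?thesis by (simp add: algebra_simps)
    qed
    finally show ?case .
  qed
  also have "\<dots> \<le> exp (2 * tail_rate) * (En N b0 w0 + c)"
  proof -
    have i1: "real i * \<delta> \<le> 1" using i rate_ge_1 by (meson divide_le_eq_1_pos less_le_trans order_trans zero_less_one)
    then have "2 * tail_rate * (real i * \<delta>) \<le> 2 * tail_rate * 1" by (intro mult_left_mono) auto
    moreover have "real i * \<delta> * c \<le> 1 * c" using i1 c by (intro mult_right_mono)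
    ultimately show ?thesis using c \<delta> by (intro mult_mono add_left_mono) auto
  qed
  finally show ?thesis unfolding c_def .
qed

end

section \<open>Limits of coefficient families\<close>

text \<open>Tannery's theorem along an arbitrary filter: the M-test makes the finite partial sums
  converge uniformly, which permits exchanging the two limits.\<close>

lemma tendsto_infsum_dominated:
  fixes f :: "'a \<Rightarrow> 'b \<Rightarrow> 'c :: banach"
  assumes lim: "\<And>x. ((\<lambda>y. f x y) \<longlongrightarrow> g x) G" and bd: "eventually (\<lambda>y. \<forall>x. norm (f x y) \<le> M x) G"
    and M: "M summable_on UNIV" and G: "G \<noteq> bot"
  shows "((\<lambda>y. \<Sum>\<^sub>\<infinity>x. f x y) \<longlongrightarrow> (\<Sum>\<^sub>\<infinity>x. g x)) G"
proof (rule swap_uniform_limit')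
  let ?Y = "{y. \<forall>x. norm (f x y) \<le> M x}"
  show "uniform_limit ?Y (\<lambda>X y. \<Sum>x\<in>X. f x y) (\<lambda>y. \<Sum>\<^sub>\<infinity>x. f x y) (finite_subsets_at_top UNIV)"
    by (rule Weierstrass_m_test_general[OF _ M]) auto
  show "\<forall>\<^sub>F X in finite_subsets_at_top UNIV. ((\<lambda>y. \<Sum>x\<in>X. f x y) \<longlongrightarrow> (\<Sum>x\<in>X. g x)) G"
    by (intro always_eventually allI tendsto_sum lim)
  have "norm (g x) \<le> M x" for x
    by (rule tendsto_upperbound[OF tendsto_norm[OF lim]]) (use bd G in \<open>auto elim: eventually_mono\<close>)
  then have "g summable_on UNIV"
    by (intro abs_summable_summable[OF summable_on_comparison_test[OF M]]) auto
  then show "(sum g \<longlongrightarrow> (\<Sum>\<^sub>\<infinity>x. g x)) (finite_subsets_at_top UNIV)"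
    by (rule infsum_tendsto)
  show "\<forall>\<^sub>F y in G. y \<in> ?Y" using bd by simp
qed simp

lemma tendsto_wt: "(\<lambda>n. wt (real n) s k) \<longlonglongrightarrow> 0"
proof -
  have "filterlim (\<lambda>n. mag k + real n) at_top sequentially"
    by (rule filterlim_tendsto_add_at_top[OF tendsto_const filterlim_real_sequentially])
  then have "(\<lambda>n. mag k / (mag k + real n) * mag k ^ s) \<longlonglongrightarrow> 0 * mag k ^ s"
    by (intro tendsto_mult tendsto_const tendsto_divide_0[OF tendsto_const] filterlim_at_top_imp_at_infinity)
  then show ?thesis by (simp add: wt_def mu_def add.commute)
qed

lemma tendsto_nw_0: assumes "hs s a" shows "(\<lambda>n. nw (real n) s a) \<longlonglongrightarrow> 0"
proof -
  have "(\<lambda>n. \<Sum>\<^sub>\<infinity>k. (wt (real n) s k * cmod (a k))\<^sup>2) \<longlonglongrightarrow> (\<Sum>\<^sub>\<infinity>k::freq. 0)"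
  proof (rule tendsto_infsum_dominated)
    show "(\<lambda>n. (wt (real n) s k * cmod (a k))\<^sup>2) \<longlonglongrightarrow> 0" for k
      using tendsto_power[OF tendsto_mult[OF tendsto_wt[of s k] tendsto_const[of "cmod (a k)"]], of 2] by simp
    show "\<forall>\<^sub>F n in sequentially. \<forall>k. norm ((wt (real n) s k * cmod (a k))\<^sup>2) \<le> (mag k ^ s * cmod (a k))\<^sup>2"
      by (intro always_eventually allI) (auto intro!: power_mono mult_right_mono wt_le)
    show "(\<lambda>k. (mag k ^ s * cmod (a k))\<^sup>2) summable_on UNIV" using assms by (simp add: hs_def l2_def)
  qed simp
  then have "(\<lambda>n. sqrt (\<Sum>\<^sub>\<infinity>k. (wt (real n) s k * cmod (a k))\<^sup>2)) \<longlonglongrightarrow> sqrt 0"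
    by (intro tendsto_real_sqrt) simp
  then show ?thesis by (simp add: nw_def n2_def)
qed

section \<open>Exhaustion of the lattice by boxes, and tails outside them\<close>

definition Box :: "nat \<Rightarrow> freq set" where
  "Box n = {- int n..int n} \<times> {- int n..int n}"

lemma finite_Box [simp]: "finite (Box n)" by (simp add: Box_def)

lemma uminus_Box: "uminus ` Box n = Box n"
proof -
  have "k \<in> uminus ` Box n" if "k \<in> Box n" for k
    using that by (intro image_eqI[of _ _ "- k"]) (auto simp: Box_def uminus_prod_def)
  then show ?thesis by (auto simp: Box_def)
qed

lemma abs_le_mag: "\<bar>real_of_int (fst k)\<bar> \<le> mag k" "\<bar>real_of_int (snd k)\<bar> \<le> mag k"
proof -
  have "(real_of_int (fst k))\<^sup>2 \<le> (mag k)\<^sup>2" "(real_of_int (snd k))\<^sup>2 \<le> (mag k)\<^sup>2"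
    unfolding mag_sq by auto
  then show "\<bar>real_of_int (fst k)\<bar> \<le> mag k" "\<bar>real_of_int (snd k)\<bar> \<le> mag k"
    using abs_le_square_iff[of _ "mag k"] by simp_all
qed

lemma mem_Box: assumes "mag k \<le> real n" shows "k \<in> Box n"
proof -
  have "\<bar>fst k\<bar> \<le> int n" "\<bar>snd k\<bar> \<le> int n"
    using abs_le_mag[of k] assms by linarith+
  then show ?thesis by (cases k) (auto simp: Box_def)
qed

lemma eventually_mem_Box: "eventually (\<lambda>n. k \<in> Box n) sequentially"
  using eventually_ge_at_top[of "nat \<lceil>mag k\<rceil>"]
proof eventually_elim
  case (elim n)
  then have "mag k \<le> real n" by linarith
  then show ?case by (rule mem_Box)
qed

text \<open>Outside the box |k| > n, where \<open>mu\<close> is at least 1 / 2; squaring turns this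
  into the factor 4. So the weighted norm does control the tail.\<close>

lemma nw_split:
  assumes a: "hs s a"
  shows "(nw 0 s a)\<^sup>2 \<le> (\<Sum>k\<in>Box n. (mag k ^ s * cmod (a k))\<^sup>2) + 4 * (nw (real n) s a)\<^sup>2"
proof -
  let ?g = "\<lambda>k. (mag k ^ s * cmod (a k))\<^sup>2"
  have g: "?g summable_on UNIV" using a by (simp add: hs_def l2_def)
  have w: "(\<lambda>k. (wt (real n) s k * cmod (a k))\<^sup>2) summable_on UNIV" using hs_l2_wt[OF a] by (simp add: l2_def)
  have b: "(\<lambda>k. if k \<in> Box n then ?g k else 0) summable_on UNIV"
    by (subst summable_on_cong_neutral[where T = "Box n" and g = ?g]) auto
  have "(nw 0 s a)\<^sup>2 = (\<Sum>\<^sub>\<infinity>k. ?g k)" unfolding nw_0[OF a] n2_sq ..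
  also have "\<dots> \<le> (\<Sum>\<^sub>\<infinity>k. (if k \<in> Box n then ?g k else 0) + 4 * (wt (real n) s k * cmod (a k))\<^sup>2)"
  proof (rule infsum_mono)
    show "(\<lambda>k. (if k \<in> Box n then ?g k else 0) + 4 * (wt (real n) s k * cmod (a k))\<^sup>2) summable_on UNIV"
      by (intro summable_on_add b summable_on_cmult_right w)
    show "?g k \<le> (if k \<in> Box n then ?g k else 0) + 4 * (wt (real n) s k * cmod (a k))\<^sup>2" for k
    proof (cases "k \<in> Box n")
      case False
      then have k: "real n < mag k" using mem_Box[of k n] by fastforce
      then have "1 / 2 \<le> mu (real n) (mag k)" by (simp add: mu_def field_simps)
      then have "1 / 2 * mag k ^ s \<le> wt (real n) s k" unfolding wt_def by (intro mult_right_mono) auto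
      then have "mag k ^ s * cmod (a k) \<le> 2 * wt (real n) s k * cmod (a k)" by (intro mult_right_mono) auto
      then have "?g k \<le> (2 * wt (real n) s k * cmod (a k))\<^sup>2" by (intro power_mono) auto
      then show ?thesis using False by (simp add: power_mult_distrib)
    qed auto
  qed (rule g)
  also have "\<dots> = (\<Sum>\<^sub>\<infinity>k. (if k \<in> Box n then ?g k else 0)) + 4 * (\<Sum>\<^sub>\<infinity>k. (wt (real n) s k * cmod (a k))\<^sup>2)"
    by (subst infsum_add) (auto intro!: b summable_on_cmult_right w simp: infsum_cmult_right')
  also have "(\<Sum>\<^sub>\<infinity>k. (if k \<in> Box n then ?g k else 0)) = (\<Sum>k\<in>Box n. ?g k)"
    by (subst infsum_cong_neutral[where T = "Box n" and g = ?g]) auto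
  also have "(\<Sum>\<^sub>\<infinity>k. (wt (real n) s k * cmod (a k))\<^sup>2) = (nw (real n) s a)\<^sup>2"
    unfolding nw_def n2_sq ..
  finally show ?thesis .
qed

text \<open>Compactness in the strong norm: finitely many coefficients converge, and the remaining
  ones are small uniformly in x by the common majorant \<tau>.\<close>

lemma tendsto_nw_of_tails:
  assumes h: "eventually (\<lambda>x. hs s (v x)) F" "hs s a"
    and c: "\<And>k. ((\<lambda>x. v x k) \<longlongrightarrow> a k) F"
    and t: "eventually (\<lambda>x. \<forall>n. nw (real n) s (v x) \<le> \<tau> n) F" "\<And>n. nw (real n) s a \<le> \<tau> n" "\<tau> \<longlonglongrightarrow> 0"
  shows "((\<lambda>x. nw 0 s (\<lambda>k. v x k - a k)) \<longlongrightarrow> 0) F"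
proof (rule tendstoI)
  fix e :: real assume e: "0 < e"
  \<comment> \<open>The weighted norm of the difference is at most 2 sqrt \<eta>, and
    \<open>nw_split\<close> multiplies its square by 4, so the tail costs 16 \<eta> = e^2 /
    2.\<close>
  define \<eta> where "\<eta> = e\<^sup>2 / 32"
  have \<eta>: "0 < sqrt \<eta>" using e by (simp add: \<eta>_def)
  from t(3) have "eventually (\<lambda>n. \<bar>\<tau> n\<bar> < sqrt \<eta>) sequentially"
    using \<eta> by (auto simp: tendsto_iff dist_real_def)
  then obtain n where n: "\<bar>\<tau> n\<bar> < sqrt \<eta>" by (auto simp: eventually_sequentially)
  have "((\<lambda>x. \<Sum>k\<in>Box n. (mag k ^ s * cmod (v x k - a k))\<^sup>2) \<longlongrightarrow> (\<Sum>k\<in>Box n. (mag k ^ s * cmod (a k - a k))\<^sup>2)) F"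
    by (intro tendsto_intros c)
  then have "eventually (\<lambda>x. (\<Sum>k\<in>Box n. (mag k ^ s * cmod (v x k - a k))\<^sup>2) < e\<^sup>2 / 2) F"
    by (rule order_tendstoD) (use e in simp)
  then show "\<forall>\<^sub>F x in F. dist (nw 0 s (\<lambda>k. v x k - a k)) 0 < e"
    using h(1) t(1)
  proof eventually_elim
    case (elim x)
    have "nw (real n) s (\<lambda>k. v x k - a k) \<le> \<tau> n + \<tau> n"
      using nw_diff_le[OF elim(2) h(2), of "real n"] spec[OF elim(3), of n] t(2)[of n] by simp
    also have "\<dots> \<le> 2 * sqrt \<eta>" using n by linarith
    finally have "(nw (real n) s (\<lambda>k. v x k - a k))\<^sup>2 \<le> (2 * sqrt \<eta>)\<^sup>2" by (intro power_mono) auto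
    then have "4 * (nw (real n) s (\<lambda>k. v x k - a k))\<^sup>2 \<le> e\<^sup>2 / 2"
      using \<eta> by (simp add: power_mult_distrib \<eta>_def)
    then have "(nw 0 s (\<lambda>k. v x k - a k))\<^sup>2 < e\<^sup>2"
      using nw_split[OF hs_diff[OF elim(2) h(2)], of n] elim(1) by linarith
    then show ?case using e by (simp add: power_less_imp_less_base)
  qed
qed

section \<open>The Jacobian in Fourier coefficients\<close>

definition jac :: "(freq \<Rightarrow> complex) \<Rightarrow> (freq \<Rightarrow> complex) \<Rightarrow> freq \<Rightarrow> complex" where
  "jac \<xi> a k = of_real (4 * pi\<^sup>2) * (\<Sum>\<^sub>\<infinity>l. of_real (sg k l) * \<xi> (k - l) * a l)"

lemma jacA_eq_jac: assumes "finite A" "\<forall>l. l \<notin> A \<longrightarrow> a l = 0" shows "jacA A \<xi> a k = jac \<xi> a k"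
proof -
  have "(\<Sum>\<^sub>\<infinity>l. of_real (sg k l) * \<xi> (k - l) * a l) = (\<Sum>\<^sub>\<infinity>l\<in>A. of_real (sg k l) * \<xi> (k - l) * a l)"
    by (rule infsum_cong_neutral) (use assms(2) in \<open>simp_all del: split_paired_All\<close>)
  then show ?thesis using assms(1) by (simp add: jac_def jacA_def)
qed

lemma jac_summable:
  assumes "hs 4 \<xi>" "hs 2 a"
  shows "(\<lambda>l. of_real (sg k l) * \<xi> (k - l) * a l) summable_on UNIV"
proof (rule abs_summable_summable, rule nonneg_bdd_above_summable_on)
  show "bdd_above (sum (\<lambda>l. cmod (of_real (sg k l) * \<xi> (k - l) * a l)) ` {F. F \<subseteq> UNIV \<and> finite F})"
    using jacobian_sum_le[OF assms, of _ k] by (auto simp: bdd_above_def)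
qed auto

lemma cmod_le_nw:
  assumes "hs s a" shows "mag k ^ s * cmod (a k) \<le> nw 0 s a"
  using abs_le_n2[of "\<lambda>k. mag k ^ s * cmod (a k)" k] assms by (simp add: nw_0 hs_def)

lemma l2_shift:
  fixes \<alpha> :: "'a::ab_group_add \<Rightarrow> real"
  assumes "l2 \<alpha>" shows "l2 (\<lambda>l. \<alpha> (k - l))"
proof -
  have "bij_betw (\<lambda>l. k - l) UNIV UNIV"
    by (rule bij_betwI[where g = "\<lambda>l. k - l"]) auto
  then show ?thesis using assms unfolding l2_def
    using summable_on_reindex_bij_betw[of "\<lambda>l. k - l" UNIV UNIV "\<lambda>l. (\<alpha> l)\<^sup>2"] by simp
qed

text \<open>k is fixed here, so the cross product may be bounded by |k| |k - l|. After this power of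
  |k - l| is spent, the bounds at orders 3 and 2 leave the summable majorant |k - l|^-2
  |l|^-2.\<close>

lemma jac_tendsto:
  assumes h: "eventually (\<lambda>n. hs 4 (X n) \<and> hs 2 (a n) \<and> nw 0 4 (X n) \<le> C \<and> nw 0 2 (a n) \<le> C) F"
    and lim: "\<And>k. ((\<lambda>n. X n k) \<longlongrightarrow> Y k) F" "\<And>k. ((\<lambda>n. a n k) \<longlongrightarrow> c k) F" and F: "F \<noteq> bot"
  shows "((\<lambda>n. jac (X n) (a n) k) \<longlongrightarrow> jac Y c k) F"
proof -
  have "((\<lambda>n. \<Sum>\<^sub>\<infinity>l. of_real (sg k l) * X n (k - l) * a n l) \<longlongrightarrow> (\<Sum>\<^sub>\<infinity>l. of_real (sg k l) * Y (k - l) * c l)) F"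
  proof (rule tendsto_infsum_dominated)
    show "((\<lambda>n. of_real (sg k l) * X n (k - l) * a n l) \<longlongrightarrow> of_real (sg k l) * Y (k - l) * c l) F" for l
      by (intro tendsto_intros lim)
    show "(\<lambda>l. mag k * C * C * (1 / mag (k - l) ^ 2 * (1 / mag l ^ 2))) summable_on UNIV"
      by (intro summable_on_cmult_right summable_l2_mult l2_shift[where \<alpha> = "\<lambda>k. 1 / mag k ^ 2"] l2_inverse_mag_sq)
    show "\<forall>\<^sub>F n in F. \<forall>l. norm (of_real (sg k l) * X n (k - l) * a n l) \<le> mag k * C * C * (1 / mag (k - l) ^ 2 * (1 / mag l ^ 2))"
      using h
    proof eventually_elim
      case (elim n)
      show ?case
      proof
        fix l
        show "norm (of_real (sg k l) * X n (k - l) * a n l) \<le> mag k * C * C * (1 / mag (k - l) ^ 2 * (1 / mag l ^ 2))"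
        \<comment> \<open>The majorant is 0 here because 1 / 0 = 0, and the term vanishes because
          both families are 0 at frequency 0.\<close>
        proof (cases "k - l = 0 \<or> l = 0")
          case True then show ?thesis using elim by (auto simp: hs_def)
        next
          case False
          let ?j = "k - l"
          have m: "1 \<le> mag ?j" "1 \<le> mag l" using False by (auto intro!: mag_ge_one)
          have alg: "(K * p) * (x * y) = K * ((p ^ 3 * x) * (q ^ 2 * y)) * (1 / p ^ 2 * (1 / q ^ 2))"
            if "1 \<le> p" "1 \<le> q" for K p q x y :: real
            using that by (simp add: field_simps power2_eq_square power3_eq_cube)
          have C: "0 \<le> C" using elim nw_nonneg[of 0 4 "X n"] by linarith
          have X3: "mag ?j ^ 3 * cmod (X n ?j) \<le> C"
            using cmod_le_nw[of 3 "X n" ?j] hs_lower[of 4 "X n" 3] elim by force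
          have a2: "mag l ^ 2 * cmod (a n l) \<le> C"
            using cmod_le_nw[of 2 "a n" l] elim by linarith
          have "norm (of_real (sg k l) * X n ?j * a n l) = \<bar>sg k l\<bar> * (cmod (X n ?j) * cmod (a n l))"
            by (simp add: norm_mult)
          also have "\<dots> \<le> (mag k * mag ?j) * (cmod (X n ?j) * cmod (a n l))"
            by (intro mult_right_mono abs_sg_shift_le) auto
          also have "\<dots> = mag k * ((mag ?j ^ 3 * cmod (X n ?j)) * (mag l ^ 2 * cmod (a n l))) * (1 / mag ?j ^ 2 * (1 / mag l ^ 2))"
            by (rule alg[OF m])
          also have "\<dots> \<le> mag k * (C * C) * (1 / mag ?j ^ 2 * (1 / mag l ^ 2))"
            using X3 a2 C by (intro mult_right_mono mult_left_mono mult_mono) auto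
          finally show ?thesis by (simp add: mult.assoc)
        qed
      qed
    qed
  qed (rule F)
  then show ?thesis unfolding jac_def by (intro tendsto_mult tendsto_const)
qed

text \<open>Full cells plus the part of the cell that contains t. This turns the Euler recursion
  into an integral equation with an explicit remainder.\<close>

lemma step_function_has_integral:
  fixes c :: "nat \<Rightarrow> 'a::banach"
  assumes d: "0 < d" and t: "0 \<le> t"
  shows "((\<lambda>s. c (nat \<lfloor>s / d\<rfloor>)) has_integral
      ((\<Sum>i<nat \<lfloor>t / d\<rfloor>. d *\<^sub>R c i) + (t - real (nat \<lfloor>t / d\<rfloor>) * d) *\<^sub>R c (nat \<lfloor>t / d\<rfloor>))) {0..t}"
proof -
  have piece: "((\<lambda>s. c (nat \<lfloor>s / d\<rfloor>)) has_integral ((u - real m * d) *\<^sub>R c m)) {real m * d..u}"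
    if u: "real m * d \<le> u" "u \<le> real (Suc m) * d" for m u
  proof (rule has_integral_spike_finite[of "{u}"])
    show "((\<lambda>_. c m) has_integral ((u - real m * d) *\<^sub>R c m)) {real m * d..u}"
      using has_integral_const_real[of "c m" "real m * d" u] u by simp
    fix s assume s: "s \<in> {real m * d..u} - {u}"
    then have "real m \<le> s / d" "s / d < real m + 1"
      using d u by (auto simp: field_simps)
    then have "\<lfloor>s / d\<rfloor> = int m" by (intro floor_unique) auto
    then show "c (nat \<lfloor>s / d\<rfloor>) = c m" by simp
  qed simp
  have base: "((\<lambda>s. c (nat \<lfloor>s / d\<rfloor>)) has_integral (\<Sum>i<m. d *\<^sub>R c i)) {0..real m * d}" for m
  proof (induction m)
    case 0 show ?case using has_integral_refl(2)[of _ 0] by simp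
  next
    case (Suc m)
    have "((\<lambda>s. c (nat \<lfloor>s / d\<rfloor>)) has_integral ((real (Suc m) * d - real m * d) *\<^sub>R c m)) {real m * d..real (Suc m) * d}"
      using d by (intro piece) auto
    moreover have "real (Suc m) * d - real m * d = d" by (simp add: algebra_simps)
    ultimately have "((\<lambda>s. c (nat \<lfloor>s / d\<rfloor>)) has_integral (d *\<^sub>R c m)) {real m * d..real (Suc m) * d}" by simp
    with Suc show ?case using d by (auto intro!: has_integral_combine[of 0 "real m * d"] mult_right_mono)
  qed
  let ?m = "nat \<lfloor>t / d\<rfloor>"
  have "real ?m \<le> t / d" "t / d \<le> real ?m + 1" using d t by (auto simp: of_nat_nat) 
  then have m: "real ?m * d \<le> t" "t \<le> real (Suc ?m) * d" using d by (auto simp: field_simps)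
  show ?thesis
    by (rule has_integral_combine[OF _ m(1) base piece[OF m]]) (use d in auto)
qed

section \<open>Existence in Fourier coefficients\<close>

context tqg
begin

text \<open>Small enough for the quadratic Euler error over the whole box to be at most \<open>1 / (n + 1)\<close>.\<close>

definition step_size :: "nat \<Rightarrow> real" where
  "step_size n = 1 / ((real n + 1) * ((\<Sum>k\<in>Box n. 2 * mag k ^ 6 * lip\<^sup>2) + 1))"

lemma step_size: "0 < step_size n" "step_size n * (\<Sum>k\<in>Box n. 2 * mag k ^ 6 * lip\<^sup>2) \<le> 1 / (real n + 1)" "step_size n \<le> 1 / (real n + 1)"
proof -
  define c where "c = (\<Sum>k\<in>Box n. 2 * mag k ^ 6 * lip\<^sup>2)"
  have c: "0 \<le> c" unfolding c_def by (intro sum_nonneg) auto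
  have d: "step_size n = 1 / (real n + 1) * (1 / (c + 1))" by (simp add: step_size_def c_def)
  show "0 < step_size n" unfolding d using c by simp
  have "step_size n * c = 1 / (real n + 1) * (c / (c + 1))" unfolding d by simp
  also have "\<dots> \<le> 1 / (real n + 1) * 1" using c by (intro mult_left_mono) auto
  finally show "step_size n * (\<Sum>k\<in>Box n. 2 * mag k ^ 6 * lip\<^sup>2) \<le> 1 / (real n + 1)" by (simp add: c_def)
  have "1 / (real n + 1) * (1 / (c + 1)) \<le> 1 / (real n + 1) * 1" using c by (intro mult_left_mono) auto
  then show "step_size n \<le> 1 / (real n + 1)" unfolding d by simp
qed

definition T where "T = 1 / rate"

lemma T_pos: "0 < T" using rate_ge_1 by (simp add: T_def)

abbreviation step_index :: "nat \<Rightarrow> real \<Rightarrow> nat" where "step_index n t \<equiv> nat \<lfloor>t / step_size n\<rfloor>"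

text \<open>Constant on each Euler step, so that the right-hand side is a step function with an
  exact integral; the price is that Lipschitz bounds hold only up to one step size.\<close>

definition approx_b :: "nat \<Rightarrow> real \<Rightarrow> freq \<Rightarrow> complex" where
  "approx_b n t = fst (euler (Box n) (step_size n) (step_index n t))"

definition approx_w :: "nat \<Rightarrow> real \<Rightarrow> freq \<Rightarrow> complex" where
  "approx_w n t = snd (euler (Box n) (step_size n) (step_index n t))"

lemma step_index: assumes "0 \<le> t" shows "real (step_index n t) * step_size n \<le> t" "t \<le> (real (step_index n t) + 1) * step_size n"
proof -
  have "real (step_index n t) \<le> t / step_size n" "t / step_size n \<le> real (step_index n t) + 1" using step_size[of n] assms by (auto simp: of_nat_nat)
  then show "real (step_index n t) * step_size n \<le> t" "t \<le> (real (step_index n t) + 1) * step_size n" using step_size(1)[of n] by (auto simp: field_simps)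
qed

lemma good_approx: "good (Box n) (approx_b n t) (approx_w n t)"
  unfolding approx_b_def approx_w_def by (rule good_euler[OF uminus_Box])

lemma euler_le_radius:
  assumes "real i * step_size n \<le> T"
  shows "sqrt (En 0 (fst (euler (Box n) (step_size n) i)) (snd (euler (Box n) (step_size n) i))) \<le> radius"
proof (rule euler_bounded)
  have "1 / (real n + 1) \<le> 1" by simp
  then show "step_size n * (\<Sum>k\<in>Box n. 2 * mag k ^ 6 * lip\<^sup>2) \<le> 1" using step_size(2)[of n] by linarith
qed (use assms step_size in \<open>auto simp: T_def uminus_Box\<close>)

lemma step_index_le_T: assumes "t \<in> {0..T}" shows "real (step_index n t) * step_size n \<le> T"
  using step_index(1)[of t n] assms by simp

lemma approx_le_radius: assumes "t \<in> {0..T}" shows "sqrt (En 0 (approx_b n t) (approx_w n t)) \<le> radius"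
  unfolding approx_b_def approx_w_def by (rule euler_le_radius[OF step_index_le_T[OF assms]])

text \<open>The bound of \<open>approx_tail\<close> without the Euler error, which is what remains
  in the limit of n.\<close>

definition tau :: "nat \<Rightarrow> real" where
  "tau m = sqrt (exp (2 * tail_rate) * (En (real m) b0 w0 + tail_rate * (D (real m))\<^sup>2))"

lemma approx_tail: assumes "t \<in> {0..T}"
  shows "sqrt (En (real m) (approx_b n t) (approx_w n t)) \<le> sqrt (exp (2 * tail_rate) * (En (real m) b0 w0 + (tail_rate * (D (real m))\<^sup>2 + 1 / (real n + 1))))"
  unfolding approx_b_def approx_w_def
  by (intro real_sqrt_le_mono euler_tail step_size uminus_Box) (use step_index_le_T[OF assms] in \<open>auto simp: T_def\<close>)

lemma euler_lipschitz:
  assumes "real j * step_size n \<le> T" "i \<le> j"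
  shows "cmod (fst (euler (Box n) (step_size n) j) k - fst (euler (Box n) (step_size n) i) k) \<le> lip * (real (j - i) * step_size n)"
    "cmod (snd (euler (Box n) (step_size n) j) k - snd (euler (Box n) (step_size n) i) k) \<le> lip * (real (j - i) * step_size n)"
  using assms(2,1)
proof (induction j rule: dec_induct)
  case base
  { case 1 then show ?case by simp next case 2 then show ?case by simp }
next
  case (step j)
  let ?b = "fst (euler (Box n) (step_size n) j)" and ?w = "snd (euler (Box n) (step_size n) j)"
  have j: "real j * step_size n \<le> T" if "real (Suc j) * step_size n \<le> T" using that step_size(1)[of n] by (simp add: algebra_simps)
  have r: "cmod (of_real (step_size n) * rhsb (Box n) ?b ?w k) \<le> step_size n * lip" "cmod (of_real (step_size n) * rhsw (Box n) ?b ?w k) \<le> step_size n * lip"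
    if "real (Suc j) * step_size n \<le> T"
    using rhs_bounds[OF finite_Box good_euler[OF uminus_Box] euler_le_radius[OF j[OF that]], of k] step_size(1)[of n]
    by (auto simp: norm_mult lip_def)
  have e: "real (Suc j - i) = real (j - i) + 1" using step by (simp add: Suc_diff_le)
  have tri: "cmod (x + y - z) \<le> cmod (x - z) + cmod y" for x y z :: complex
    using norm_triangle_ineq[of "x - z" y] by (simp add: algebra_simps)
  { case 1
    have "cmod (?b k + of_real (step_size n) * rhsb (Box n) ?b ?w k - fst (euler (Box n) (step_size n) i) k) \<le> lip * (real (j - i) * step_size n) + step_size n * lip"
      by (rule order_trans[OF tri add_mono[OF step.IH(1)[OF j[OF 1]] r(1)[OF 1]]])
    then show ?case unfolding e by (simp add: algebra_simps) }
  { case 2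
    have "cmod (?w k + of_real (step_size n) * rhsw (Box n) ?b ?w k - snd (euler (Box n) (step_size n) i) k) \<le> lip * (real (j - i) * step_size n) + step_size n * lip"
      by (rule order_trans[OF tri add_mono[OF step.IH(2)[OF j[OF 2]] r(2)[OF 2]]])
    then show ?case unfolding e by (simp add: algebra_simps) }
qed

lemma approx_lipschitz:
  assumes "s \<in> {0..T}" "t \<in> {0..T}"
  shows "cmod (approx_b n t k - approx_b n s k) \<le> lip * (\<bar>t - s\<bar> + step_size n)" "cmod (approx_w n t k - approx_w n s k) \<le> lip * (\<bar>t - s\<bar> + step_size n)"
proof -
  have main: "cmod (approx_b n t k - approx_b n s k) \<le> lip * (\<bar>t - s\<bar> + step_size n) \<and> cmod (approx_w n t k - approx_w n s k) \<le> lip * (\<bar>t - s\<bar> + step_size n)"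
    if st: "s \<le> t" "s \<in> {0..T}" "t \<in> {0..T}" for s t
  proof -
    have i: "step_index n s \<le> step_index n t" using st step_size(1)[of n] by (intro nat_mono floor_mono divide_right_mono) auto
    have "real (step_index n t) * step_size n \<le> t" "s \<le> (real (step_index n s) + 1) * step_size n" using step_index[of t n] step_index[of s n] st by auto
    \<comment> \<open>Rounding both times down to the grid adds at most one step to the elapsed
      time.\<close>
    then have "real (step_index n t - step_index n s) * step_size n \<le> t - s + step_size n" using i by (simp add: of_nat_diff algebra_simps)
    then have "lip * (real (step_index n t - step_index n s) * step_size n) \<le> lip * (\<bar>t - s\<bar> + step_size n)" using st by (intro mult_left_mono) auto
    then show ?thesis
      using euler_lipschitz[OF step_index_le_T[OF st(3)] i, of k] unfolding approx_b_def approx_w_def by linarith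
  qed
  show "cmod (approx_b n t k - approx_b n s k) \<le> lip * (\<bar>t - s\<bar> + step_size n)" "cmod (approx_w n t k - approx_w n s k) \<le> lip * (\<bar>t - s\<bar> + step_size n)"
    using main[of s t] main[of t s] assms by (cases "s \<le> t"; simp add: norm_minus_commute abs_minus_commute)+
qed

lemma cmod_approx_le:
  assumes "t \<in> {0..T}" shows "cmod (approx_b n t k) \<le> radius" "cmod (approx_w n t k) \<le> radius"
proof -
  have h: "hs 3 (approx_b n t)" "hs 2 (approx_w n t)" using good_hs[OF finite_Box good_approx] by auto
  have *: "cmod (a k) \<le> nw 0 s a" if "hs s a" for s a
  proof (cases "k = 0")
    case True then show ?thesis using that by (simp add: hs_def)
  next
    case False
    have "1 * cmod (a k) \<le> mag k ^ s * cmod (a k)" using mag_ge_one[OF False] by (intro mult_right_mono one_le_power) auto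
    then show ?thesis using cmod_le_nw[OF that, of k] by simp
  qed
  show "cmod (approx_b n t k) \<le> radius" "cmod (approx_w n t k) \<le> radius"
    using *[OF h(1)] *[OF h(2)] nw_le_sqrt_En(1)[of 0 "approx_b n t" "approx_w n t"] nw_le_sqrt_En(2)[of 0 "approx_w n t" "approx_b n t"] approx_le_radius[OF assms, of n]
    by linarith+
qed

lemma tendsto_step_size: "step_size \<longlonglongrightarrow> 0"
proof (rule tendsto_sandwich[OF _ _ tendsto_const])
  show "(\<lambda>n. 1 / (real n + 1)) \<longlonglongrightarrow> 0" using LIMSEQ_inverse_real_of_nat by (simp add: inverse_eq_divide add.commute)
  show "\<forall>\<^sub>F n in sequentially. 0 \<le> step_size n" using step_size(1) by (intro always_eventually allI less_imp_le)
  show "\<forall>\<^sub>F n in sequentially. step_size n \<le> 1 / (real n + 1)" using step_size(3) by (intro always_eventually allI)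
qed

text \<open>Arzela-Ascoli for single coefficients: a diagonal extraction over rational times and all
  frequencies, then extension to every time by equicontinuity. The latter holds only up to
  \<open>step_size\<close>, which tends to 0 along the subsequence.\<close>

lemma convergent_subsequence:
  obtains r :: "nat \<Rightarrow> nat" where "strict_mono r"
    "\<And>t k. t \<in> {0..T} \<Longrightarrow> convergent (\<lambda>n. approx_b (r n) t k)" "\<And>t k. t \<in> {0..T} \<Longrightarrow> convergent (\<lambda>n. approx_w (r n) t k)"
proof -
  let ?S = "(\<rat> \<inter> {0..T}) \<times> (UNIV :: freq set)"
  have "countable ?S" by (intro countable_SIGMA countable_Int1 countable_rat) auto
  moreover have "norm (case p of (q, k) \<Rightarrow> (approx_b n q k, approx_w n q k)) \<le> radius + radius" if "p \<in> ?S" for n p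
    using that cmod_approx_le[of "fst p" n "snd p"] norm_Pair_le[of "approx_b n (fst p) (snd p)" "approx_w n (fst p) (snd p)"]
    by (auto simp: case_prod_beta)
  ultimately obtain r where r: "strict_mono r" "\<And>p. p \<in> ?S \<Longrightarrow> \<exists>l. (\<lambda>n. case p of (q, k) \<Rightarrow> (approx_b (r n) q k, approx_w (r n) q k)) \<longlonglongrightarrow> l"
    using function_convergent_subsequence[of ?S "\<lambda>n p. case p of (q, k) \<Rightarrow> (approx_b n q k, approx_w n q k)" "radius + radius"] by blast
  have rat: "convergent (\<lambda>n. approx_b (r n) q k)" "convergent (\<lambda>n. approx_w (r n) q k)" if q: "q \<in> \<rat>" "q \<in> {0..T}" for q k
    using r(2)[of "(q, k)"] q tendsto_fst tendsto_snd by (fastforce simp: convergent_def)+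
  have dr: "(\<lambda>n. step_size (r n)) \<longlonglongrightarrow> 0"
    using LIMSEQ_subseq_LIMSEQ[OF tendsto_step_size r(1)] by (simp add: o_def)
  have conv: "convergent (\<lambda>n. y (r n) t)"
    if t: "t \<in> {0..T}" and lp: "\<And>n s. s \<in> {0..T} \<Longrightarrow> cmod (y n t - y n s) \<le> lip * (\<bar>t - s\<bar> + step_size n)"
      and cq: "\<And>q. q \<in> \<rat> \<Longrightarrow> q \<in> {0..T} \<Longrightarrow> convergent (\<lambda>n. y (r n) q)" for y :: "nat \<Rightarrow> real \<Rightarrow> complex" and t
  proof (rule Cauchy_convergent, rule CauchyI)
    fix e :: real assume e: "0 < e"
    \<comment> \<open>Time distance and step size are each below \<eta>, so the Lipschitz bound
      costs 2 \<open>lip\<close> \<eta> \<le> e / 3; the summand 1 guards against \<open>lip\<close>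
      = 0.\<close>
    define \<eta> where "\<eta> = e / (6 * (lip + 1))"
    have "lip * (e / (6 * (lip + 1))) = e / 6 * (lip / (lip + 1))" by simp
    also have "\<dots> \<le> e / 6 * 1" using e add_nonneg_pos[OF lip_nonneg zero_less_one] by (intro mult_left_mono) (auto simp: divide_le_eq_1_pos)
    finally have "lip * \<eta> \<le> e / 6" by (simp only: \<eta>_def mult_1_right)
    moreover have "0 < \<eta>"
      unfolding \<eta>_def using e by (intro divide_pos_pos mult_pos_pos add_nonneg_pos) auto
    ultimately have \<eta>: "0 < \<eta>" "lip * \<eta> \<le> e / 6" by auto
    obtain q where q: "q \<in> \<rat>" "q \<in> {0..T}" "\<bar>t - q\<bar> < \<eta>"
    proof -
      have "max 0 (t - \<eta>) < min T (t + \<eta>)" using t \<eta> T_pos by auto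
      from Rats_dense_in_real[OF this] obtain q where "q \<in> \<rat>" "max 0 (t - \<eta>) < q" "q < min T (t + \<eta>)" by blast
      then show ?thesis by (intro that[of q]) auto
    qed
    from cq[OF q(1,2)] have "Cauchy (\<lambda>n. y (r n) q)" by (rule convergent_Cauchy)
    from CauchyD[OF this, of "e / 3"] e obtain M1 where M1: "\<And>m n. m \<ge> M1 \<Longrightarrow> n \<ge> M1 \<Longrightarrow> cmod (y (r m) q - y (r n) q) < e / 3" by auto
    from order_tendstoD(2)[OF dr \<eta>(1)] obtain M2 where M2: "\<And>n. n \<ge> M2 \<Longrightarrow> step_size (r n) < \<eta>" by (auto simp: eventually_sequentially)
    have close: "cmod (y (r n) t - y (r n) q) \<le> e / 3" if "n \<ge> M2" for n
    proof -
      have "cmod (y (r n) t - y (r n) q) \<le> lip * (\<bar>t - q\<bar> + step_size (r n))" by (rule lp[OF q(2)])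
      also have "\<dots> \<le> lip * (\<eta> + \<eta>)" using q(3) M2[OF that] by (intro mult_left_mono) auto
      finally show ?thesis using \<eta>(2) by (simp add: algebra_simps)
    qed
    show "\<exists>M. \<forall>m\<ge>M. \<forall>n\<ge>M. norm (y (r m) t - y (r n) t) < e"
    proof (intro exI[of _ "max M1 M2"] allI impI)
      fix m n assume mn: "max M1 M2 \<le> m" "max M1 M2 \<le> n"
      have "y (r m) t - y (r n) t = (y (r m) t - y (r m) q) + (y (r m) q - y (r n) q) - (y (r n) t - y (r n) q)" by simp
      also have "cmod \<dots> \<le> cmod (y (r m) t - y (r m) q) + cmod (y (r m) q - y (r n) q) + cmod (y (r n) t - y (r n) q)"
        by (rule order_trans[OF norm_triangle_ineq4 add_right_mono[OF norm_triangle_ineq]])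
      also have "\<dots> < e" using close[of m] close[of n] M1[of m n] mn by simp
      finally show "norm (y (r m) t - y (r n) t) < e" .
    qed
  qed
  show ?thesis
  proof (rule that[OF r(1)])
    fix t k assume t: "t \<in> {0..T}"
    show "convergent (\<lambda>n. approx_b (r n) t k)"
      by (rule conv[of t "\<lambda>n t. approx_b n t k"]) (use t approx_lipschitz(1) rat(1) in auto)
    show "convergent (\<lambda>n. approx_w (r n) t k)"
      by (rule conv[of t "\<lambda>n t. approx_w n t k"]) (use t approx_lipschitz(2) rat(2) in auto)
  qed
qed

lemma tendsto_tau: "tau \<longlonglongrightarrow> 0"
proof -
  have "(\<lambda>m. D (real m)) \<longlonglongrightarrow> 0 + 0" unfolding D_def using f \<xi> by (intro tendsto_add tendsto_nw_0)
  moreover have "(\<lambda>m. En (real m) b0 w0) \<longlonglongrightarrow> 0\<^sup>2 + 0\<^sup>2"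
    unfolding En_def using b0 w0 by (intro tendsto_add tendsto_power tendsto_nw_0)
  ultimately have "tau \<longlonglongrightarrow> sqrt (exp (2 * tail_rate) * ((0\<^sup>2 + 0\<^sup>2) + tail_rate * (0 + 0)\<^sup>2))"
    unfolding tau_def by (intro tendsto_intros)
  then show ?thesis by simp
qed

text \<open>The Euler increments telescope over full steps; the extra term is the stretch from the
  last grid point to t, during which the approximation stands still.\<close>

lemma approx_integral:
  fixes k :: freq
  assumes t: "t \<in> {0..T}" "0 \<le> t"
  defines "Gb \<equiv> \<lambda>n s. rhsb (Box n) (approx_b n s) (approx_w n s) k" and "Gw \<equiv> \<lambda>n s. rhsw (Box n) (approx_b n s) (approx_w n s) k"
  shows "(Gb n has_integral (approx_b n t k - approx_b n 0 k + (t - real (step_index n t) * step_size n) *\<^sub>R Gb n t)) {0..t}"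
    "(Gw n has_integral (approx_w n t k - approx_w n 0 k + (t - real (step_index n t) * step_size n) *\<^sub>R Gw n t)) {0..t}"
proof -
  let ?e = "euler (Box n) (step_size n)"
  let ?rb = "\<lambda>i. rhsb (Box n) (fst (?e i)) (snd (?e i)) k" and ?rw = "\<lambda>i. rhsw (Box n) (fst (?e i)) (snd (?e i)) k"
  have "(\<Sum>i<m. step_size n *\<^sub>R ?rb i) = fst (?e m) k - fst (?e 0) k" "(\<Sum>i<m. step_size n *\<^sub>R ?rw i) = snd (?e m) k - snd (?e 0) k" for m
    by (induction m) (auto simp: scaleR_conv_of_real)
  then have s: "(\<Sum>i<step_index n t. step_size n *\<^sub>R ?rb i) = approx_b n t k - approx_b n 0 k" "(\<Sum>i<step_index n t. step_size n *\<^sub>R ?rw i) = approx_w n t k - approx_w n 0 k"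
    unfolding approx_b_def approx_w_def by simp_all
  have G: "Gb n = (\<lambda>s. ?rb (step_index n s))" "Gw n = (\<lambda>s. ?rw (step_index n s))" unfolding Gb_def Gw_def approx_b_def approx_w_def by auto
  show "(Gb n has_integral (approx_b n t k - approx_b n 0 k + (t - real (step_index n t) * step_size n) *\<^sub>R Gb n t)) {0..t}"
    using step_function_has_integral[OF step_size(1)[of n] t(2), of ?rb] unfolding G s .
  show "(Gw n has_integral (approx_w n t k - approx_w n 0 k + (t - real (step_index n t) * step_size n) *\<^sub>R Gw n t)) {0..t}"
    using step_function_has_integral[OF step_size(1)[of n] t(2), of ?rw] unfolding G s .
qed

text \<open>The approximations are supported in the box, so truncating the convolution loses
  nothing. The Galerkin system differs from the full one only by the projection of the output, and
  every fixed k eventually lies in the box.\<close>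

lemma rhs_eq_jac:
  assumes "k \<in> Box n"
  shows "rhsb (Box n) (approx_b n s) (approx_w n s) k = jac (psi (approx_w n s)) (approx_b n s) k"
    "rhsw (Box n) (approx_b n s) (approx_w n s) k = jac (psi (approx_w n s)) (\<lambda>k. approx_w n s k - approx_b n s k) k + jac \<xi> (approx_b n s) k"
  using assms good_approx[of n s] unfolding rhsb_def rhsw_def good_def
  by (simp_all add: jacA_eq_jac del: split_paired_All)

lemma psi_tendsto: "((\<lambda>n. w n k) \<longlongrightarrow> w' k) F \<Longrightarrow> ((\<lambda>n. psi (w n) k) \<longlongrightarrow> psi w' k) F"
  unfolding psi_def divide_inverse by (intro tendsto_intros)

text \<open>A common constant for \<open>jac_tendsto\<close>: 2 \<open>radius\<close> covers w - b,
  and \<open>radius\<close> + D 0 covers the stream functions.\<close>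

definition bound :: real where "bound = 2 * radius + D 0"

lemma psi_le_bound: assumes "hs 2 w" "nw 0 2 w \<le> radius" shows "hs 4 (psi w)" "nw 0 4 (psi w) \<le> bound"
  using psi_bounds[OF assms(1) order_refl] assms(2) nw_nonneg[of 0 4 \<xi>] radius_nonneg unfolding bound_def D_def
  by (assumption | linarith)+

theorem coefficient_solution:
  obtains vb vw :: "real \<Rightarrow> freq \<Rightarrow> complex" where
    "\<And>t. t \<in> {0..T} \<Longrightarrow> hs 3 (vb t) \<and> hs 2 (vw t) \<and> hermitian (vb t) \<and> hermitian (vw t)"
    "\<And>t. t \<in> {0..T} \<Longrightarrow> ((\<lambda>s. nw 0 3 (\<lambda>k. vb s k - vb t k)) \<longlongrightarrow> 0) (at t within {0..T})"
    "\<And>t. t \<in> {0..T} \<Longrightarrow> ((\<lambda>s. nw 0 2 (\<lambda>k. vw s k - vw t k)) \<longlongrightarrow> 0) (at t within {0..T})"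
    "\<And>t k. t \<in> {0..T} \<Longrightarrow> ((\<lambda>s. jac (psi (vw s)) (vb s) k) has_integral (vb t k - b0 k)) {0..t}"
    "\<And>t k. t \<in> {0..T} \<Longrightarrow> ((\<lambda>s. jac (psi (vw s)) (\<lambda>k. vw s k - vb s k) k + jac \<xi> (vb s) k) has_integral (vw t k - w0 k)) {0..t}"
proof -
  obtain r where r: "strict_mono r"
    "\<And>t k. t \<in> {0..T} \<Longrightarrow> convergent (\<lambda>n. approx_b (r n) t k)" "\<And>t k. t \<in> {0..T} \<Longrightarrow> convergent (\<lambda>n. approx_w (r n) t k)"
    by (rule convergent_subsequence) (rule that)
  define vb vw where "vb = (\<lambda>t k. lim (\<lambda>n. approx_b (r n) t k))" and "vw = (\<lambda>t k. lim (\<lambda>n. approx_w (r n) t k))"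
  have L: "(\<lambda>n. approx_b (r n) t k) \<longlonglongrightarrow> vb t k" "(\<lambda>n. approx_w (r n) t k) \<longlonglongrightarrow> vw t k" if "t \<in> {0..T}" for t k
    using r(2,3)[OF that] unfolding vb_def vw_def by (simp_all add: convergent_LIMSEQ_iff)
  have sub: "filterlim r sequentially sequentially" using r(1) by (rule filterlim_subseq)
  have inv: "(\<lambda>n. 1 / (real (r n) + 1)) \<longlonglongrightarrow> 0"
    using LIMSEQ_subseq_LIMSEQ[OF LIMSEQ_inverse_real_of_nat r(1)] by (simp add: o_def inverse_eq_divide add.commute)
  have dr: "(\<lambda>n. step_size (r n)) \<longlonglongrightarrow> 0"
    by (rule tendsto_sandwich[OF _ _ tendsto_const inv])
      (use step_size(1,3) in \<open>auto intro!: always_eventually less_imp_le\<close>)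
  have hx: "hs 3 (approx_b n t)" "hs 2 (approx_b n t)" "hs 2 (approx_w n t)" for n t using good_hs[OF finite_Box good_approx] by auto
  have bx: "nw 0 3 (approx_b n t) \<le> radius" "nw 0 2 (approx_b n t) \<le> radius" "nw 0 2 (approx_w n t) \<le> radius" if "t \<in> {0..T}" for n t
    using nw_le_sqrt_En(1)[of 0 "approx_b n t" "approx_w n t"] nw_le_sqrt_En(2)[of 0 "approx_w n t" "approx_b n t"] approx_le_radius[OF that, of n]
      hs_lower(2)[OF hx(1)[of n t], of 2] by linarith+
  have z: "vb t 0 = 0" "vw t 0 = 0" if "t \<in> {0..T}" for t
    using L[OF that, of 0] good_approx unfolding good_def by (simp_all add: LIMSEQ_const_iff)
  have nb: "l2 (\<lambda>k. mag k ^ 3 * cmod (vb t k))" "l2 (\<lambda>k. mag k ^ 2 * cmod (vw t k))" if t: "t \<in> {0..T}" for t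
  proof -
    show "l2 (\<lambda>k. mag k ^ 3 * cmod (vb t k))"
    proof (rule n2_le_pointwise_limit(1))
      show "(\<lambda>n. mag k ^ 3 * cmod (approx_b (r n) t k)) \<longlonglongrightarrow> mag k ^ 3 * cmod (vb t k)" for k by (intro tendsto_intros L t)
      show "\<forall>\<^sub>F n in sequentially. l2 (\<lambda>k. mag k ^ 3 * cmod (approx_b (r n) t k)) \<and> n2 (\<lambda>k. mag k ^ 3 * cmod (approx_b (r n) t k)) \<le> radius"
        using hx bx[OF t] by (intro always_eventually allI) (simp add: nw_0 hs_def)
    qed (rule tendsto_const)
    show "l2 (\<lambda>k. mag k ^ 2 * cmod (vw t k))"
    proof (rule n2_le_pointwise_limit(1))
      show "(\<lambda>n. mag k ^ 2 * cmod (approx_w (r n) t k)) \<longlonglongrightarrow> mag k ^ 2 * cmod (vw t k)" for k by (intro tendsto_intros L t)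
      show "\<forall>\<^sub>F n in sequentially. l2 (\<lambda>k. mag k ^ 2 * cmod (approx_w (r n) t k)) \<and> n2 (\<lambda>k. mag k ^ 2 * cmod (approx_w (r n) t k)) \<le> radius"
        using hx bx[OF t] by (intro always_eventually allI) (simp add: nw_0 hs_def)
    qed (rule tendsto_const)
  qed
  have hv: "hs 3 (vb t)" "hs 2 (vw t)" if "t \<in> {0..T}" for t using nb[OF that] z[OF that] by (auto simp: hs_def)
  \<comment> \<open>The same \<open>tau\<close> serves all times, so
    \<open>tendsto_nw_of_tails\<close> can be applied with the filter of times near t.\<close>
  have tails: "nw (real m) 3 (vb t) \<le> tau m" "nw (real m) 2 (vw t) \<le> tau m" if t: "t \<in> {0..T}" for m t
  proof -
    let ?M = "\<lambda>n. sqrt (exp (2 * tail_rate) * (En (real m) b0 w0 + (tail_rate * (D (real m))\<^sup>2 + 1 / (real (r n) + 1))))"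
    have "?M \<longlonglongrightarrow> sqrt (exp (2 * tail_rate) * (En (real m) b0 w0 + (tail_rate * (D (real m))\<^sup>2 + 0)))"
      by (intro tendsto_intros inv)
    then have M: "?M \<longlonglongrightarrow> tau m" by (simp add: tau_def)
    show "nw (real m) 3 (vb t) \<le> tau m" unfolding nw_def
    proof (rule n2_le_pointwise_limit(2)[OF _ _ M])
      show "(\<lambda>n. wt (real m) 3 k * cmod (approx_b (r n) t k)) \<longlonglongrightarrow> wt (real m) 3 k * cmod (vb t k)" for k by (intro tendsto_intros L t)
      show "\<forall>\<^sub>F n in sequentially. l2 (\<lambda>k. wt (real m) 3 k * cmod (approx_b (r n) t k)) \<and> n2 (\<lambda>k. wt (real m) 3 k * cmod (approx_b (r n) t k)) \<le> ?M n"
        using hs_l2_wt[OF hx(1)] order_trans[OF nw_le_sqrt_En(1) approx_tail[OF t]]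
        by (intro always_eventually allI) (simp add: nw_def)
    qed
    show "nw (real m) 2 (vw t) \<le> tau m" unfolding nw_def
    proof (rule n2_le_pointwise_limit(2)[OF _ _ M])
      show "(\<lambda>n. wt (real m) 2 k * cmod (approx_w (r n) t k)) \<longlonglongrightarrow> wt (real m) 2 k * cmod (vw t k)" for k by (intro tendsto_intros L t)
      show "\<forall>\<^sub>F n in sequentially. l2 (\<lambda>k. wt (real m) 2 k * cmod (approx_w (r n) t k)) \<and> n2 (\<lambda>k. wt (real m) 2 k * cmod (approx_w (r n) t k)) \<le> ?M n"
        using hs_l2_wt[OF hx(3)] order_trans[OF nw_le_sqrt_En(2) approx_tail[OF t]]
        by (intro always_eventually allI) (simp add: nw_def)
    qed
  qed
  have her: "hermitian (vb t)" "hermitian (vw t)" if t: "t \<in> {0..T}" for t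
  proof -
    have x: "approx_b (r n) t (- k) = cnj (approx_b (r n) t k)" "approx_w (r n) t (- k) = cnj (approx_w (r n) t k)" for n k
      using good_approx[of "r n" t] unfolding good_def hermitian_def by blast+
    have "vb t (- k) = cnj (vb t k)" "vw t (- k) = cnj (vw t k)" for k
      using LIMSEQ_unique[OF L(1)[OF t, of "- k", unfolded x] tendsto_cnj[OF L(1)[OF t]]]
        LIMSEQ_unique[OF L(2)[OF t, of "- k", unfolded x] tendsto_cnj[OF L(2)[OF t]]] by blast+
    then show "hermitian (vb t)" "hermitian (vw t)" unfolding hermitian_def by blast+
  qed
  have lipv: "cmod (vb s k - vb t k) \<le> lip * \<bar>s - t\<bar>" "cmod (vw s k - vw t k) \<le> lip * \<bar>s - t\<bar>"
    if st: "s \<in> {0..T}" "t \<in> {0..T}" for s t k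
  proof -
    have B: "(\<lambda>n. lip * (\<bar>s - t\<bar> + step_size (r n))) \<longlonglongrightarrow> lip * \<bar>s - t\<bar>"
      using tendsto_mult[OF tendsto_const tendsto_add[OF tendsto_const dr], of lip "\<bar>s - t\<bar>"] by simp
    show "cmod (vb s k - vb t k) \<le> lip * \<bar>s - t\<bar>"
      by (rule LIMSEQ_le[OF tendsto_norm[OF tendsto_diff[OF L(1)[OF st(1)] L(1)[OF st(2)]]] B]) (use approx_lipschitz(1)[OF st(2,1)] in auto)
    show "cmod (vw s k - vw t k) \<le> lip * \<bar>s - t\<bar>"
      by (rule LIMSEQ_le[OF tendsto_norm[OF tendsto_diff[OF L(2)[OF st(1)] L(2)[OF st(2)]]] B]) (use approx_lipschitz(2)[OF st(2,1)] in auto)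
  qed
  have cc: "((\<lambda>s. v s k) \<longlongrightarrow> v t k) (at t within {0..T})"
    if t: "t \<in> {0..T}" and lv: "\<And>s. s \<in> {0..T} \<Longrightarrow> cmod (v s k - v t k) \<le> lip * \<bar>s - t\<bar>" for v :: "real \<Rightarrow> freq \<Rightarrow> complex" and t k
  proof -
    have "((\<lambda>s. lip * \<bar>s - t\<bar>) \<longlongrightarrow> lip * \<bar>t - t\<bar>) (at t within {0..T})" by (intro tendsto_intros)
    then have "((\<lambda>s. lip * \<bar>s - t\<bar>) \<longlongrightarrow> 0) (at t within {0..T})" by simp
    then have "((\<lambda>s. v s k - v t k) \<longlongrightarrow> 0) (at t within {0..T})"
      by (rule Lim_null_comparison[rotated]) (use lv in \<open>auto simp: eventually_at_filter\<close>)
    then show ?thesis by (simp add: LIM_zero_iff)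
  qed
  have evT: "eventually (\<lambda>s. s \<in> {0..T}) (at t within {0..T})" for t by (auto simp: eventually_at_filter)
  have x0: "approx_b n 0 k = (if k \<in> Box n then b0 k else 0)" "approx_w n 0 k = (if k \<in> Box n then w0 k else 0)" for n k
    by (simp_all add: approx_b_def approx_w_def)
  have ev0: "\<forall>\<^sub>F n in sequentially. k \<in> Box (r n)" for k
    using sub eventually_mem_Box[of k] unfolding filterlim_iff by blast
  have L0: "(\<lambda>n. approx_b (r n) 0 k) \<longlonglongrightarrow> b0 k" "(\<lambda>n. approx_w (r n) 0 k) \<longlonglongrightarrow> w0 k" for k
    by (rule tendsto_eventually, use ev0[of k] in \<open>eventually_elim, simp add: x0\<close>)+
  have LJ: "(\<lambda>n. rhsb (Box (r n)) (approx_b (r n) s) (approx_w (r n) s) k) \<longlonglongrightarrow> jac (psi (vw s)) (vb s) k"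
    "(\<lambda>n. rhsw (Box (r n)) (approx_b (r n) s) (approx_w (r n) s) k) \<longlonglongrightarrow> jac (psi (vw s)) (\<lambda>k. vw s k - vb s k) k + jac \<xi> (vb s) k"
    if s: "s \<in> {0..T}" for s k
  proof -
    have rb: "radius \<le> bound" "2 * radius \<le> bound" using radius_nonneg D_nonneg[of 0] by (auto simp: bound_def)
    have xi: "nw 0 4 \<xi> \<le> bound" unfolding bound_def D_def using radius_nonneg nw_nonneg[of 0 2 f] by linarith
    have d: "nw 0 2 (\<lambda>k. approx_w n s k - approx_b n s k) \<le> bound" for n
      using nw_diff_le[OF hx(3) hx(2) order_refl, of n s n s] bx[OF s, of n] rb by linarith
    have 1: "(\<lambda>n. jac (psi (approx_w (r n) s)) (approx_b (r n) s) k) \<longlonglongrightarrow> jac (psi (vw s)) (vb s) k"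
      by (rule jac_tendsto[where C = bound]) (use psi_le_bound hx bx[OF s] rb in \<open>auto intro!: psi_tendsto L s always_eventually intro: order_trans[OF bx(2)[OF s] rb(1)]\<close>)
    have 2: "(\<lambda>n. jac (psi (approx_w (r n) s)) (\<lambda>k. approx_w (r n) s k - approx_b (r n) s k) k) \<longlonglongrightarrow> jac (psi (vw s)) (\<lambda>k. vw s k - vb s k) k"
      by (rule jac_tendsto[where C = bound]) (use psi_le_bound hx bx[OF s] d in \<open>auto intro!: psi_tendsto L s always_eventually tendsto_diff hs_diff\<close>)
    have 3: "(\<lambda>n. jac \<xi> (approx_b (r n) s) k) \<longlonglongrightarrow> jac \<xi> (vb s) k"
      by (rule jac_tendsto[where C = bound]) (use \<xi> xi hx in \<open>auto intro!: L s always_eventually order_trans[OF bx(2)[OF s] rb(1)]\<close>)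
    show "(\<lambda>n. rhsb (Box (r n)) (approx_b (r n) s) (approx_w (r n) s) k) \<longlonglongrightarrow> jac (psi (vw s)) (vb s) k"
      by (rule Lim_transform_eventually[OF 1]) (use ev0[of k] in \<open>eventually_elim, simp add: rhs_eq_jac\<close>)
    show "(\<lambda>n. rhsw (Box (r n)) (approx_b (r n) s) (approx_w (r n) s) k) \<longlonglongrightarrow> jac (psi (vw s)) (\<lambda>k. vw s k - vb s k) k + jac \<xi> (vb s) k"
      by (rule Lim_transform_eventually[OF tendsto_add[OF 2 3]]) (use ev0[of k] in \<open>eventually_elim, simp add: rhs_eq_jac\<close>)
  qed
  have rl: "cmod (rhsb (Box n) (approx_b n s) (approx_w n s) k) \<le> lip" "cmod (rhsw (Box n) (approx_b n s) (approx_w n s) k) \<le> lip" if "s \<in> {0..T}" for n s k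
    using rhs_bounds[OF finite_Box good_approx approx_le_radius[OF that]] by (auto simp: lip_def)
  \<comment> \<open>Dominated convergence in time with the constant \<open>lip\<close> as majorant;
    the remainder from the incomplete Euler step is at most
    \<open>step_size (r n) * lip\<close>.\<close>
  have lim_int: "(J has_integral (l - l0)) {0..t}"
    if t: "t \<in> {0..T}" and G: "\<And>n. (G n has_integral (y n - y0 n + (t - real (step_index (r n) t) * step_size (r n)) *\<^sub>R G n t)) {0..t}"
      and bd: "\<And>n s. s \<in> {0..T} \<Longrightarrow> cmod (G n s) \<le> lip" and lm: "\<And>s. s \<in> {0..T} \<Longrightarrow> (\<lambda>n. G n s) \<longlonglongrightarrow> J s"
      and y: "y \<longlonglongrightarrow> l" "y0 \<longlonglongrightarrow> l0" for G :: "nat \<Rightarrow> real \<Rightarrow> complex" and J y y0 l l0 t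
  proof -
    have i: "G n integrable_on {0..t}" for n using G by blast
    have c: "(\<lambda>_. lip) integrable_on {0..t}" by (rule integrable_const_ivl)
    have dc: "J integrable_on {0..t}" "(\<lambda>n. integral {0..t} (G n)) \<longlonglongrightarrow> integral {0..t} J"
      using dominated_convergence[of G "{0..t}" "\<lambda>_. lip" J, OF i c] t bd lm by auto
    have e: "(\<lambda>n. (t - real (step_index (r n) t) * step_size (r n)) *\<^sub>R G n t) \<longlonglongrightarrow> 0"
    proof (rule Lim_null_comparison)
      show "(\<lambda>n. step_size (r n) * lip) \<longlonglongrightarrow> 0" using tendsto_mult[OF dr tendsto_const[of lip]] by simp
      have "norm ((t - real (step_index (r n) t) * step_size (r n)) *\<^sub>R G n t) \<le> step_size (r n) * lip" for n
        unfolding norm_scaleR using step_index[of t "r n"] t bd[OF t, of n] step_size(1)[of "r n"]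
        by (intro mult_mono) (auto simp: algebra_simps)
      then show "\<forall>\<^sub>F n in sequentially. norm ((t - real (step_index (r n) t) * step_size (r n)) *\<^sub>R G n t) \<le> step_size (r n) * lip" by simp
    qed
    have "(\<lambda>n. y n - y0 n + (t - real (step_index (r n) t) * step_size (r n)) *\<^sub>R G n t) \<longlonglongrightarrow> l - l0 + 0"
      by (intro tendsto_intros y e)
    moreover have "integral {0..t} (G n) = y n - y0 n + (t - real (step_index (r n) t) * step_size (r n)) *\<^sub>R G n t" for n
      using G by (rule integral_unique)
    ultimately have "(\<lambda>n. integral {0..t} (G n)) \<longlonglongrightarrow> l - l0" by simp
    then have "integral {0..t} J = l - l0" using dc(2) LIMSEQ_unique by blast
    then show ?thesis using dc(1) by (metis has_integral_integral)
  qed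
  show ?thesis
  proof (rule that[of vb vw])
    fix t assume t: "t \<in> {0..T}"
    show "hs 3 (vb t) \<and> hs 2 (vw t) \<and> hermitian (vb t) \<and> hermitian (vw t)" using hv her t by auto
    show "((\<lambda>s. nw 0 3 (\<lambda>k. vb s k - vb t k)) \<longlongrightarrow> 0) (at t within {0..T})"
      by (rule tendsto_nw_of_tails[OF _ hv(1)[OF t] _ _ tails(1)[OF t] tendsto_tau])
        (use evT[of t] hv tails lipv t in \<open>auto elim!: eventually_mono intro!: cc\<close>)
    show "((\<lambda>s. nw 0 2 (\<lambda>k. vw s k - vw t k)) \<longlongrightarrow> 0) (at t within {0..T})"
      by (rule tendsto_nw_of_tails[OF _ hv(2)[OF t] _ _ tails(2)[OF t] tendsto_tau])
        (use evT[of t] hv tails lipv t in \<open>auto elim!: eventually_mono intro!: cc\<close>)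
  next
    fix t k assume t: "t \<in> {0..T}"
    then have t0: "0 \<le> t" by simp
    show "((\<lambda>s. jac (psi (vw s)) (vb s) k) has_integral (vb t k - b0 k)) {0..t}"
      by (rule lim_int[OF t approx_integral(1)[OF t t0] rl(1) LJ(1) L(1)[OF t] L0(1)])
    show "((\<lambda>s. jac (psi (vw s)) (\<lambda>k. vw s k - vb s k) k + jac \<xi> (vb s) k) has_integral (vw t k - w0 k)) {0..t}"
      by (rule lim_int[OF t approx_integral(2)[OF t t0] rl(2) LJ(2) L(2)[OF t] L0(2)])
  qed
qed

end

section \<open>Characters and Fourier coefficients on the torus\<close>

lemma torus_cell: "{0..1::real} \<times> {0..1::real} = cbox (0, 0) (1, 1)"
  by (auto simp: cbox_Pair_eq)

lemma torus_cell_sets [measurable, simp]: "{0..1::real} \<times> {0..1::real} \<in> sets borel"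
  unfolding torus_cell by simp

lemma space_torus [simp]: "space torus = {0..1} \<times> {0..1}"
  by (simp add: torus_def space_restrict_space)

lemma borel_measurable_torus [measurable_dest]: "f \<in> borel_measurable borel \<Longrightarrow> f \<in> borel_measurable torus"
  unfolding torus_def by (rule measurable_restrict_space1) simp

lemma emeasure_torus: "emeasure torus (space torus) = 1"
proof -
  have "emeasure torus (space torus) = emeasure lborel (cbox (0, 0) (1::real, 1::real))"
    unfolding space_torus unfolding torus_def by (subst emeasure_restrict_space) (auto simp: torus_cell)
  also have "\<dots> = 1" by (simp add: emeasure_lborel_cbox_eq Basis_prod_def)
  finally show ?thesis .
qed

interpretation torus: finite_measure torus
  by (rule finite_measureI) (simp add: emeasure_torus del: space_torus)

lemma measure_torus [simp]: "Sigma_Algebra.measure torus ({0..1} \<times> {0..1}) = 1"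
  using emeasure_torus by (simp add: measure_def)

lemma borel_measurable_torus_continuous:
  "continuous_on UNIV f \<Longrightarrow> f \<in> borel_measurable torus"
  by (intro borel_measurable_torus borel_measurable_continuous_onI)

lemma integrable_torus_bounded:
  fixes f :: "real \<times> real \<Rightarrow> 'a::{banach, second_countable_topology}"
  assumes "f \<in> borel_measurable torus" "\<And>p. norm (f p) \<le> B"
  shows "integrable torus f"
  by (rule torus.integrable_const_bound[of _ B]) (use assms in auto)

lemma integral_torus_eq:
  fixes g :: "real \<times> real \<Rightarrow> real"
  assumes "continuous_on UNIV g"
  shows "integrable torus g" "(\<integral>p. g p \<partial>torus) = integral (cbox (0, 0) (1, 1)) g"
proof -
  have c: "continuous_on (cbox (0, 0) (1, 1)) g" using assms continuous_on_subset by blast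
  have i: "integrable lborel (\<lambda>x. indicator (cbox (0, 0) (1, 1)) x *\<^sub>R g x)"
    by (rule borel_integrable_compact[OF compact_cbox c])
  then show "integrable torus g"
    unfolding torus_def torus_cell by (subst integrable_restrict_space) auto
  have "(\<integral>p. g p \<partial>torus) = (LINT x : cbox (0, 0) (1, 1)|lborel. g x)"
    unfolding torus_def torus_cell by (subst integral_restrict_space) (auto simp: set_lebesgue_integral_def)
  also have "\<dots> = integral (cbox (0, 0) (1, 1)) g"
    by (rule set_borel_integral_eq_integral(2)) (use i in \<open>simp add: set_integrable_def\<close>)
  finally show "(\<integral>p. g p \<partial>torus) = integral (cbox (0, 0) (1, 1)) g" .
qed

section \<open>Test functions and integration by parts on the torus\<close>

lemma smooth_cases: assumes "smooth \<phi>"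
  shows "\<phi> differentiable (at p)" "smooth (pdx \<phi>)" "smooth (pdy \<phi>)"
  using assms by (auto elim: smooth.cases)

lemma smooth_continuous: "smooth \<phi> \<Longrightarrow> continuous_on S \<phi>"
  by (intro continuous_at_imp_continuous_on ballI differentiable_imp_continuous_within smooth_cases(1))

lemma smooth_has_partial:
  assumes "smooth \<phi>"
  shows "((\<lambda>s. \<phi> (s, y)) has_real_derivative pdx \<phi> (x, y)) (at x)"
    "((\<lambda>s. \<phi> (x, s)) has_real_derivative pdy \<phi> (x, y)) (at y)"
proof -
  have "((\<lambda>s. (s, y)) has_derivative (\<lambda>h. (h, 0))) (at x)" "((\<lambda>s. (x, s)) has_derivative (\<lambda>h. (0, h))) (at y)"
    by (intro has_derivative_Pair has_derivative_ident has_derivative_const)+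
  from this[THEN differentiableI]
  have "(\<phi> \<circ> (\<lambda>s. (s, y))) differentiable (at x)" "(\<phi> \<circ> (\<lambda>s. (x, s))) differentiable (at y)"
    by (auto intro!: differentiable_chain_at smooth_cases(1)[OF assms])
  then have "(\<lambda>s. \<phi> (s, y)) differentiable (at x)" "(\<lambda>s. \<phi> (x, s)) differentiable (at y)"
    unfolding o_def .
  then show "((\<lambda>s. \<phi> (s, y)) has_real_derivative pdx \<phi> (x, y)) (at x)"
    "((\<lambda>s. \<phi> (x, s)) has_real_derivative pdy \<phi> (x, y)) (at y)"
    by (auto simp: pdx_def pdy_def DERIV_deriv_iff_real_differentiable)
qed

lemma test_functions_pd:
  assumes "\<phi> \<in> test_functions" shows "pdx \<phi> \<in> test_functions" "pdy \<phi> \<in> test_functions"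
proof -
  have s: "smooth \<phi>" and p: "\<And>x y. \<phi> (x + 1, y) = \<phi> (x, y)" "\<And>x y. \<phi> (x, y + 1) = \<phi> (x, y)"
    using assms by (auto simp: test_functions_def)
  have "pdx \<phi> (x + 1, y) = pdx \<phi> (x, y)" for x y
  proof -
    have "((\<lambda>s. \<phi> (s + 1, y)) has_real_derivative pdx \<phi> (x + 1, y)) (at x)"
      using smooth_has_partial(1)[OF s, of y "x + 1"] by (rule iffD1[OF DERIV_shift])
    then show ?thesis using smooth_has_partial(1)[OF s, of y x] unfolding p by (rule DERIV_unique)
  qed
  moreover have "pdy \<phi> (x, y + 1) = pdy \<phi> (x, y)" for x y
  proof -
    have "((\<lambda>s. \<phi> (x, s + 1)) has_real_derivative pdy \<phi> (x, y + 1)) (at y)"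
      using smooth_has_partial(2)[OF s, of x "y + 1"] by (rule iffD1[OF DERIV_shift])
    then show ?thesis using smooth_has_partial(2)[OF s, of x y] unfolding p by (rule DERIV_unique)
  qed
  moreover have "pdx \<phi> (x, y + 1) = pdx \<phi> (x, y)" "pdy \<phi> (x + 1, y) = pdy \<phi> (x, y)" for x y
    by (simp_all add: pdx_def pdy_def p)
  ultimately show "pdx \<phi> \<in> test_functions" "pdy \<phi> \<in> test_functions"
    using smooth_cases[OF s] by (auto simp: test_functions_def)
qed

text \<open>The integral in x vanishes by the fundamental theorem of calculus and periodicity;
  exchanging the order of integration brings it to the inside.\<close>

lemma integral_partial_eq_0:
  fixes F G :: "real \<times> real \<Rightarrow> real"
  assumes G: "continuous_on UNIV G" and p: "\<And>x y. F (x + 1, y) = F (x, y)"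
    and d: "\<And>x y. ((\<lambda>s. F (s, y)) has_real_derivative G (x, y)) (at x)"
  shows "(\<integral>p. G p \<partial>torus) = 0"
proof -
  have x0: "integral {0..1} (\<lambda>x. G (x, y)) = 0" for y
  proof -
    have "((\<lambda>x. G (x, y)) has_integral F (1, y) - F (0, y)) {0..1}"
      by (rule fundamental_theorem_of_calculus)
        (auto simp: has_real_derivative_iff_has_vector_derivative[symmetric] intro!: DERIV_subset[OF d])
    then show ?thesis using p[of 0 y] by (simp add: integral_unique)
  qed
  have c: "continuous_on S G" for S using G continuous_on_subset by blast
  have "(\<integral>p. G p \<partial>torus) = integral (cbox (0::real) 1) (\<lambda>x. integral (cbox (0::real) 1) (\<lambda>y. G (x, y)))"
    by (simp only: integral_torus_eq(2)[OF c] integral_prod_continuous[OF c])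
  also have "\<dots> = integral (cbox (0::real) 1) (\<lambda>y. integral (cbox (0::real) 1) (\<lambda>x. G (x, y)))"
    by (rule integral_swap_continuous) (use c in \<open>simp add: case_prod_beta\<close>)
  finally show ?thesis by (simp add: x0)
qed

lemma integral_partial_eq_0':
  fixes F G :: "real \<times> real \<Rightarrow> real"
  assumes G: "continuous_on UNIV G" and p: "\<And>x y. F (x, y + 1) = F (x, y)"
    and d: "\<And>x y. ((\<lambda>s. F (x, s)) has_real_derivative G (x, y)) (at y)"
  shows "(\<integral>p. G p \<partial>torus) = 0"
proof -
  have y0: "integral {0..1} (\<lambda>y. G (x, y)) = 0" for x
  proof -
    have "((\<lambda>y. G (x, y)) has_integral F (x, 1) - F (x, 0)) {0..1}"
      by (rule fundamental_theorem_of_calculus)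
        (auto simp: has_real_derivative_iff_has_vector_derivative[symmetric] intro!: DERIV_subset[OF d])
    then show ?thesis using p[of x 0] by (simp add: integral_unique)
  qed
  have c: "continuous_on S G" for S using G continuous_on_subset by blast
  have "(\<integral>p. G p \<partial>torus) = integral (cbox (0::real) 1) (\<lambda>x. integral (cbox (0::real) 1) (\<lambda>y. G (x, y)))"
    by (simp only: integral_torus_eq(2)[OF c] integral_prod_continuous[OF c])
  then show ?thesis by (simp add: y0)
qed

lemma integral_pd_mult:
  assumes "\<phi> \<in> test_functions" "\<theta> \<in> test_functions"
  shows "(\<integral>p. pdx \<phi> p * \<theta> p \<partial>torus) = - (\<integral>p. \<phi> p * pdx \<theta> p \<partial>torus)"
    "(\<integral>p. pdy \<phi> p * \<theta> p \<partial>torus) = - (\<integral>p. \<phi> p * pdy \<theta> p \<partial>torus)"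
proof -
  have s: "smooth \<phi>" "smooth \<theta>" and p: "\<And>x y. \<phi> (x + 1, y) = \<phi> (x, y)" "\<And>x y. \<phi> (x, y + 1) = \<phi> (x, y)"
      "\<And>x y. \<theta> (x + 1, y) = \<theta> (x, y)" "\<And>x y. \<theta> (x, y + 1) = \<theta> (x, y)"
    using assms by (auto simp: test_functions_def)
  have c: "continuous_on UNIV (pdx \<phi>)" "continuous_on UNIV (pdy \<phi>)" "continuous_on UNIV (pdx \<theta>)"
      "continuous_on UNIV (pdy \<theta>)" "continuous_on UNIV \<phi>" "continuous_on UNIV \<theta>"
    using smooth_cases[OF s(1)] smooth_cases[OF s(2)] s by (auto intro: smooth_continuous)
  have "(\<integral>p. pdx \<phi> p * \<theta> p + \<phi> p * pdx \<theta> p \<partial>torus) = 0"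
    by (rule integral_partial_eq_0[where F = "\<lambda>p. \<phi> p * \<theta> p"])
      (auto intro!: continuous_intros c derivative_eq_intros smooth_has_partial s simp: p)
  then show "(\<integral>p. pdx \<phi> p * \<theta> p \<partial>torus) = - (\<integral>p. \<phi> p * pdx \<theta> p \<partial>torus)"
    by (subst (asm) Bochner_Integration.integral_add) (auto intro!: integral_torus_eq continuous_intros c)
  have "(\<integral>p. pdy \<phi> p * \<theta> p + \<phi> p * pdy \<theta> p \<partial>torus) = 0"
    by (rule integral_partial_eq_0'[where F = "\<lambda>p. \<phi> p * \<theta> p"])
      (auto intro!: continuous_intros c derivative_eq_intros smooth_has_partial s simp: p)
  then show "(\<integral>p. pdy \<phi> p * \<theta> p \<partial>torus) = - (\<integral>p. \<phi> p * pdy \<theta> p \<partial>torus)"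
    by (subst (asm) Bochner_Integration.integral_add) (auto intro!: integral_torus_eq continuous_intros c)
qed

lemma integral_pd_eq_0:
  assumes "\<phi> \<in> test_functions"
  shows "(\<integral>p. pdx \<phi> p \<partial>torus) = 0" "(\<integral>p. pdy \<phi> p \<partial>torus) = 0"
proof -
  have s: "smooth \<phi>" and p: "\<And>x y. \<phi> (x + 1, y) = \<phi> (x, y)" "\<And>x y. \<phi> (x, y + 1) = \<phi> (x, y)"
    using assms by (auto simp: test_functions_def)
  show "(\<integral>p. pdx \<phi> p \<partial>torus) = 0"
    by (rule integral_partial_eq_0[OF _ p(1) smooth_has_partial(1)[OF s]]) (use smooth_cases[OF s] in \<open>auto intro: smooth_continuous\<close>)
  show "(\<integral>p. pdy \<phi> p \<partial>torus) = 0"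
    by (rule integral_partial_eq_0'[OF _ p(2) smooth_has_partial(2)[OF s]]) (use smooth_cases[OF s] in \<open>auto intro: smooth_continuous\<close>)
qed

section \<open>Characters and real trigonometric test functions\<close>

definition ee :: "freq \<Rightarrow> real \<times> real \<Rightarrow> complex" where
  "ee k p = cis (2 * pi * (real_of_int (fst k) * fst p + real_of_int (snd k) * snd p))"

lemma ee_add: "ee (k + l) p = ee k p * ee l p"
  by (simp add: ee_def cis_mult algebra_simps)

lemma ee_0 [simp]: "ee 0 p = 1" by (simp add: ee_def)

lemma cnj_ee: "cnj (ee k p) = ee (- k) p"
  by (simp add: ee_def cis_cnj algebra_simps)

lemma norm_ee [simp]: "cmod (ee k p) = 1" by (simp add: ee_def)

lemma continuous_ee [continuous_intros]: "continuous_on S (ee k)"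
  unfolding ee_def by (intro continuous_intros)

lemma measurable_ee [measurable]: "ee k \<in> borel_measurable torus"
  by (intro borel_measurable_torus_continuous continuous_intros)

lemma ee_periodic [simp]: "ee k (x + 1, y) = ee k (x, y)" "ee k (x, y + 1) = ee k (x, y)"
proof -
  have c: "cis (t + 2 * pi * of_int m) = cis t" for t m
    using cis_mult[of t "2 * pi * of_int m"] cis_multiple_2pi[of "of_int m"] by simp
  show "ee k (x + 1, y) = ee k (x, y)" "ee k (x, y + 1) = ee k (x, y)"
    using c[of "2 * pi * (fst k * x + snd k * y)" "fst k"] c[of "2 * pi * (fst k * x + snd k * y)" "snd k"]
    by (simp_all add: ee_def algebra_simps)
qed

text \<open>With a complex amplitude \<open>c\<close>, differentiation is multiplication of \<open>c\<close> by a constant.\<close>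

definition tg :: "complex \<Rightarrow> freq \<Rightarrow> real \<times> real \<Rightarrow> real" where
  "tg c k p = Re (c * ee k p)"

definition dx :: "freq \<Rightarrow> complex" where "dx k = 2 * pi * \<i> * of_int (fst k)"
definition dy :: "freq \<Rightarrow> complex" where "dy k = 2 * pi * \<i> * of_int (snd k)"

lemma tg_pd: "pdx (tg c k) = tg (dx k * c) k" "pdy (tg c k) = tg (dy k * c) k"
proof -
  have e: "tg c k p = Re c * cos (2 * pi * (real_of_int (fst k) * fst p + real_of_int (snd k) * snd p))
     - Im c * sin (2 * pi * (real_of_int (fst k) * fst p + real_of_int (snd k) * snd p))" for c k p
    by (simp add: tg_def ee_def)
  show "pdx (tg c k) = tg (dx k * c) k"
    unfolding pdx_def e by (auto simp: fun_eq_iff dx_def intro!: DERIV_imp_deriv derivative_eq_intros)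
  show "pdy (tg c k) = tg (dy k * c) k"
    unfolding pdy_def e by (auto simp: fun_eq_iff dy_def intro!: DERIV_imp_deriv derivative_eq_intros)
qed

lemma tg_differentiable: "tg c k differentiable (at p)"
proof -
  have e: "tg c k = (\<lambda>p. Re c * cos (2 * pi * (real_of_int (fst k) * fst p + real_of_int (snd k) * snd p))
     - Im c * sin (2 * pi * (real_of_int (fst k) * fst p + real_of_int (snd k) * snd p)))"
    by (simp add: fun_eq_iff tg_def ee_def)
  show ?thesis unfolding e differentiable_def by (rule exI) (rule derivative_eq_intros refl)+
qed

lemma smooth_tg: "smooth (tg c k)"
proof -
  have "\<exists>c. tg c k = tg c' k" for c' by blast
  then show ?thesis
  proof (coinduction arbitrary: c)
    case smooth
    show ?case using tg_pd[of _ k] tg_differentiable by auto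
  qed
qed

lemma tg_test_function: "tg c k \<in> test_functions"
  by (simp add: test_functions_def smooth_tg) (simp add: tg_def)

lemma tg_iterated_pd: "(pdx ^^ i) ((pdy ^^ j) (tg c k)) = tg (dx k ^ i * dy k ^ j * c) k"
proof -
  have "(pdy ^^ j) (tg c k) = tg (dy k ^ j * c) k" for c by (induction j) (auto simp: tg_pd mult_ac)
  moreover have "(pdx ^^ i) (tg c k) = tg (dx k ^ i * c) k" for c by (induction i) (auto simp: tg_pd mult_ac)
  ultimately show ?thesis by (simp add: mult_ac)
qed

text \<open>A nontrivial character is a partial derivative of a periodic function, hence integrates
  to 0; real parts suffice because the amplitude c is arbitrary.\<close>

lemma integral_ee: "(\<integral>p. ee k p \<partial>torus) = (if k = 0 then 1 else 0)"
proof (cases "k = 0")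
  case True then show ?thesis by simp
next
  case False
  have i: "integrable torus (ee k)" by (rule integrable_torus_bounded[of _ 1]) auto
  have "(\<integral>p. tg c k p \<partial>torus) = 0" for c
  proof (cases "fst k = 0")
    case True
    then have "dy k \<noteq> 0" using False by (auto simp: dy_def prod_eq_iff)
    then have "tg c k = pdy (tg (c / dy k) k)" by (simp add: tg_pd)
    then show ?thesis using integral_pd_eq_0(2)[OF tg_test_function] by metis
  next
    case False
    then have "dx k \<noteq> 0" by (auto simp: dx_def)
    then have "tg c k = pdx (tg (c / dx k) k)" by (simp add: tg_pd)
    then show ?thesis using integral_pd_eq_0(1)[OF tg_test_function] by metis
  qed
  moreover have "(\<integral>p. tg c k p \<partial>torus) = Re (c * (\<integral>p. ee k p \<partial>torus))" for c
    unfolding tg_def using i by (simp add: integral_Re[symmetric] del: times_complex.sel)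
  ultimately have z: "Re (c * (\<integral>p. ee k p \<partial>torus)) = 0" for c by simp
  have "Re (1 * (\<integral>p. ee k p \<partial>torus)) = 0" "Re (\<i> * (\<integral>p. ee k p \<partial>torus)) = 0" by (fact z)+
  then show ?thesis using False by (simp add: complex_eq_iff)
qed

section \<open>Fourier coefficients of integrable functions\<close>

definition ft :: "(real \<times> real \<Rightarrow> real) \<Rightarrow> freq \<Rightarrow> complex" where
  "ft f k = (\<integral>p. of_real (f p) * ee (- k) p \<partial>torus)"

lemma cnj_ft: "cnj (ft f k) = (\<integral>p. complex_of_real (f p) * ee k p \<partial>torus)"
  unfolding ft_def by (simp add: cnj_ee flip: Bochner_Integration.integral_cnj)

lemma integrable_mult_ee: assumes "integrable torus f" shows "integrable torus (\<lambda>p. complex_of_real (f p) * ee k p)"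
proof (rule Bochner_Integration.integrable_bound[OF assms])
  show "(\<lambda>p. complex_of_real (f p) * ee k p) \<in> borel_measurable torus" using assms by measurable
qed (auto simp: norm_mult)

text \<open>A real test function sees only a real part, but c = 1 and c = \<i> together recover the
  whole coefficient. Identities against test functions become identities of coefficients this
  way.\<close>

lemma integral_mult_tg:
  assumes "integrable torus f"
  shows "integrable torus (\<lambda>p. f p * tg c k p)" "(\<integral>p. f p * tg c k p \<partial>torus) = Re (c * cnj (ft f k))"
proof -
  note i = integrable_mult_ee[OF assms, of k]
  have e: "f p * tg c k p = Re (c * (complex_of_real (f p) * ee k p))" for p
    by (simp add: tg_def algebra_simps)
  show "integrable torus (\<lambda>p. f p * tg c k p)" unfolding e by (intro integrable_Re integrable_mult_right i)
  show "(\<integral>p. f p * tg c k p \<partial>torus) = Re (c * cnj (ft f k))"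
    unfolding e integral_Re[OF integrable_mult_right[OF i]] cnj_ft by simp
qed

lemma hermitian_ft: "hermitian (ft f)"
  unfolding hermitian_def cnj_ft by (simp add: ft_def)

lemma ft_add: "integrable torus f \<Longrightarrow> integrable torus g \<Longrightarrow> ft (\<lambda>p. f p + g p) k = ft f k + ft g k"
  unfolding ft_def by (subst Bochner_Integration.integral_add[symmetric]) (auto intro: integrable_mult_ee simp: algebra_simps)

lemma ft_cmult: "ft (\<lambda>p. c * f p) k = of_real c * ft f k"
  unfolding ft_def by (simp add: mult.assoc)

lemma ft_cong_AE: assumes "integrable torus f" "integrable torus g" "AE p in torus. f p = g p" shows "ft f k = ft g k"
  unfolding ft_def by (rule integral_cong_AE) (use assms in \<open>auto intro: borel_measurable_integrable integrable_mult_ee\<close>)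

lemma ft_pd:
  assumes "\<phi> \<in> test_functions"
  shows "ft (pdx \<phi>) k = dx k * ft \<phi> k" "ft (pdy \<phi>) k = dy k * ft \<phi> k"
proof -
  have i: "integrable torus \<phi>" "integrable torus (pdx \<phi>)" "integrable torus (pdy \<phi>)"
    using assms test_functions_pd[OF assms] by (auto intro!: integral_torus_eq smooth_continuous simp: test_functions_def)
  have "Re (c * cnj (ft (pdx \<phi>) k)) = - Re (dx k * c * cnj (ft \<phi> k))" "Re (c * cnj (ft (pdy \<phi>) k)) = - Re (dy k * c * cnj (ft \<phi> k))" for c
    using integral_pd_mult[OF assms tg_test_function, of c k] integral_mult_tg(2)[OF i(2), of c k]
      integral_mult_tg(2)[OF i(3), of c k] integral_mult_tg(2)[OF i(1), of _ k] by (simp_all only: tg_pd)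
  note q = this[of 1] this[of \<i>]
  show "ft (pdx \<phi>) k = dx k * ft \<phi> k" "ft (pdy \<phi>) k = dy k * ft \<phi> k"
    using q by (simp_all add: complex_eq_iff dx_def dy_def)
qed

section \<open>Completeness of the trigonometric system\<close>

inductive trigp :: "(real \<times> real \<Rightarrow> complex) \<Rightarrow> bool" where
  trigp_ee: "trigp (\<lambda>p. c * ee k p)"
| trigp_add: "trigp g \<Longrightarrow> trigp h \<Longrightarrow> trigp (\<lambda>p. g p + h p)"

lemma trigp_mult:
  assumes "trigp g" "trigp h" shows "trigp (\<lambda>p. g p * h p)"
  using assms(1)
proof induction
  case (trigp_ee c k)
  show ?case using assms(2)
  proof induction
    case (trigp_ee d l)
    have "(\<lambda>p. c * ee k p * (d * ee l p)) = (\<lambda>p. (c * d) * ee (k + l) p)" by (simp add: ee_add mult_ac)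
    then show ?case by (simp only: trigp.trigp_ee)
  next
    case (trigp_add g h)
    then show ?case by (simp only: distrib_left trigp.trigp_add)
  qed
next
  case (trigp_add g h)
  then show ?case by (simp only: distrib_right trigp.trigp_add)
qed

lemma trigp_const: "trigp (\<lambda>p. c)"
  using trigp_ee[of c 0] by simp

lemma trigp_cmult: "trigp g \<Longrightarrow> trigp (\<lambda>p. c * g p)"
  by (rule trigp_mult[OF trigp_const])

lemma trigp_Re_Im: "trigp (\<lambda>p. of_real (Re (ee k p)))" "trigp (\<lambda>p. of_real (Im (ee k p)))"
proof -
  have "(\<lambda>p. complex_of_real (Re (ee k p))) = (\<lambda>p. 1 / 2 * ee k p + 1 / 2 * ee (- k) p)"
    by (auto simp: fun_eq_iff complex_eq_iff simp flip: cnj_ee)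
  moreover have "(\<lambda>p. complex_of_real (Im (ee k p))) = (\<lambda>p. - \<i> / 2 * ee k p + \<i> / 2 * ee (- k) p)"
    by (auto simp: fun_eq_iff complex_eq_iff simp flip: cnj_ee)
  ultimately show "trigp (\<lambda>p. of_real (Re (ee k p)))" "trigp (\<lambda>p. of_real (Im (ee k p)))"
    using trigp_add[OF trigp_ee[of "1 / 2" k] trigp_ee[of "1 / 2" "- k"]]
      trigp_add[OF trigp_ee[of "- \<i> / 2" k] trigp_ee[of "\<i> / 2" "- k"]] by (simp_all only:)
qed

text \<open>Periodic functions do not separate boundary points of the cell, so Stone--Weierstrass is
  applied on the product of two circles.\<close>

definition circ :: "real \<times> real \<Rightarrow> complex \<times> complex" where
  "circ p = (ee (1, 0) p, ee (0, 1) p)"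

lemma continuous_circ: "continuous_on S circ"
  unfolding circ_def by (intro continuous_intros)

text \<open>Linear functionals on the two complex coordinates are combinations of real and imaginary
  parts of the basic characters, and \<open>trigp\<close> is closed under products; hence
  polynomials on the product of circles pull back to trigonometric polynomials.\<close>

lemma trigp_polynomial:
  fixes g :: "complex \<times> complex \<Rightarrow> real"
  assumes "real_polynomial_function g" shows "trigp (\<lambda>p. of_real (g (circ p)))"
  using assms
proof induction
  case (linear g)
  then interpret bounded_linear g .
  have lin: "g (z, w) = Re z * g (1, 0) + Im z * g (\<i>, 0) + Re w * g (0, 1) + Im w * g (0, \<i>)" for z w
  proof -
    have "(z, w) = Re z *\<^sub>R (1, 0) + Im z *\<^sub>R (\<i>, 0) + Re w *\<^sub>R (0, 1) + Im w *\<^sub>R (0, \<i>)"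
      by (simp add: complex_eq_iff)
    then have "g (z, w) = g (Re z *\<^sub>R (1, 0) + Im z *\<^sub>R (\<i>, 0) + Re w *\<^sub>R (0, 1) + Im w *\<^sub>R (0, \<i>))" by simp
    then show ?thesis by (simp only: add scaleR real_scaleR_def)
  qed
  have "(\<lambda>p. complex_of_real (g (circ p))) = (\<lambda>p. of_real (g (1, 0)) * of_real (Re (ee (1, 0) p)) + of_real (g (\<i>, 0)) * of_real (Im (ee (1, 0) p))
      + of_real (g (0, 1)) * of_real (Re (ee (0, 1) p)) + of_real (g (0, \<i>)) * of_real (Im (ee (0, 1) p)))"
    unfolding circ_def by (rule ext, subst lin) (simp only: of_real_add of_real_mult mult.commute)
  moreover note trigp_add[OF trigp_add[OF trigp_add[OF trigp_cmult[OF trigp_Re_Im(1)[of "(1, 0)"], of "of_real (g (1, 0))"]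
      trigp_cmult[OF trigp_Re_Im(2)[of "(1, 0)"], of "of_real (g (\<i>, 0))"]]
      trigp_cmult[OF trigp_Re_Im(1)[of "(0, 1)"], of "of_real (g (0, 1))"]]
      trigp_cmult[OF trigp_Re_Im(2)[of "(0, 1)"], of "of_real (g (0, \<i>))"]]
  ultimately show ?case by (simp only:)
next
  case (const c) then show ?case by (simp add: trigp_const)
next
  case (add g h) then show ?case by (simp only: of_real_add trigp_add)
next
  case (mult g h) then show ?case by (simp only: of_real_mult trigp_mult)
qed

lemma trigp_orthogonal:
  assumes f: "integrable torus f" "\<And>k. ft f k = 0" and h: "trigp h"
  shows "integrable torus (\<lambda>p. of_real (f p) * h p) \<and> (\<integral>p. of_real (f p) * h p \<partial>torus) = 0"
  using h
proof induction
  case (trigp_ee c k)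
  have e: "(\<lambda>p. of_real (f p) * (c * ee k p)) = (\<lambda>p. c * (of_real (f p) * ee k p))" by (simp add: mult_ac)
  show ?case unfolding e using integrable_mult_ee[OF f(1), of k] cnj_ft[of f k] f(2)[of k] by simp
next
  case (trigp_add g h)
  then show ?case by (simp add: distrib_left)
qed

lemma AE_torus_interior: "AE p in torus. p \<in> {0<..<1} \<times> {0<..<1}"
proof -
  have b: "{0<..<1} \<times> {0<..<1} = box (0, 0) (1::real, 1::real)"
    by (auto simp: box_def Basis_prod_def)
  have "emeasure lborel (cbox (0, 0) (1::real, 1::real) - box (0, 0) (1::real, 1::real)) = 0"
    by (subst emeasure_Diff) (auto simp: emeasure_lborel_cbox_eq emeasure_lborel_box_eq Basis_prod_def box_subset_cbox)
  then have "cbox (0, 0) (1::real, 1::real) - box (0, 0) (1::real, 1::real) \<in> null_sets lborel" by auto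
  from AE_not_in[OF this] show ?thesis
    unfolding torus_def torus_cell b by (subst AE_restrict_space_iff) auto
qed

text \<open>f is only integrable, so the approximation is made on the test side: polynomials
  approximate g uniformly, and the error is weighted by the integral of |f|.\<close>

lemma integral_circ_continuous:
  fixes g :: "complex \<times> complex \<Rightarrow> real"
  assumes f: "integrable torus f" "\<And>k. ft f k = 0" and g: "continuous_on UNIV g"
  shows "(\<integral>p. f p * g (circ p) \<partial>torus) = 0"
proof -
  let ?S = "sphere (0::complex) 1 \<times> sphere (0::complex) 1"
  have S: "compact ?S" by (intro compact_Times) auto
  have c: "circ p \<in> ?S" for p by (simp add: circ_def)
  have gS: "continuous_on ?S g" using g continuous_on_subset by blast
  have mc: "(\<lambda>p. h (circ p)) \<in> borel_measurable torus" if "continuous_on UNIV h" for h :: "complex \<times> complex \<Rightarrow> real"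
    by (intro borel_measurable_torus_continuous continuous_on_compose2[OF that continuous_circ]) auto
  have int: "integrable torus (\<lambda>p. f p * h (circ p))" if h: "continuous_on UNIV h" for h :: "complex \<times> complex \<Rightarrow> real"
  proof -
    have "compact (h ` ?S)" using S h by (intro compact_continuous_image) (auto intro: continuous_on_subset)
    then obtain B where B: "\<And>x. x \<in> ?S \<Longrightarrow> \<bar>h x\<bar> \<le> B" using compact_imp_bounded bounded_iff by (metis imageI real_norm_def)
    show ?thesis
    proof (rule Bochner_Integration.integrable_bound[of _ "\<lambda>p. B * f p"])
      show "integrable torus (\<lambda>p. B * f p)" using f by simp
      show "(\<lambda>p. f p * h (circ p)) \<in> borel_measurable torus" using mc[OF h] f by simp
      show "AE p in torus. norm (f p * h (circ p)) \<le> norm (B * f p)"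
      proof (rule AE_I2)
        fix p
        have "\<bar>h (circ p)\<bar> \<le> \<bar>B\<bar>" using B[OF c, of p] by linarith
        from mult_right_mono[OF this, of "\<bar>f p\<bar>"] show "norm (f p * h (circ p)) \<le> norm (B * f p)"
          by (simp add: abs_mult mult.commute)
      qed
    qed
  qed
  define I where "I = (\<integral>p. \<bar>f p\<bar> \<partial>torus)"
  have I: "0 \<le> I" unfolding I_def by simp
  have small: "\<bar>\<integral>p. f p * g (circ p) \<partial>torus\<bar> \<le> e * I" if e: "0 < e" for e
  proof -
    obtain h where h: "real_polynomial_function h" "\<And>x. x \<in> ?S \<Longrightarrow> \<bar>g x - h x\<bar> < e"
      using Stone_Weierstrass_real_polynomial_function[OF S gS e] by blast
    have hc: "continuous_on UNIV h" using h(1) by (auto simp: continuous_on_eq_continuous_within intro: continuous_real_polymonial_function)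
    have "(\<integral>p. complex_of_real (f p) * of_real (h (circ p)) \<partial>torus) = 0"
      using trigp_orthogonal[OF f trigp_polynomial[OF h(1)]] by blast
    then have "(\<integral>p. complex_of_real (f p * h (circ p)) \<partial>torus) = 0" by simp
    then have h0: "(\<integral>p. f p * h (circ p) \<partial>torus) = 0" by (simp only: integral_complex_of_real of_real_eq_0_iff)
    have "(\<integral>p. f p * g (circ p) \<partial>torus) = (\<integral>p. f p * g (circ p) - f p * h (circ p) \<partial>torus)"
      by (subst Bochner_Integration.integral_diff) (use int[OF g] int[OF hc] h0 in auto)
    also have "\<bar>\<dots>\<bar> \<le> (\<integral>p. \<bar>f p * g (circ p) - f p * h (circ p)\<bar> \<partial>torus)"
      by (rule integral_abs_bound)
    also have "\<dots> \<le> (\<integral>p. e * \<bar>f p\<bar> \<partial>torus)"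
    proof (rule integral_mono)
      fix p
      have "\<bar>f p * g (circ p) - f p * h (circ p)\<bar> = \<bar>g (circ p) - h (circ p)\<bar> * \<bar>f p\<bar>"
        by (simp add: abs_mult[symmetric] algebra_simps)
      also have "\<dots> \<le> e * \<bar>f p\<bar>" using h(2)[OF c, of p] by (intro mult_right_mono) auto
      finally show "\<bar>f p * g (circ p) - f p * h (circ p)\<bar> \<le> e * \<bar>f p\<bar>" .
    qed (use int[OF g] int[OF hc] f in auto)
    finally show ?thesis by (simp add: I_def)
  qed
  have "\<bar>\<integral>p. f p * g (circ p) \<partial>torus\<bar> \<le> 0"
  proof (rule field_le_epsilon)
    fix e :: real assume "0 < e"
    then have "\<bar>\<integral>p. f p * g (circ p) \<partial>torus\<bar> \<le> e / (I + 1) * I" using I by (intro small) auto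
    also have "\<dots> = e * (I / (I + 1))" by simp
    also have "\<dots> \<le> e * 1" using I \<open>0 < e\<close> by (intro mult_left_mono) auto
    finally show "\<bar>\<integral>p. f p * g (circ p) \<partial>torus\<bar> \<le> 0 + e" by simp
  qed
  then show ?thesis by simp
qed

text \<open>Indicators of open sets are pointwise limits of continuous cutoffs built from the
  distance to the complement, dominated by |f|.\<close>

lemma integral_circ_open:
  assumes f: "integrable torus f" "\<And>k. ft f k = 0" and U: "open U"
  shows "(\<integral>p. f p * indicator U (circ p) \<partial>torus) = 0"
\<comment> \<open>Treated apart because \<open>infdist\<close> to the empty set is 0 while the
  indicator is 1.\<close>
proof (cases "U = UNIV")
  case True
  then show ?thesis using integral_circ_continuous[OF f, of "\<lambda>_. 1"] by simp
next
  case False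
  then have ne: "- U \<noteq> {}" and cl: "closed (- U)" using U by (auto simp: closed_def)
  define g where "g m x = min 1 (real m * infdist x (- U))" for m :: nat and x :: "complex \<times> complex"
  have gc: "continuous_on UNIV (g m)" for m unfolding g_def by (intro continuous_intros)
  have gb: "0 \<le> g m x" "g m x \<le> 1" for m x by (auto simp: g_def infdist_nonneg)
  have lim: "(\<lambda>m. g m x) \<longlonglongrightarrow> indicator U x" for x
  proof (cases "x \<in> U")
    case False
    then have "g m x = 0" for m by (simp add: g_def infdist_zero)
    then show ?thesis using False by simp
  next
    case True
    then have p: "0 < infdist x (- U)" using in_closed_iff_infdist_zero[OF cl ne] infdist_nonneg[of x "- U"] by fastforce
    then obtain M :: nat where M: "1 < real M * infdist x (- U)" using reals_Archimedean3[OF p] by blast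
    have "g m x = 1" if "M \<le> m" for m
    proof -
      have "real M * infdist x (- U) \<le> real m * infdist x (- U)" using that p by (intro mult_right_mono) auto
      then show ?thesis using M by (simp add: g_def)
    qed
    then have "eventually (\<lambda>m. g m x = indicator U x) sequentially"
      using True by (auto simp: eventually_sequentially intro!: exI[of _ M])
    then show ?thesis by (rule tendsto_eventually)
  qed
  have mc: "(\<lambda>p. h (circ p)) \<in> borel_measurable torus" if "continuous_on UNIV h" for h :: "complex \<times> complex \<Rightarrow> real"
    by (intro borel_measurable_torus_continuous continuous_on_compose2[OF that continuous_circ]) auto
  have "(\<lambda>m. \<integral>p. f p * g m (circ p) \<partial>torus) \<longlonglongrightarrow> (\<integral>p. f p * indicator U (circ p) \<partial>torus)"
  proof (rule integral_dominated_convergence)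
    show "integrable torus (\<lambda>p. \<bar>f p\<bar>)" using f by simp
    show m: "(\<lambda>p. f p * g m (circ p)) \<in> borel_measurable torus" for m using f mc[OF gc] by simp
    show "AE p in torus. (\<lambda>m. f p * g m (circ p)) \<longlonglongrightarrow> f p * indicator U (circ p)"
      by (intro AE_I2 tendsto_intros lim)
    show "(\<lambda>p. f p * indicator U (circ p)) \<in> borel_measurable torus"
      by (rule borel_measurable_LIMSEQ_real[where u = "\<lambda>m p. f p * g m (circ p)"]) (intro tendsto_intros lim, rule m)
    show "AE p in torus. norm (f p * g m (circ p)) \<le> \<bar>f p\<bar>" for m
      using gb by (intro AE_I2) (simp add: abs_mult mult_left_le)
  qed
  moreover have "(\<integral>p. f p * g m (circ p) \<partial>torus) = 0" for m by (rule integral_circ_continuous[OF f gc])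
  ultimately show ?thesis by (simp add: LIMSEQ_const_iff)
qed

lemma measurable_circ [measurable]: "circ \<in> torus \<rightarrow>\<^sub>M borel"
  by (intro borel_measurable_torus_continuous continuous_circ)

text \<open>The sets B for which the integral vanishes form a Dynkin system containing the
  intersection-stable family of open sets.\<close>

lemma integral_circ_borel:
  assumes f: "integrable torus f" "\<And>k. ft f k = 0" and B: "B \<in> sets borel"
  shows "(\<integral>p. f p * indicator B (circ p) \<partial>torus) = 0"
proof -
  have int: "integrable torus (\<lambda>p. f p * indicator B (circ p))" if "B \<in> sets borel" for B
    by (rule Bochner_Integration.integrable_bound[OF f(1)]) (use f that in \<open>auto simp: indicator_def\<close>)
  have e: "sets (borel :: (complex \<times> complex) measure) = sigma_sets UNIV {S. open S}"
    by (simp add: borel_def)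
  have "Int_stable {S :: (complex \<times> complex) set. open S}" "{S :: (complex \<times> complex) set. open S} \<subseteq> Pow UNIV" "B \<in> sigma_sets UNIV {S. open S}"
    using B e by (auto simp: Int_stable_def)
  then show ?thesis
  proof (induction rule: sigma_sets_induct_disjoint)
    case (basic A)
    then show ?case using integral_circ_open[OF f] by simp
  next
    case empty show ?case by simp
  next
    case (compl A)
    have A: "A \<in> sets borel" using compl.hyps e by simp
    have "(\<integral>p. f p * indicator (UNIV - A) (circ p) \<partial>torus) = (\<integral>p. f p * indicator UNIV (circ p) - f p * indicator A (circ p) \<partial>torus)"
      by (intro Bochner_Integration.integral_cong) (auto simp: indicator_def)
    also have "\<dots> = (\<integral>p. f p * indicator UNIV (circ p) \<partial>torus) - (\<integral>p. f p * indicator A (circ p) \<partial>torus)"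
      by (intro Bochner_Integration.integral_diff int A) auto
    also have "\<dots> = 0" using compl.IH integral_circ_open[OF f open_UNIV] by simp
    finally show ?case .
  next
    case (union A)
    have A: "A i \<in> sets borel" for i using union.hyps e by auto
    have "(\<lambda>n. \<integral>p. f p * indicator (\<Union>i<n. A i) (circ p) \<partial>torus) \<longlonglongrightarrow> (\<integral>p. f p * indicator (\<Union>i. A i) (circ p) \<partial>torus)"
    proof (rule integral_dominated_convergence)
      show "integrable torus (\<lambda>p. \<bar>f p\<bar>)" using f by simp
      show "(\<lambda>p. f p * indicator (\<Union>i<n. A i) (circ p)) \<in> borel_measurable torus" for n
        using int[of "\<Union>i<n. A i"] A by auto
      show "(\<lambda>p. f p * indicator (\<Union>i. A i) (circ p)) \<in> borel_measurable torus"
        using int[of "\<Union>i. A i"] A by auto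
      show "AE p in torus. (\<lambda>n. f p * indicator (\<Union>i<n. A i) (circ p)) \<longlonglongrightarrow> f p * indicator (\<Union>i. A i) (circ p)"
        by (intro AE_I2 tendsto_intros LIMSEQ_indicator_UN)
      show "AE p in torus. norm (f p * indicator (\<Union>i<n. A i) (circ p)) \<le> \<bar>f p\<bar>" for n
        by (intro AE_I2) (auto simp: indicator_def)
    qed
    moreover have "(\<integral>p. f p * indicator (\<Union>i<n. A i) (circ p) \<partial>torus) = 0" for n
    proof (induction n)
      case 0 show ?case by simp
    next
      case (Suc n)
      have "A i \<inter> A n = {}" if "i < n" for i using union.hyps(1) that by (simp add: disjoint_family_on_def)
      then have d: "(\<Union>i<n. A i) \<inter> A n = {}" by blast
      have "(\<integral>p. f p * indicator (\<Union>i<Suc n. A i) (circ p) \<partial>torus) = (\<integral>p. f p * indicator (\<Union>i<n. A i) (circ p) + f p * indicator (A n) (circ p) \<partial>torus)"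
        using d by (intro Bochner_Integration.integral_cong) (auto simp: indicator_def lessThan_Suc)
      also have "\<dots> = (\<integral>p. f p * indicator (\<Union>i<n. A i) (circ p) \<partial>torus) + (\<integral>p. f p * indicator (A n) (circ p) \<partial>torus)"
        by (intro Bochner_Integration.integral_add int) (use A in auto)
      finally show ?case using Suc union.IH by simp
    qed
    ultimately show ?case by (simp add: LIMSEQ_const_iff)
  qed
qed

text \<open>A Borel left inverse of t \<mapsto> cis (2 pi t) on the open unit interval. The
  logarithm is taken of - z, so that its branch cut falls on nonnegative real z, that is, on the
  boundary of the cell.\<close>

definition angle :: "complex \<Rightarrow> real" where
  "angle z = (if z \<in> {z. - z \<in> \<real>\<^sub>\<le>\<^sub>0} then 0 else (Im (Ln (- z)) + pi) / (2 * pi))"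

lemma measurable_angle [measurable]: "angle \<in> borel_measurable borel"
proof -
  have "closed ((\<lambda>z::complex. - z) -` \<real>\<^sub>\<le>\<^sub>0)"
    by (intro continuous_closed_vimage closed_nonpos_Reals_complex) auto
  then have "{z::complex. - z \<in> \<real>\<^sub>\<le>\<^sub>0} \<in> sets borel" by (auto simp: vimage_def)
  then show ?thesis unfolding angle_def[abs_def]
    by (intro borel_measurable_continuous_on_if continuous_intros) auto
qed

lemma angle_cis: assumes "0 < t" "t < 1" shows "angle (cis (2 * pi * t)) = t"
proof -
  let ?s = "2 * pi * t - pi"
  have s: "- pi < ?s" "?s < pi" using assms by auto
  have c: "- cis (2 * pi * t) = cis ?s" by (simp add: complex_eq_iff cos_diff sin_diff)
  have L: "Ln (cis ?s) = \<i> * of_real ?s"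
    unfolding cis_conv_exp by (rule Ln_exp) (use s in auto)
  have "cis ?s \<notin> \<real>\<^sub>\<le>\<^sub>0"
  proof
    assume "cis ?s \<in> \<real>\<^sub>\<le>\<^sub>0"
    then have "cos ?s \<le> 0" "sin ?s = 0" unfolding complex_nonpos_Reals_iff cis.sel by blast+
    moreover from \<open>sin ?s = 0\<close> have "?s = 0" using s by (metis sin_eq_0_pi)
    ultimately show False unfolding \<open>?s = 0\<close> by simp
  qed
  then show ?thesis unfolding angle_def mem_Collect_eq c L by simp
qed

text \<open>Off the boundary \<open>circ\<close> has the Borel left inverse L, so Borel sets of the
  cell are, up to null sets, preimages under \<open>circ\<close>; testing with the sets where f is
  positive or negative gives f = 0. Integrability is the right generality because products of two
  square-integrable functions are identified below.\<close>

theorem ft_unique: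
  assumes f: "integrable torus f" "\<And>k. ft f k = 0"
  shows "AE p in torus. f p = 0"
proof -
  define L where "L x = (angle (fst x), angle (snd x))" for x
  have L: "L \<in> borel \<rightarrow>\<^sub>M borel" unfolding L_def borel_prod[symmetric] by measurable
  have inv: "AE p in torus. L (circ p) = p"
    using AE_torus_interior by eventually_elim (auto simp: L_def circ_def ee_def angle_cis)
  \<comment> \<open>f is measurable relative to the cell; extension by 0 makes its sign sets Borel
    in the plane.\<close>
  define f' where "f' p = indicator ({0..1} \<times> {0..1}) p * f p" for p
  have f': "f' \<in> borel_measurable borel"
    using borel_measurable_integrable[OF f(1)] unfolding torus_def f'_def
    by (subst (asm) borel_measurable_restrict_space_iff) auto
  have z: "AE p in torus. f p * indicator A p = 0"
    if A: "A = {p. 0 < s * f' p}" for s :: real and A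
  proof -
    have Am: "A \<in> sets borel" unfolding A using f' by measurable
    have B: "L -` A \<in> sets borel" using measurable_sets[OF L Am] by simp
    have iA: "integrable torus (\<lambda>p. f p * indicator A p)"
    proof (rule Bochner_Integration.integrable_bound[OF f(1)])
      have "(indicator A :: _ \<Rightarrow> real) \<in> borel_measurable torus" using Am by (intro borel_measurable_torus) auto
      then show "(\<lambda>p. f p * indicator A p) \<in> borel_measurable torus" using f(1) by simp
    qed (auto simp: indicator_def)
    have "(\<integral>p. f p * indicator A p \<partial>torus) = (\<integral>p. f p * indicator (L -` A) (circ p) \<partial>torus)"
    proof (rule integral_cong_AE)
      show "AE p in torus. f p * indicator A p = f p * indicator (L -` A) (circ p)"
        using inv by eventually_elim (auto simp: indicator_def)
      show "(\<lambda>p. f p * indicator (L -` A) (circ p)) \<in> borel_measurable torus" using B f(1) by measurable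
    qed (use iA in auto)
    also have "\<dots> = 0" by (rule integral_circ_borel[OF f B])
    finally have "(\<integral>p. s * (f p * indicator A p) \<partial>torus) = 0" by simp
    moreover have "AE p in torus. 0 \<le> s * (f p * indicator A p)"
      by (intro AE_I2) (auto simp: A f'_def indicator_def)
    ultimately have "AE p in torus. s * (f p * indicator A p) = 0"
      using iA by (subst (asm) integral_nonneg_eq_0_iff_AE) auto
    then show ?thesis by eventually_elim (auto simp: A indicator_def)
  qed
  show ?thesis using z[OF refl, of 1] z[OF refl, of "-1"] AE_space
    by eventually_elim (auto simp: f'_def indicator_def split: if_splits)
qed

section \<open>The space of square-integrable functions\<close>

abbreviation cls :: "(real \<times> real \<Rightarrow> real) \<Rightarrow> torus_L2" where "cls \<equiv> abs_torus_L2"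

lemma square_integrable_val [simp]: "square_integrable (val f)"
  using Quotient_rep_reflp[OF Quotient_torus_L2, of f] by simp

lemma cls_val [simp]: "cls (val f) = f"
  by (rule Quotient_abs_rep[OF Quotient_torus_L2])

lemma cls_eq_iff:
  "square_integrable f \<Longrightarrow> square_integrable g \<Longrightarrow> cls f = cls g \<longleftrightarrow> (AE p in torus. f p = g p)"
  using Quotient_rel[OF Quotient_torus_L2, of f g] by auto

lemma val_cls: "square_integrable f \<Longrightarrow> AE p in torus. val (cls f) p = f p"
  using cls_eq_iff[of "val (cls f)" f] by simp

lemma torus_L2_eqI: "AE p in torus. val f p = val g p \<Longrightarrow> f = g"
  using cls_eq_iff[of "val f" "val g"] by simp

lemma cls_ops:
  assumes "square_integrable f" "square_integrable g"
  shows "cls f + cls g = cls (\<lambda>p. f p + g p)" "cls f - cls g = cls (\<lambda>p. f p - g p)" "c *\<^sub>R cls f = cls (\<lambda>p. c * f p)"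
    "inner (cls f) (cls g) = (\<integral>p. f p * g p \<partial>torus)"
  using assms by (auto simp: plus_torus_L2.abs_eq minus_torus_L2.abs_eq scaleR_torus_L2.abs_eq inner_torus_L2.abs_eq)

lemma square_integrable_diff:
  "square_integrable f \<Longrightarrow> square_integrable g \<Longrightarrow> square_integrable (\<lambda>p. f p - g p)"
  using square_integrable_add[OF _ square_integrable_scale[of g "-1"], of f] by simp

lemma val_ops:
  "AE p in torus. val (f + g) p = val f p + val g p" "AE p in torus. val (f - g) p = val f p - val g p"
  "AE p in torus. val (c *\<^sub>R f) p = c * val f p"
  using val_cls[OF square_integrable_add[of "val f" "val g"]] val_cls[OF square_integrable_diff[of "val f" "val g"]]
    val_cls[OF square_integrable_scale[of "val f" c]] cls_ops[of "val f" "val g"] cls_ops(3)[of "val f" "val g" c] by simp_all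

lemma val_measurable [measurable, simp]: "val f \<in> borel_measurable torus"
  using square_integrable_val[of f] unfolding square_integrable_def by blast

lemma inner_val: "inner f g = (\<integral>p. val f p * val g p \<partial>torus)"
  using cls_ops(4)[of "val f" "val g"] by simp

lemma norm_val: "(norm f)\<^sup>2 = (\<integral>p. (val f p)\<^sup>2 \<partial>torus)"
  unfolding power2_norm_eq_inner inner_val by (simp add: power2_eq_square)

lemma square_integrable_bounded:
  assumes "f \<in> borel_measurable torus" "\<And>p. \<bar>f p\<bar> \<le> B" shows "square_integrable f"
  unfolding square_integrable_def
proof
  have "\<bar>(f p)\<^sup>2\<bar> \<le> B\<^sup>2" for p
    using power_mono[OF assms(2)[of p] abs_ge_zero, of 2] by simp
  then show "integrable torus (\<lambda>p. (f p)\<^sup>2)"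
    using assms(1) by (intro integrable_torus_bounded[of _ "B\<^sup>2"]) auto
qed (fact assms(1))

lemma square_integrable_abs: "square_integrable f \<Longrightarrow> square_integrable (\<lambda>p. \<bar>f p\<bar>)"
  by (auto simp: square_integrable_def intro: borel_measurable_abs)

lemma square_integrable_imp_integrable: assumes "square_integrable f" shows "integrable torus f"
  using square_integrable_mult[OF assms square_integrable_bounded[of "\<lambda>_. 1" 1]] by simp

lemma integrable_val [simp]: "integrable torus (val f)"
  by (rule square_integrable_imp_integrable) simp

lemma square_integrable_test: assumes "\<phi> \<in> test_functions" shows "square_integrable \<phi>"
proof -
  have s: "continuous_on UNIV \<phi>" using assms by (auto simp: test_functions_def intro: smooth_continuous)
  have "continuous_on UNIV (\<lambda>p. (\<phi> p)\<^sup>2)" using s by (intro continuous_intros)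
  then show ?thesis unfolding square_integrable_def using s integral_torus_eq(1) borel_measurable_torus_continuous by blast
qed

section \<open>Cauchy-Schwarz and completeness\<close>

lemma integral_abs_mult_le:
  "(\<integral>p. \<bar>val f p\<bar> * \<bar>val g p\<bar> \<partial>torus) \<le> norm f * norm g"
proof -
  define F G where "F = cls (\<lambda>p. \<bar>val f p\<bar>)" and "G = cls (\<lambda>p. \<bar>val g p\<bar>)"
  have a: "square_integrable (\<lambda>p. \<bar>val f p\<bar>)" for f by (simp add: square_integrable_abs)
  have "inner F F = inner f f" "inner G G = inner g g"
    unfolding F_def G_def cls_ops(4)[OF a a] by (simp_all add: inner_val)
  then have n: "norm F = norm f" "norm G = norm g" by (simp_all add: norm_eq_sqrt_inner)
  have "(\<integral>p. \<bar>val f p\<bar> * \<bar>val g p\<bar> \<partial>torus) = inner F G"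
    unfolding F_def G_def cls_ops(4)[OF a a] ..
  also have "\<dots> \<le> norm F * norm G" by (rule norm_cauchy_schwarz)
  finally show ?thesis by (simp add: n)
qed

lemma integral_abs_le_norm: "(\<integral>p. \<bar>val f p\<bar> \<partial>torus) \<le> norm f"
proof -
  have one: "square_integrable (\<lambda>_. 1)" by (rule square_integrable_bounded[of _ 1]) auto
  have "(norm (cls (\<lambda>_. 1)))\<^sup>2 = 1" unfolding power2_norm_eq_inner cls_ops(4)[OF one one] by simp
  then have n: "norm (cls (\<lambda>_. 1)) = 1" by (simp add: power2_eq_1_iff)  (metis norm_ge_zero not_one_le_zero neg_0_le_iff_le le_minus_one_simps(1) le_minus_one_simps(3))
  have "(\<integral>p. \<bar>val f p\<bar> \<partial>torus) = (\<integral>p. \<bar>val f p\<bar> * \<bar>val (cls (\<lambda>_. 1)) p\<bar> \<partial>torus)"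
    by (rule integral_cong_AE) (use val_cls[OF one] in \<open>auto elim: eventually_mono\<close>)
  also have "\<dots> \<le> norm f * norm (cls (\<lambda>_. 1))" by (rule integral_abs_mult_le)
  finally show ?thesis by (simp add: n)
qed

text \<open>Geometrically small increments are also summable in L1, so the telescoping series
  converges almost everywhere; Fatou's lemma then measures the distance to the limit in L2.\<close>

lemma torus_L2_complete_aux:
  fixes X :: "nat \<Rightarrow> torus_L2"
  assumes X: "\<And>n. norm (X (Suc n) - X n) \<le> (1 / 2) ^ n"
  shows "\<exists>g. X \<longlonglongrightarrow> g"
proof -
  define d where "d n = val (X (Suc n) - X n)" for n
  have dm [measurable]: "d n \<in> borel_measurable torus" for n unfolding d_def by simp
  \<comment> \<open>Partial sums of fixed representatives: x n represents X n only almost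
    everywhere, but its convergence is that of one series at each point.\<close>
  define x where "x n p = val (X 0) p + (\<Sum>i<n. d i p)" for n p
  have xm [measurable]: "x n \<in> borel_measurable torus" for n unfolding x_def by measurable
  have xX: "AE p in torus. x n p = val (X n) p" for n
  proof (induction n)
    case 0 show ?case by (simp add: x_def)
  next
    case (Suc n)
    then show ?case using val_ops(2)[of "X (Suc n)" "X n"]
      by eventually_elim (simp add: x_def d_def)
  qed
  have "(\<integral>\<^sup>+p. (\<Sum>n. ennreal \<bar>d n p\<bar>) \<partial>torus) = (\<Sum>n. \<integral>\<^sup>+p. ennreal \<bar>d n p\<bar> \<partial>torus)"
    by (rule nn_integral_suminf) measurable
  also have "\<dots> \<le> (\<Sum>n. ennreal ((1 / 2) ^ n))"
  proof (rule suminf_le)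
    fix n
    have "(\<integral>\<^sup>+p. ennreal \<bar>d n p\<bar> \<partial>torus) = ennreal (\<integral>p. \<bar>d n p\<bar> \<partial>torus)"
      by (rule nn_integral_eq_integral) (auto simp: d_def)
    also have "\<dots> \<le> ennreal ((1 / 2) ^ n)"
      unfolding d_def by (rule ennreal_leI) (rule order_trans[OF integral_abs_le_norm X])
    finally show "(\<integral>\<^sup>+p. ennreal \<bar>d n p\<bar> \<partial>torus) \<le> ennreal ((1 / 2) ^ n)" .
  qed auto
  also have "\<dots> = ennreal (\<Sum>n. (1 / 2) ^ n)"
    by (rule suminf_ennreal2) auto
  also have "\<dots> < \<infinity>" by simp
  finally have "(\<integral>\<^sup>+p. (\<Sum>n. ennreal \<bar>d n p\<bar>) \<partial>torus) \<noteq> \<infinity>" by simp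
  then have "AE p in torus. (\<Sum>n. ennreal \<bar>d n p\<bar>) \<noteq> \<infinity>"
    by (intro nn_integral_PInf_AE) measurable
  then have conv: "AE p in torus. summable (\<lambda>n. d n p)"
  proof eventually_elim
    case (elim p)
    then have "summable (\<lambda>n. \<bar>d n p\<bar>)"
      by (intro summable_suminf_not_top) auto
    then show ?case by (rule summable_rabs_cancel)
  qed
  define g where "g p = lim (\<lambda>n. x n p)" for p
  have gm [measurable]: "g \<in> borel_measurable torus" unfolding g_def by measurable
  have lim: "AE p in torus. (\<lambda>n. x n p) \<longlonglongrightarrow> g p"
    using conv
  proof eventually_elim
    case (elim p)
    then have "(\<lambda>n. x n p) \<longlonglongrightarrow> val (X 0) p + (\<Sum>n. d n p)"
      unfolding x_def using summable_LIMSEQ[OF elim] by (intro tendsto_intros)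
    then show ?case unfolding g_def by (simp add: limI)
  qed
  have dist: "norm (X m - X n) \<le> 2 * (1 / 2) ^ n" if "n \<le> m" for m n
  proof -
    have "norm (X m - X n) \<le> 2 * (1 / 2) ^ n - 2 * (1 / 2) ^ m" using that
    proof (induction m rule: dec_induct)
      case (step m)
      have "norm (X (Suc m) - X n) \<le> norm (X (Suc m) - X m) + norm (X m - X n)"
        using norm_triangle_ineq[of "X (Suc m) - X m" "X m - X n"] by simp
      then show ?case using X[of m] step.IH by simp
    qed simp
    then show ?thesis using zero_le_power[of "1/2::real" m] by linarith
  qed
  have key: "(\<integral>\<^sup>+p. ennreal ((x n p - g p)\<^sup>2) \<partial>torus) \<le> ennreal ((2 * (1 / 2) ^ n)\<^sup>2)" for n
  proof -
    have "(\<integral>\<^sup>+p. ennreal ((x n p - g p)\<^sup>2) \<partial>torus) = (\<integral>\<^sup>+p. liminf (\<lambda>m. ennreal ((x n p - x m p)\<^sup>2)) \<partial>torus)"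
    proof (rule nn_integral_cong_AE)
      show "AE p in torus. ennreal ((x n p - g p)\<^sup>2) = liminf (\<lambda>m. ennreal ((x n p - x m p)\<^sup>2))"
        using lim
      proof eventually_elim
        case (elim p)
        then have "(\<lambda>m. ennreal ((x n p - x m p)\<^sup>2)) \<longlonglongrightarrow> ennreal ((x n p - g p)\<^sup>2)"
          by (intro tendsto_ennrealI tendsto_intros)
        then show ?case by (metis lim_imp_Liminf trivial_limit_sequentially)
      qed
    qed
    also have "\<dots> \<le> liminf (\<lambda>m. \<integral>\<^sup>+p. ennreal ((x n p - x m p)\<^sup>2) \<partial>torus)"
      by (rule nn_integral_liminf) measurable
    also have "\<dots> \<le> ennreal ((2 * (1 / 2) ^ n)\<^sup>2)"
    proof (rule Liminf_le)
      show "\<forall>\<^sub>F m in sequentially. (\<integral>\<^sup>+p. ennreal ((x n p - x m p)\<^sup>2) \<partial>torus) \<le> ennreal ((2 * (1 / 2) ^ n)\<^sup>2)"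
        using eventually_ge_at_top[of n]
      proof eventually_elim
        case (elim m)
        have "(\<integral>\<^sup>+p. ennreal ((x n p - x m p)\<^sup>2) \<partial>torus) = (\<integral>\<^sup>+p. ennreal ((val (X m - X n) p)\<^sup>2) \<partial>torus)"
          by (rule nn_integral_cong_AE) (use xX[of n] xX[of m] val_ops(2)[of "X m" "X n"] in \<open>eventually_elim, simp add: power2_commute\<close>)
        also have "\<dots> = ennreal ((norm (X m - X n))\<^sup>2)"
          unfolding norm_val by (rule nn_integral_eq_integral) (use square_integrable_val[of "X m - X n"] in \<open>auto simp: square_integrable_def\<close>)
        also have "\<dots> \<le> ennreal ((2 * (1 / 2) ^ n)\<^sup>2)"
          using dist[OF elim] by (intro ennreal_leI power_mono) auto
        finally show ?case .
      qed
    qed simp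
    finally show ?thesis .
  qed
  have xg: "square_integrable (\<lambda>p. x n p - g p)" for n
    unfolding square_integrable_def
  proof
    show "integrable torus (\<lambda>p. (x n p - g p)\<^sup>2)"
      by (rule integrableI_nonneg) (use key[of n] in \<open>auto simp: less_top[symmetric] top_unique intro: le_less_trans\<close>)
  qed measurable
  have x0: "square_integrable (x 0)" by (simp add: x_def[abs_def])
  have g: "square_integrable g" using square_integrable_diff[OF x0 xg[of 0]] by simp
  have n: "norm (X n - cls g) \<le> 2 * (1 / 2) ^ n" for n
  proof -
    have "AE p in torus. val (X n - cls g) p = x n p - g p"
      using xX[of n] val_ops(2)[of "X n" "cls g"] val_cls[OF g] by eventually_elim simp
    then have "(norm (X n - cls g))\<^sup>2 = (\<integral>p. (x n p - g p)\<^sup>2 \<partial>torus)"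
      unfolding norm_val by (intro integral_cong_AE) (auto elim: eventually_mono)
    moreover have "ennreal (\<integral>p. (x n p - g p)\<^sup>2 \<partial>torus) \<le> ennreal ((2 * (1 / 2) ^ n)\<^sup>2)"
      using key[of n] xg[of n] by (subst nn_integral_eq_integral[symmetric]) (auto simp: square_integrable_def)
    ultimately have "(norm (X n - cls g))\<^sup>2 \<le> (2 * (1 / 2) ^ n)\<^sup>2" by (simp add: ennreal_le_iff)
    then show ?thesis by (rule power2_le_imp_le) simp
  qed
  have "(\<lambda>n. 2 * (1 / 2 :: real) ^ n) \<longlonglongrightarrow> 2 * 0" by (intro tendsto_intros LIMSEQ_power_zero) simp
  then have "(\<lambda>n. X n - cls g) \<longlonglongrightarrow> 0"
    by (intro Lim_null_comparison[OF always_eventually[OF allI[OF n]]]) simp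
  then show ?thesis by (intro exI[of _ "cls g"]) (simp add: LIM_zero_iff)
qed

text \<open>Completeness is used for the Riesz-Fischer theorem and for integrals of continuous
  curves in \<open>torus_L2\<close>.\<close>

instance torus_L2 :: banach
proof
  fix X :: "nat \<Rightarrow> torus_L2" assume C: "Cauchy X"
  have "\<exists>M. \<forall>m\<ge>M. \<forall>n\<ge>M. norm (X m - X n) < (1 / 2) ^ i" for i :: nat
    using CauchyD[OF C, of "(1/2)^i"] by simp
  then obtain M where M: "\<And>i m n. m \<ge> M i \<Longrightarrow> n \<ge> M i \<Longrightarrow> norm (X m - X n) < (1 / 2) ^ i" by metis
  \<comment> \<open>Adding up all earlier thresholds makes r strictly increasing and at least M
    i.\<close>
  define r where "r i = i + (\<Sum>j\<le>i. M j)" for i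
  have r: "M i \<le> r i" for i using member_le_sum[of i "{..i}" M] by (simp add: r_def)
  have rs: "strict_mono r" unfolding strict_mono_Suc_iff by (simp add: r_def)
  have "norm (X (r (Suc n)) - X (r n)) \<le> (1 / 2) ^ n" for n
    using M[of n "r (Suc n)" "r n"] r[of n] strict_monoD[OF rs, of n "Suc n"] by simp
  then obtain g where "(\<lambda>n. X (r n)) \<longlonglongrightarrow> g" using torus_L2_complete_aux[of "\<lambda>n. X (r n)"] by blast
  then have "X \<longlonglongrightarrow> g" using Cauchy_converges_subseq[OF C rs] by (simp add: o_def)
  then show "convergent X" by (rule convergentI)
qed

section \<open>Fourier series of square-integrable functions\<close>

lemma hermitianD: "hermitian a \<Longrightarrow> a (- k) = cnj (a k)"
  unfolding hermitian_def by blast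

definition fc :: "torus_L2 \<Rightarrow> freq \<Rightarrow> complex" where
  "fc f = ft (val f)"

lemma fc_cls: assumes "square_integrable g" shows "fc (cls g) = ft g"
  unfolding fc_def
  by (rule ext, rule ft_cong_AE) (use val_cls[OF assms] square_integrable_imp_integrable[OF assms] in auto)

lemma hermitian_fc: "hermitian (fc f)" by (simp add: fc_def hermitian_ft)

lemma fc_add: "fc (f + g) k = fc f k + fc g k"
proof -
  have "fc (f + g) k = ft (\<lambda>p. val f p + val g p) k"
    unfolding fc_def by (rule ft_cong_AE) (use val_ops(1)[of f g] in auto)
  then show ?thesis by (simp add: ft_add fc_def)
qed

lemma fc_scaleR: "fc (c *\<^sub>R f) k = c *\<^sub>R fc f k"
proof -
  have "fc (c *\<^sub>R f) k = ft (\<lambda>p. c * val f p) k"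
    unfolding fc_def by (rule ft_cong_AE) (use val_ops(3)[of c f] in auto)
  then show ?thesis by (simp add: ft_cmult fc_def scaleR_conv_of_real)
qed

lemma cmod_fc_le: "cmod (fc f k) \<le> norm f"
proof -
  have "cmod (fc f k) \<le> (\<integral>p. cmod (of_real (val f p) * ee (- k) p) \<partial>torus)"
    unfolding fc_def ft_def by (rule integral_norm_bound)
  also have "\<dots> = (\<integral>p. \<bar>val f p\<bar> \<partial>torus)" by (simp add: norm_mult)
  also have "\<dots> \<le> norm f" by (rule integral_abs_le_norm)
  finally show ?thesis .
qed

lemma bounded_linear_fc: "bounded_linear (\<lambda>f. fc f k)"
  by (rule bounded_linear_intro[of _ 1]) (auto simp: fc_add fc_scaleR cmod_fc_le)

lemma fc_diff: "fc (f - g) k = fc f k - fc g k"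
  by (rule linear_diff[OF bounded_linear.linear[OF bounded_linear_fc]])

lemma fc_minus: "fc (- g) k = - fc g k"
  by (rule linear_neg[OF bounded_linear.linear[OF bounded_linear_fc]])

text \<open>Completeness of the characters in the form used throughout: it makes weak derivatives
  and the inverse Helmholtz operator unique.\<close>

lemma fc_eqI: assumes "\<And>k. fc f k = fc g k" shows "f = g"
proof -
  have "AE p in torus. val (f - g) p = 0"
    by (rule ft_unique) (use assms fc_diff[of f g] in \<open>auto simp: fc_def\<close>)
  then have "AE p in torus. val f p = val g p"
    using val_ops(2)[of f g] by eventually_elim simp
  then show ?thesis by (rule torus_L2_eqI)
qed

lemma fc_mean_zero: "f \<in> mean_zero \<longleftrightarrow> fc f 0 = 0"
proof -
  have "fc f 0 = of_real (\<integral>p. val f p \<partial>torus)" by (simp add: fc_def ft_def)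
  then show ?thesis by (simp add: mean_zero_def)
qed

definition tp :: "freq set \<Rightarrow> (freq \<Rightarrow> complex) \<Rightarrow> torus_L2" where
  "tp A a = cls (\<lambda>p. Re (\<Sum>k\<in>A. a k * ee k p))"

lemma tp_square_integrable: assumes "finite A" shows "square_integrable (\<lambda>p. Re (\<Sum>k\<in>A. a k * ee k p))"
proof (rule square_integrable_bounded)
  show "(\<lambda>p. Re (\<Sum>k\<in>A. a k * ee k p)) \<in> borel_measurable torus"
    by (intro borel_measurable_torus_continuous continuous_intros)
  show "\<bar>Re (\<Sum>k\<in>A. a k * ee k p)\<bar> \<le> (\<Sum>k\<in>A. cmod (a k))" for p
    by (rule order_trans[OF abs_Re_le_cmod order_trans[OF norm_sum]]) (simp add: norm_mult)
qed

lemma trig_sum_real: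
  assumes "uminus ` A = A" "hermitian a"
  shows "complex_of_real (Re (\<Sum>k\<in>A. a k * ee k p)) = (\<Sum>k\<in>A. a k * ee k p)"
proof -
  have "(\<Sum>k\<in>A. a k * ee k p) = (\<Sum>k\<in>uminus ` A. a k * ee k p)" using assms by simp
  also have "\<dots> = (\<Sum>k\<in>A. a (- k) * ee (- k) p)" by (subst sum.reindex) auto
  also have "\<dots> = cnj (\<Sum>k\<in>A. a k * ee k p)"
    unfolding cnj_sum complex_cnj_mult cnj_ee hermitianD[OF assms(2)] ..
  finally show ?thesis by (metis Reals_cnj_iff of_real_Re)
qed

lemma integrable_val_mult: "integrable torus (\<lambda>p. val f p * val g p)"
  by (rule square_integrable_mult) auto

text \<open>Multiplication by a character translates the coefficients. At k = 0 this computes inner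
  products, and its limit is the convolution theorem \<open>ft_mult\<close>.\<close>

lemma ft_tp_mult:
  assumes A: "finite A" "uminus ` A = A" "hermitian a"
  shows "ft (\<lambda>p. val (tp A a) p * val g p) k = (\<Sum>l\<in>A. a l * fc g (k - l))"
proof -
  let ?S = "\<lambda>p. \<Sum>l\<in>A. a l * ee l p"
  have S: "AE p in torus. val (tp A a) p = Re (?S p)"
    unfolding tp_def by (rule val_cls[OF tp_square_integrable[OF A(1)]])
  have i: "integrable torus (\<lambda>p. Re (?S p) * val g p)"
    by (rule square_integrable_mult) (use tp_square_integrable[OF A(1)] in auto)
  have "ft (\<lambda>p. val (tp A a) p * val g p) k = ft (\<lambda>p. Re (?S p) * val g p) k"
    by (rule ft_cong_AE[OF integrable_val_mult i]) (use S in \<open>eventually_elim, simp\<close>)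
  also have "\<dots> = (\<integral>p. (\<Sum>l\<in>A. a l * (of_real (val g p) * ee (- (k - l)) p)) \<partial>torus)"
    unfolding ft_def of_real_mult trig_sum_real[OF A(2,3)]
  proof (intro Bochner_Integration.integral_cong refl)
    fix p
    have "ee (- (k - l)) p = ee l p * ee (- k) p" for l by (simp add: ee_add[symmetric])
    then show "?S p * of_real (val g p) * ee (- k) p = (\<Sum>l\<in>A. a l * (of_real (val g p) * ee (- (k - l)) p))"
      unfolding sum_distrib_right by (intro sum.cong refl) (simp only: mult_ac)
  qed
  also have "\<dots> = (\<Sum>l\<in>A. a l * fc g (k - l))"
    by (subst Bochner_Integration.integral_sum) (auto simp: fc_def ft_def intro!: integrable_mult_ee)
  finally show ?thesis .
qed

lemma inner_tp:
  assumes A: "finite A" "uminus ` A = A" "hermitian a"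
  shows "complex_of_real (inner (tp A a) g) = (\<Sum>l\<in>A. a l * cnj (fc g l))"
proof -
  have "complex_of_real (inner (tp A a) g) = ft (\<lambda>p. val (tp A a) p * val g p) 0"
    by (simp add: inner_val ft_def flip: of_real_mult)
  also have "\<dots> = (\<Sum>l\<in>A. a l * fc g (0 - l))" by (rule ft_tp_mult[OF A])
  finally show ?thesis by (simp add: hermitianD[OF hermitian_fc])
qed

lemma fc_tp:
  assumes A: "finite A" "uminus ` A = A" "hermitian a"
  shows "fc (tp A a) k = (if k \<in> A then a k else 0)"
proof -
  have "fc (tp A a) k = ft (\<lambda>p. Re (\<Sum>l\<in>A. a l * ee l p)) k"
    unfolding tp_def fc_cls[OF tp_square_integrable[OF A(1)]] ..
  also have "\<dots> = (\<integral>p. (\<Sum>l\<in>A. a l * ee (l - k) p) \<partial>torus)"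
    unfolding ft_def trig_sum_real[OF A(2,3)]
    by (intro Bochner_Integration.integral_cong refl)
      (simp add: sum_distrib_right ee_add[symmetric] mult.assoc)
  also have "\<dots> = (\<Sum>l\<in>A. a l * (\<integral>p. ee (l - k) p \<partial>torus))"
    by (subst Bochner_Integration.integral_sum) (auto intro!: integrable_mult_right integrable_torus_bounded[of _ 1])
  also have "\<dots> = (\<Sum>l\<in>A. if k = l then a l else 0)"
    by (intro sum.cong) (auto simp: integral_ee)
  finally show ?thesis using A(1) by (simp add: sum.delta)
qed

lemma norm_tp:
  assumes A: "finite A" "uminus ` A = A" "hermitian a"
  shows "(norm (tp A a))\<^sup>2 = (\<Sum>k\<in>A. (cmod (a k))\<^sup>2)"
proof -
  have "complex_of_real ((norm (tp A a))\<^sup>2) = (\<Sum>l\<in>A. a l * cnj (a l))"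
    unfolding power2_norm_eq_inner inner_tp[OF A] using fc_tp[OF A] by (intro sum.cong) auto
  also have "\<dots> = complex_of_real (\<Sum>k\<in>A. (cmod (a k))\<^sup>2)"
    by (simp add: complex_norm_square[symmetric])
  finally show ?thesis by (simp only: of_real_eq_iff)
qed

lemma Box_mono: "m \<le> n \<Longrightarrow> Box m \<subseteq> Box n" by (auto simp: Box_def)

lemma filterlim_Box: "filterlim Box (finite_subsets_at_top UNIV) sequentially"
  unfolding filterlim_finite_subsets_at_top
proof (intro allI impI)
  fix X :: "freq set" assume "finite X \<and> X \<subseteq> UNIV"
  then have "\<forall>\<^sub>F n in sequentially. \<forall>k\<in>X. k \<in> Box n"
    by (intro eventually_ball_finite) (auto intro: eventually_mem_Box)
  then show "\<forall>\<^sub>F n in sequentially. finite (Box n) \<and> X \<subseteq> Box n \<and> Box n \<subseteq> UNIV"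
    by eventually_elim auto
qed

lemma finite_subset_Box: assumes "finite X" shows "\<exists>n. X \<subseteq> Box n"
proof -
  have "\<forall>\<^sub>F n in sequentially. X \<subseteq> Box n"
    using filterlim_Box assms unfolding filterlim_finite_subsets_at_top by simp
  then show ?thesis by (auto dest: eventually_happens)
qed

lemma uminus_Diff_Box: "uminus ` (Box n - Box m) = Box n - Box m"
  using image_set_diff[of uminus "Box n" "Box m"] by (simp add: uminus_Box)

text \<open>The squared distance of two box sums is the difference of the partial sums of a
  convergent series, so completeness applies. Functions prescribed by their coefficients come from
  here.\<close>

theorem Riesz_Fischer:
  assumes a: "hermitian a" "l2 (\<lambda>k. cmod (a k))"
  shows "\<exists>f. fc f = a \<and> (\<lambda>n. tp (Box n) a) \<longlonglongrightarrow> f"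
proof -
  let ?s = "\<lambda>n. \<Sum>k\<in>Box n. (cmod (a k))\<^sup>2"
  have "(\<lambda>k. (cmod (a k))\<^sup>2) summable_on UNIV" using a by (simp add: l2_def)
  then have "?s \<longlonglongrightarrow> (\<Sum>\<^sub>\<infinity>k. (cmod (a k))\<^sup>2)"
    by (intro filterlim_compose[OF infsum_tendsto filterlim_Box])
  then have C: "Cauchy ?s" by (rule LIMSEQ_imp_Cauchy)
  have d: "(norm (tp (Box n) a - tp (Box m) a))\<^sup>2 = ?s n - ?s m" if "m \<le> n" for m n
  proof -
    have "tp (Box n) a - tp (Box m) a = tp (Box n - Box m) a"
      by (rule fc_eqI) (use Box_mono[OF that] a in \<open>auto simp: fc_diff fc_tp uminus_Box uminus_Diff_Box\<close>)
    then show ?thesis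
      using a by (simp add: norm_tp uminus_Diff_Box sum_diff[OF finite_Box Box_mono[OF that]])
  qed
  have "Cauchy (\<lambda>n. tp (Box n) a)"
  proof (rule CauchyI)
    fix e :: real assume e: "0 < e"
    then obtain M where M: "\<And>m n. m \<ge> M \<Longrightarrow> n \<ge> M \<Longrightarrow> norm (?s m - ?s n) < e\<^sup>2"
      using CauchyD[OF C, of "e\<^sup>2"] by auto
    have "norm (tp (Box m) a - tp (Box n) a) < e" if mn: "m \<ge> M" "n \<ge> M" for m n
    proof -
      have "(norm (tp (Box m) a - tp (Box n) a))\<^sup>2 < e\<^sup>2"
        using d[of m n] d[of n m] M[OF mn] by (cases "m \<le> n") (auto simp: norm_minus_commute)
      then show ?thesis using e by (simp add: power_less_imp_less_base)
    qed
    then show "\<exists>M. \<forall>m\<ge>M. \<forall>n\<ge>M. norm (tp (Box m) a - tp (Box n) a) < e" by blast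
  qed
  then obtain f where f: "(\<lambda>n. tp (Box n) a) \<longlonglongrightarrow> f" using Cauchy_convergent convergent_def by blast
  have "fc f k = a k" for k
  proof (rule LIMSEQ_unique)
    show "(\<lambda>n. fc (tp (Box n) a) k) \<longlonglongrightarrow> fc f k" by (rule bounded_linear.tendsto[OF bounded_linear_fc f])
    show "(\<lambda>n. fc (tp (Box n) a) k) \<longlonglongrightarrow> a k"
      by (rule tendsto_eventually) (use eventually_mem_Box[of k] in \<open>eventually_elim, simp add: fc_tp uminus_Box a\<close>)
  qed
  then have "fc f = a" by (rule ext)
  then show ?thesis using f by blast
qed

text \<open>Bessel's inequality: the partial sum t satisfies |t|^2 = <t, f> \<le> |t| |f|. Finite
  sets are first enlarged to a box because \<open>norm_tp\<close> needs a symmetric one.\<close>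

lemma l2_fc: "l2 (\<lambda>k. cmod (fc f k))"
proof (rule l2I(1))
  fix X :: "freq set" assume "finite X"
  then obtain n where n: "X \<subseteq> Box n" using finite_subset_Box by blast
  let ?t = "tp (Box n) (fc f)"
  have "complex_of_real (inner ?t f) = complex_of_real (\<Sum>k\<in>Box n. (cmod (fc f k))\<^sup>2)"
    by (simp add: inner_tp uminus_Box hermitian_fc complex_norm_square[symmetric])
  then have "inner ?t f = (norm ?t)\<^sup>2"
    by (simp only: of_real_eq_iff norm_tp[OF finite_Box uminus_Box hermitian_fc])
  then have "(norm ?t)\<^sup>2 \<le> norm ?t * norm f" using norm_cauchy_schwarz[of ?t f] by simp
  then have t: "norm ?t \<le> norm f"
    using mult_left_le_imp_le[of "norm ?t" "norm ?t" "norm f"] norm_ge_zero[of f]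
    by (cases "?t = 0") (simp_all only: power2_eq_square zero_less_norm_iff norm_zero, blast)
  have "(\<Sum>k\<in>X. (cmod (fc f k))\<^sup>2) \<le> (\<Sum>k\<in>Box n. (cmod (fc f k))\<^sup>2)"
    by (rule sum_mono2) (use n in auto)
  also have "\<dots> = (norm ?t)\<^sup>2" by (simp only: norm_tp[OF finite_Box uminus_Box hermitian_fc])
  also have "\<dots> \<le> (norm f)\<^sup>2" using t by (intro power_mono) auto
  finally show "L2_set (\<lambda>k. cmod (fc f k)) X \<le> norm f"
    unfolding L2_set_def by (intro real_le_lsqrt) auto
qed

text \<open>The series converges to some function with the coefficients of f, and coefficients
  determine the function.\<close>

lemma tp_fc_tendsto: "(\<lambda>n. tp (Box n) (fc f)) \<longlonglongrightarrow> f"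
proof -
  obtain g where g: "fc g = fc f" "(\<lambda>n. tp (Box n) (fc f)) \<longlonglongrightarrow> g"
    using Riesz_Fischer[OF hermitian_fc l2_fc] by blast
  have "g = f" by (rule fc_eqI) (simp add: g(1))
  then show ?thesis using g(2) by simp
qed

lemma summable_conv:
  fixes a b :: "freq \<Rightarrow> complex"
  assumes "l2 (\<lambda>k. cmod (a k))" "l2 (\<lambda>k. cmod (b k))"
  shows "(\<lambda>l. a l * b (k - l)) summable_on UNIV"
proof (rule abs_summable_summable)
  show "(\<lambda>l. norm (a l * b (k - l))) summable_on UNIV"
    unfolding norm_mult
    by (rule summable_l2_mult(1)[OF assms(1) l2_shift[where \<alpha> = "\<lambda>k. cmod (b k)", OF assms(2)]])
qed

text \<open>A product of two classes is in general only integrable, so this concerns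
  \<open>ft\<close> and not \<open>fc\<close>. For partial sums of f it is the translation formula;
  Cauchy-Schwarz passes to the limit.\<close>

theorem ft_mult:
  "ft (\<lambda>p. val f p * val g p) k = (\<Sum>\<^sub>\<infinity>l. fc f l * fc g (k - l))"
proof (rule LIMSEQ_unique)
  let ?t = "\<lambda>n. tp (Box n) (fc f)"
  have "(\<lambda>n. \<Sum>l\<in>Box n. fc f l * fc g (k - l)) \<longlonglongrightarrow> (\<Sum>\<^sub>\<infinity>l. fc f l * fc g (k - l))"
    by (intro filterlim_compose[OF infsum_tendsto filterlim_Box] summable_conv l2_fc)
  then show "(\<lambda>n. ft (\<lambda>p. val (?t n) p * val g p) k) \<longlonglongrightarrow> (\<Sum>\<^sub>\<infinity>l. fc f l * fc g (k - l))"
    by (simp add: ft_tp_mult uminus_Box hermitian_fc)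
  show "(\<lambda>n. ft (\<lambda>p. val (?t n) p * val g p) k) \<longlonglongrightarrow> ft (\<lambda>p. val f p * val g p) k"
  proof (rule LIM_zero_cancel, rule Lim_null_comparison)
    have "(\<lambda>n. norm (?t n - f) * norm g) \<longlonglongrightarrow> 0 * norm g"
      by (intro tendsto_intros tendsto_norm_zero LIM_zero tp_fc_tendsto)
    then show "(\<lambda>n. norm (?t n - f) * norm g) \<longlonglongrightarrow> 0" by simp
    show "\<forall>\<^sub>F n in sequentially. norm (ft (\<lambda>p. val (?t n) p * val g p) k - ft (\<lambda>p. val f p * val g p) k) \<le> norm (?t n - f) * norm g"
    proof (intro always_eventually allI)
      fix n
      have "ft (\<lambda>p. val (?t n) p * val g p) k - ft (\<lambda>p. val f p * val g p) k
        = (\<integral>p. of_real (val (?t n) p * val g p) * ee (- k) p - of_real (val f p * val g p) * ee (- k) p \<partial>torus)"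
        unfolding ft_def by (subst Bochner_Integration.integral_diff) (auto intro!: integrable_mult_ee integrable_val_mult simp del: of_real_mult)
      also have "norm \<dots> \<le> (\<integral>p. norm (of_real (val (?t n) p * val g p) * ee (- k) p - of_real (val f p * val g p) * ee (- k) p) \<partial>torus)"
        by (rule integral_norm_bound)
      also have "\<dots> = (\<integral>p. \<bar>val (?t n - f) p\<bar> * \<bar>val g p\<bar> \<partial>torus)"
      proof (rule integral_cong_AE)
        show "AE p in torus. norm (of_real (val (?t n) p * val g p) * ee (- k) p - of_real (val f p * val g p) * ee (- k) p) = \<bar>val (?t n - f) p\<bar> * \<bar>val g p\<bar>"
          using val_ops(2)[of "?t n" f]
        proof eventually_elim
          case (elim p)
          have "of_real (val (?t n) p * val g p) * ee (- k) p - of_real (val f p * val g p) * ee (- k) p = of_real (val (?t n - f) p * val g p) * ee (- k) p"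
            by (simp add: elim algebra_simps)
          then show ?case by (simp add: norm_mult abs_mult)
        qed
      qed measurable
      also have "\<dots> \<le> norm (?t n - f) * norm g" by (rule integral_abs_mult_le)
      finally show "norm (ft (\<lambda>p. val (?t n) p * val g p) k - ft (\<lambda>p. val f p * val g p) k) \<le> norm (?t n - f) * norm g" .
    qed
  qed
qed

theorem Parseval: "complex_of_real (inner f g) = (\<Sum>\<^sub>\<infinity>l. fc f l * cnj (fc g l))"
proof -
  have "complex_of_real (inner f g) = ft (\<lambda>p. val f p * val g p) 0"
    by (simp add: inner_val ft_def flip: of_real_mult)
  then show ?thesis by (simp add: ft_mult hermitianD[OF hermitian_fc])
qed

lemma norm_eq_n2: "norm f = n2 (\<lambda>k. cmod (fc f k))"
proof -
  have "complex_of_real ((norm f)\<^sup>2) = (\<Sum>\<^sub>\<infinity>l. complex_of_real ((cmod (fc f l))\<^sup>2))"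
    by (simp add: power2_norm_eq_inner Parseval complex_norm_square[symmetric])
  also have "\<dots> = complex_of_real (\<Sum>\<^sub>\<infinity>l. (cmod (fc f l))\<^sup>2)"
    using l2_fc[of f] by (intro infsumI has_sum_of_real has_sum_infsum) (simp add: l2_def)
  finally have "(norm f)\<^sup>2 = (n2 (\<lambda>k. cmod (fc f k)))\<^sup>2"
    unfolding n2_sq by (simp only: of_real_eq_iff)
  then show ?thesis by (simp add: power2_eq_iff_nonneg)
qed

section \<open>Weak derivatives and Sobolev spaces in Fourier coefficients\<close>

text \<open>Fourier symbol of the partial derivative of order (i, j).\<close>

definition dd :: "nat \<Rightarrow> nat \<Rightarrow> freq \<Rightarrow> complex" where
  "dd i j k = dx k ^ i * dy k ^ j"

lemma cnj_dx: "cnj (dx k) = - dx k" "cnj (dy k) = - dy k"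
  by (simp_all add: dx_def dy_def)

lemma cnj_dd: "cnj (dd i j k) = (- 1) ^ (i + j) * dd i j k"
  by (simp add: dd_def cnj_dx power_add power_minus[of "dx k"] power_minus[of "dy k"])

lemma dx_minus: "dx (- k) = cnj (dx k)" "dy (- k) = cnj (dy k)"
  by (simp_all add: dx_def dy_def)

lemma dd_minus: "dd i j (- k) = cnj (dd i j k)"
  by (simp add: dd_def dx_minus)

lemma cmod_dx: "cmod (dx k) = 2 * pi * \<bar>real_of_int (fst k)\<bar>" "cmod (dy k) = 2 * pi * \<bar>real_of_int (snd k)\<bar>"
  by (simp_all add: dx_def dy_def norm_mult)

lemma cmod_dd_le: "cmod (dd i j k) \<le> (2 * pi) ^ (i + j) * mag k ^ (i + j)"
proof -
  have "cmod (dd i j k) \<le> (2 * pi * mag k) ^ i * (2 * pi * mag k) ^ j"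
    unfolding dd_def norm_mult norm_power cmod_dx
    by (intro mult_mono power_mono mult_left_mono abs_le_mag) auto
  then show ?thesis by (simp add: power_mult_distrib power_add mult_ac)
qed

lemma Re_mult_all_eqD: assumes "\<And>c. Re (c * z) = Re (c * w)" shows "z = w"
  using assms[of 1] assms[of \<i>] by (simp add: complex_eq_iff)

lemma inner_cls: "square_integrable \<phi> \<Longrightarrow> inner f (cls \<phi>) = (\<integral>p. val f p * \<phi> p \<partial>torus)"
  using cls_ops(4)[of "val f" \<phi>] by simp

lemma iterated_pd:
  assumes "\<phi> \<in> test_functions"
  shows "(pdx ^^ i) ((pdy ^^ j) \<phi>) \<in> test_functions" "ft ((pdx ^^ i) ((pdy ^^ j) \<phi>)) k = dd i j k * ft \<phi> k"
proof -
  have y: "(pdy ^^ j) \<phi> \<in> test_functions \<and> ft ((pdy ^^ j) \<phi>) k = dy k ^ j * ft \<phi> k"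
    by (induction j) (use assms in \<open>auto simp: test_functions_pd ft_pd\<close>)
  have "(pdx ^^ i) ((pdy ^^ j) \<phi>) \<in> test_functions \<and> ft ((pdx ^^ i) ((pdy ^^ j) \<phi>)) k = dd i j k * ft \<phi> k"
    by (induction i) (use y in \<open>auto simp: test_functions_pd ft_pd dd_def\<close>)
  then show "(pdx ^^ i) ((pdy ^^ j) \<phi>) \<in> test_functions" "ft ((pdx ^^ i) ((pdy ^^ j) \<phi>)) k = dd i j k * ft \<phi> k"
    by auto
qed

lemma Parseval_test:
  assumes "\<phi> \<in> test_functions"
  shows "complex_of_real (\<integral>p. val f p * \<phi> p \<partial>torus) = (\<Sum>\<^sub>\<infinity>l. fc f l * cnj (ft \<phi> l))"
  using Parseval[of f "cls \<phi>"] square_integrable_test[OF assms] by (simp add: fc_cls inner_cls)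

text \<open>Testing with \<open>tg\<close> determines the coefficients of g; conversely, Parseval
  extends the identity to every test function. The sign of repeated integration by parts is that of
  \<open>cnj_dd\<close>.\<close>

theorem has_weak_deriv_iff: "has_weak_deriv i j f g \<longleftrightarrow> (\<forall>k. fc g k = dd i j k * fc f k)"
proof
  assume w: "has_weak_deriv i j f g"
  have "fc g k = dd i j k * fc f k" for k
  proof -
    have r: "Re (complex_of_real r * z) = r * Re z" for r z by simp
    have "Re (c * (dd i j k * cnj (fc f k))) = Re (c * ((- 1) ^ (i + j) * cnj (fc g k)))" for c
    proof -
      have "(\<integral>p. val f p * tg (dd i j k * c) k p \<partial>torus) = (- 1) ^ (i + j) * (\<integral>p. val g p * tg c k p \<partial>torus)"
        using w tg_test_function[of c k] unfolding has_weak_deriv_def dd_def tg_iterated_pd[symmetric] by blast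
      then have "Re (dd i j k * c * cnj (fc f k)) = (- 1) ^ (i + j) * Re (c * cnj (fc g k))"
        unfolding integral_mult_tg(2)[OF integrable_val] fc_def .
      also have "\<dots> = Re (complex_of_real ((- 1) ^ (i + j)) * (c * cnj (fc g k)))" by (simp only: r)
      finally show ?thesis by (simp add: mult_ac)
    qed
    then have "dd i j k * cnj (fc f k) = (- 1) ^ (i + j) * cnj (fc g k)" by (rule Re_mult_all_eqD)
    then have "cnj (dd i j k * cnj (fc f k)) = cnj ((- 1) ^ (i + j) * cnj (fc g k))" by (rule arg_cong)
    then have "(- 1) ^ (i + j) * (dd i j k * fc f k) = (- 1) ^ (i + j) * fc g k"
      by (simp add: cnj_dd mult.assoc)
    then show ?thesis by simp
  qed
  then show "\<forall>k. fc g k = dd i j k * fc f k" by blast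
next
  assume c: "\<forall>k. fc g k = dd i j k * fc f k"
  show "has_weak_deriv i j f g" unfolding has_weak_deriv_def
  proof
    fix \<phi> assume t: "\<phi> \<in> test_functions"
    have "complex_of_real (\<integral>p. val f p * (pdx ^^ i) ((pdy ^^ j) \<phi>) p \<partial>torus) = (\<Sum>\<^sub>\<infinity>l. fc f l * cnj (dd i j l * ft \<phi> l))"
      unfolding Parseval_test[OF iterated_pd(1)[OF t]] iterated_pd(2)[OF t] ..
    also have "\<dots> = (\<Sum>\<^sub>\<infinity>l. (- 1) ^ (i + j) * (fc g l * cnj (ft \<phi> l)))"
      by (rule infsum_cong) (simp add: cnj_dd spec[OF c])
    also have "\<dots> = (- 1) ^ (i + j) * complex_of_real (\<integral>p. val g p * \<phi> p \<partial>torus)"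
      unfolding Parseval_test[OF t] by (rule infsum_cmult_right')
    also have "\<dots> = complex_of_real ((- 1) ^ (i + j) * (\<integral>p. val g p * \<phi> p \<partial>torus))" by simp
    finally show "(\<integral>p. val f p * (pdx ^^ i) ((pdy ^^ j) \<phi>) p \<partial>torus) = (- 1) ^ (i + j) * (\<integral>p. val g p * \<phi> p \<partial>torus)"
      by (simp only: of_real_eq_iff)
  qed
qed

lemma weak_deriv_eq: assumes "has_weak_deriv i j f g" shows "weak_deriv i j f = g"
  unfolding weak_deriv_def
  by (rule the_equality[where P = "has_weak_deriv i j f"])
    (use assms in \<open>auto simp: has_weak_deriv_iff intro!: fc_eqI\<close>)

lemma fc_weak_deriv: assumes "f \<in> sobolev s" "i + j \<le> s" shows "fc (weak_deriv i j f) k = dd i j k * fc f k"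
proof -
  obtain g where g: "has_weak_deriv i j f g" using assms unfolding sobolev_def by blast
  show ?thesis using g unfolding weak_deriv_eq[OF g] has_weak_deriv_iff by blast
qed

lemma hermitian_dd: "hermitian a \<Longrightarrow> hermitian (\<lambda>k. dd i j k * a k)"
  unfolding hermitian_def by (simp add: dd_minus del: split_paired_All)

text \<open>The two pure derivatives of order s suffice, since |k|^s is at most 2^s times the sum of
  the s-th powers of the components.\<close>

lemma sobolev_imp_hs: assumes "f \<in> sobolev s" "f \<in> mean_zero" shows "hs s (fc f)"
  unfolding hs_def
proof
  show "fc f 0 = 0" using assms(2) by (simp add: fc_mean_zero)
  have l: "l2 (\<lambda>k. 2 ^ s * (cmod (fc (weak_deriv s 0 f) k) + cmod (fc (weak_deriv 0 s f) k)))"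
    by (intro l2_cmult l2_add l2_fc)
  show "l2 (\<lambda>k. mag k ^ s * cmod (fc f k))"
  proof (rule l2_mono(1)[OF l])
    fix k
    define x y where "x = \<bar>real_of_int (fst k)\<bar>" and "y = \<bar>real_of_int (snd k)\<bar>"
    have xy: "0 \<le> x" "0 \<le> y" by (auto simp: x_def y_def)
    have "mag k \<le> x + y" unfolding mag_def x_def y_def using norm_Pair_le[of "real_of_int (fst k)" "real_of_int (snd k)"] by simp
    also have "\<dots> \<le> 2 * max x y" by simp
    finally have "mag k ^ s \<le> (2 * max x y) ^ s" by (intro power_mono) auto
    also have "\<dots> \<le> 2 ^ s * (x ^ s + y ^ s)" unfolding power_mult_distrib
      using xy by (intro mult_left_mono) (auto simp: max_def)
    also have "\<dots> \<le> 2 ^ s * ((2 * pi * x) ^ s + (2 * pi * y) ^ s)"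
    proof (intro mult_left_mono add_mono power_mono)
      have "1 \<le> 2 * pi" using pi_gt3 by linarith
      then show "x \<le> 2 * pi * x" "y \<le> 2 * pi * y" using xy mult_right_mono[of 1 "2 * pi"] by force+
    qed (use xy in auto)
    finally have "mag k ^ s * cmod (fc f k) \<le> 2 ^ s * ((2 * pi * x) ^ s + (2 * pi * y) ^ s) * cmod (fc f k)"
      by (rule mult_right_mono) simp
    also have "\<dots> = 2 ^ s * (cmod (fc (weak_deriv s 0 f) k) + cmod (fc (weak_deriv 0 s f) k))"
      using assms(1) by (simp add: fc_weak_deriv dd_def norm_mult norm_power cmod_dx x_def y_def algebra_simps)
    finally show "\<bar>mag k ^ s * cmod (fc f k)\<bar> \<le> \<bar>2 ^ s * (cmod (fc (weak_deriv s 0 f) k) + cmod (fc (weak_deriv 0 s f) k))\<bar>"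
      by (simp add: abs_mult)
  qed
qed

lemma hs_dd:
  assumes "hs s a" "i + j \<le> s"
  shows "l2 (\<lambda>k. cmod (dd i j k * a k))" "n2 (\<lambda>k. cmod (dd i j k * a k)) \<le> (2 * pi) ^ (i + j) * nw 0 s a"
proof -
  have h: "hs (i + j) a" "nw 0 (i + j) a \<le> nw 0 s a" using hs_lower[OF assms] by auto
  have l: "l2 (\<lambda>k. (2 * pi) ^ (i + j) * (mag k ^ (i + j) * cmod (a k)))"
    using h(1) by (intro l2_cmult) (simp add: hs_def)
  have b: "\<bar>cmod (dd i j k * a k)\<bar> \<le> \<bar>(2 * pi) ^ (i + j) * (mag k ^ (i + j) * cmod (a k))\<bar>" for k
    using mult_right_mono[OF cmod_dd_le[of i j k] norm_ge_zero[of "a k"]] by (simp add: norm_mult abs_mult mult.assoc)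
  show "l2 (\<lambda>k. cmod (dd i j k * a k))" by (rule l2_mono(1)[OF l b])
  have "n2 (\<lambda>k. cmod (dd i j k * a k)) \<le> n2 (\<lambda>k. (2 * pi) ^ (i + j) * (mag k ^ (i + j) * cmod (a k)))"
    by (rule l2_mono(2)[OF l b])
  also have "\<dots> = (2 * pi) ^ (i + j) * nw 0 (i + j) a"
    unfolding nw_0[OF h(1)] using h(1) by (subst l2_cmult(2)) (auto simp: hs_def)
  also have "\<dots> \<le> (2 * pi) ^ (i + j) * nw 0 s a" using h(2) by (intro mult_left_mono) auto
  finally show "n2 (\<lambda>k. cmod (dd i j k * a k)) \<le> (2 * pi) ^ (i + j) * nw 0 s a" .
qed

lemma hs_imp_sobolev: assumes "hs s (fc f)" shows "f \<in> sobolev s"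
  unfolding sobolev_def
proof (intro CollectI allI impI)
  fix i j :: nat assume ij: "i + j \<le> s"
  have "\<exists>g. fc g = (\<lambda>k. dd i j k * fc f k) \<and> (\<lambda>n. tp (Box n) (\<lambda>k. dd i j k * fc f k)) \<longlonglongrightarrow> g"
    by (rule Riesz_Fischer[OF hermitian_dd[OF hermitian_fc] hs_dd(1)[OF assms ij]])
  then show "\<exists>g. has_weak_deriv i j f g" unfolding has_weak_deriv_iff by metis
qed

lemma hs_imp_mean_zero: "hs s (fc f) \<Longrightarrow> f \<in> mean_zero"
  by (simp add: fc_mean_zero hs_def)

text \<open>Transfers convergence in the homogeneous coefficient norm to the norm of the statement,
  which sums over all derivatives.\<close>

lemma sobolev_norm_le:
  assumes "hs s (fc f)"
  shows "sobolev_norm s f \<le> sqrt (real (card {(i, j). i + j \<le> s})) * (2 * pi) ^ s * nw 0 s (fc f)"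
proof -
  let ?S = "{(i, j). i + j \<le> s}"
  have "?S \<subseteq> {..s} \<times> {..s}" by auto
  then have S: "finite ?S" by (rule finite_subset) auto
  have f: "f \<in> sobolev s" by (rule hs_imp_sobolev[OF assms])
  have "(\<Sum>(i, j)\<in>?S. (norm (weak_deriv i j f))\<^sup>2) \<le> (\<Sum>(i, j)\<in>?S. ((2 * pi) ^ s * nw 0 s (fc f))\<^sup>2)"
  proof (rule sum_mono, clarify, rule power_mono)
    fix i j assume ij: "i + j \<le> s"
    have "norm (weak_deriv i j f) = n2 (\<lambda>k. cmod (dd i j k * fc f k))"
      unfolding norm_eq_n2 fc_weak_deriv[OF f ij] ..
    also have "\<dots> \<le> (2 * pi) ^ (i + j) * nw 0 s (fc f)" by (rule hs_dd(2)[OF assms ij])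
    also have "\<dots> \<le> (2 * pi) ^ s * nw 0 s (fc f)"
      using ij pi_gt3 by (intro mult_right_mono power_increasing) auto
    finally show "norm (weak_deriv i j f) \<le> (2 * pi) ^ s * nw 0 s (fc f)" .
  qed simp
  also have "\<dots> = real (card ?S) * ((2 * pi) ^ s * nw 0 s (fc f))\<^sup>2" by (simp add: case_prod_beta)
  finally have "sobolev_norm s f \<le> sqrt (real (card ?S) * ((2 * pi) ^ s * nw 0 s (fc f))\<^sup>2)"
    unfolding sobolev_norm_def by (rule real_sqrt_le_mono)
  then show ?thesis by (simp add: real_sqrt_mult mult.assoc)
qed

lemma sobolev_norm_nonneg: "0 \<le> sobolev_norm s f"
  unfolding sobolev_norm_def by (intro real_sqrt_ge_zero sum_nonneg) auto

lemma continuous_into_sobolevI: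
  assumes h: "\<And>t. t \<in> {0..T} \<Longrightarrow> hs s (fc (v t))"
    and c: "\<And>t. t \<in> {0..T} \<Longrightarrow> ((\<lambda>r. nw 0 s (\<lambda>k. fc (v r) k - fc (v t) k)) \<longlongrightarrow> 0) (at t within {0..T})"
  shows "continuous_into_sobolev s T v"
  unfolding continuous_into_sobolev_def
proof (intro ballI conjI)
  fix t assume t: "t \<in> {0..T}"
  show "v t \<in> sobolev s" by (rule hs_imp_sobolev[OF h[OF t]])
  let ?C = "sqrt (real (card {(i, j). i + j \<le> s})) * (2 * pi) ^ s"
  show "((\<lambda>r. sobolev_norm s (v r - v t)) \<longlongrightarrow> 0) (at t within {0..T})"
  proof (rule tendsto_sandwich[OF _ _ tendsto_const])
    show "((\<lambda>r. ?C * nw 0 s (\<lambda>k. fc (v r) k - fc (v t) k)) \<longlongrightarrow> 0) (at t within {0..T})"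
      using tendsto_mult[OF tendsto_const c[OF t], of ?C] by simp
    show "\<forall>\<^sub>F r in at t within {0..T}. 0 \<le> sobolev_norm s (v r - v t)" by (simp add: sobolev_norm_nonneg)
    have e: "fc (v r - v t) = (\<lambda>k. fc (v r) k - fc (v t) k)" for r by (simp add: fun_eq_iff fc_diff)
    have "sobolev_norm s (v r - v t) \<le> ?C * nw 0 s (\<lambda>k. fc (v r) k - fc (v t) k)" if "r \<in> {0..T}" for r
      using sobolev_norm_le[of s "v r - v t"] hs_diff[OF h[OF that] h[OF t]] unfolding e by blast
    then show "\<forall>\<^sub>F r in at t within {0..T}. sobolev_norm s (v r - v t) \<le> ?C * nw 0 s (\<lambda>k. fc (v r) k - fc (v t) k)"
      by (auto simp: eventually_at_filter)
  qed
qed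

subsection \<open>The Helmholtz operator\<close>

lemma dd_laplacian: "dd 2 0 k + dd 0 2 k = - of_real (4 * pi\<^sup>2 * (mag k)\<^sup>2)"
  by (simp add: dd_def dx_def dy_def mag_sq power_mult_distrib algebra_simps)

lemma helmholtz_symbol: "of_real (1 + 4 * pi\<^sup>2 * (mag k)\<^sup>2) \<noteq> (0 :: complex)"
proof -
  have "0 < 1 + 4 * pi\<^sup>2 * (mag k)\<^sup>2" by (intro add_pos_nonneg) auto
  then show ?thesis by (simp only: of_real_eq_0_iff)
qed

lemma fc_helmholtz: assumes "\<psi> \<in> sobolev 2"
  shows "fc (laplacian \<psi> - \<psi>) k = - of_real (1 + 4 * pi\<^sup>2 * (mag k)\<^sup>2) * fc \<psi> k"
proof -
  have "fc (laplacian \<psi> - \<psi>) k = (dd 2 0 k + dd 0 2 k) * fc \<psi> k - fc \<psi> k"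
    using assms by (simp add: laplacian_def fc_diff fc_add fc_weak_deriv distrib_right)
  also have "(dd 2 0 k + dd 0 2 k) * z - z = - of_real (1 + 4 * pi\<^sup>2 * (mag k)\<^sup>2) * z" for z
    unfolding dd_laplacian by (simp add: algebra_simps)
  finally show ?thesis .
qed

text \<open>The symbol of the operator never vanishes, so the equation is solved, and its solution
  determined, coefficient by coefficient.\<close>

lemma inv_helmholtz:
  assumes "\<psi> \<in> sobolev 2" "\<And>k. fc \<psi> k = - fc g k / of_real (1 + 4 * pi\<^sup>2 * (mag k)\<^sup>2)"
  shows "inv_helmholtz g = \<psi>"
  unfolding inv_helmholtz_def
proof (rule the_equality)
  have c: "- w * (- z / w) = z" "- (- w * z) / w = z" if "w \<noteq> 0" for w z :: complex using that by simp_all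
  have "laplacian \<psi> - \<psi> = g"
    by (rule fc_eqI) (simp only: fc_helmholtz[OF assms(1)] assms(2) c(1)[OF helmholtz_symbol])
  then show "\<psi> \<in> sobolev 2 \<and> laplacian \<psi> - \<psi> = g" using assms by simp
  fix \<theta> assume t: "\<theta> \<in> sobolev 2 \<and> laplacian \<theta> - \<theta> = g"
  show "\<theta> = \<psi>"
  proof (rule fc_eqI)
    fix k
    have "fc g k = - of_real (1 + 4 * pi\<^sup>2 * (mag k)\<^sup>2) * fc \<theta> k" using fc_helmholtz[of \<theta> k] t by simp
    then show "fc \<theta> k = fc \<psi> k" by (simp only: assms(2) c(2)[OF helmholtz_symbol])
  qed
qed

subsection \<open>The weak divergence of a transport flux\<close>

text \<open>Young's inequality for a summable and a square-summable family: finite sums of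
  translates obey Minkowski's inequality, and the bound passes to the limit.\<close>

lemma conv_l2:
  fixes \<alpha> \<beta> :: "'a::ab_group_add \<Rightarrow> real"
  assumes \<alpha>: "\<And>l. 0 \<le> \<alpha> l" "\<alpha> summable_on UNIV" and \<beta>: "l2 \<beta>"
    and c: "\<And>k. \<bar>c k\<bar> \<le> (\<Sum>\<^sub>\<infinity>l. \<alpha> l * \<bar>\<beta> (k - l)\<bar>)"
  shows "l2 c" "n2 c \<le> infsum \<alpha> UNIV * n2 \<beta>"
proof -
  have sm: "(\<lambda>l. \<alpha> l * \<bar>\<beta> (k - l)\<bar>) summable_on UNIV" for k
  proof (rule summable_on_comparison_test)
    show "(\<lambda>l. n2 \<beta> * \<alpha> l) summable_on UNIV" by (intro summable_on_cmult_right \<alpha>)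
    show "\<alpha> l * \<bar>\<beta> (k - l)\<bar> \<le> n2 \<beta> * \<alpha> l" for l
      using mult_left_mono[OF abs_le_n2[OF \<beta>, of "k - l"] \<alpha>(1)[of l]] by (simp add: mult.commute)
  qed (use \<alpha> in auto)
  have "L2_set c A \<le> infsum \<alpha> UNIV * n2 \<beta>" if A: "finite A" for A
  proof -
    have fin: "L2_set (\<lambda>k. \<Sum>l\<in>L. \<alpha> l * \<bar>\<beta> (k - l)\<bar>) A \<le> (\<Sum>l\<in>L. \<alpha> l) * n2 \<beta>" if "finite L" for L
      using that
    proof induction
      case empty show ?case by (simp add: L2_set_0')
    next
      case (insert l L)
      have "L2_set (\<lambda>k. \<alpha> l * \<bar>\<beta> (k - l)\<bar>) A = \<alpha> l * L2_set (\<lambda>k. \<bar>\<beta> (k - l)\<bar>) A"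
        by (rule L2_set_right_distrib[symmetric]) (rule \<alpha>)
      also have "L2_set (\<lambda>k. \<bar>\<beta> (k - l)\<bar>) A = L2_set \<beta> ((\<lambda>k. k - l) ` A)"
        unfolding L2_set_def by (subst sum.reindex) (auto simp: inj_on_def)
      also have "\<alpha> l * \<dots> \<le> \<alpha> l * n2 \<beta>" using A by (intro mult_left_mono L2_set_le_n2 \<beta> \<alpha>) auto
      finally have "L2_set (\<lambda>k. \<alpha> l * \<bar>\<beta> (k - l)\<bar>) A \<le> \<alpha> l * n2 \<beta>" .
      then show ?case
        using insert L2_set_triangle_ineq[of "\<lambda>k. \<alpha> l * \<bar>\<beta> (k - l)\<bar>" "\<lambda>k. \<Sum>l\<in>L. \<alpha> l * \<bar>\<beta> (k - l)\<bar>" A]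
        by (simp add: distrib_right)
    qed
    have "L2_set c A \<le> L2_set (\<lambda>k. \<Sum>\<^sub>\<infinity>l. \<alpha> l * \<bar>\<beta> (k - l)\<bar>) A"
    proof (rule L2_set_mono_abs)
      fix k
      have "0 \<le> (\<Sum>\<^sub>\<infinity>l. \<alpha> l * \<bar>\<beta> (k - l)\<bar>)" using \<alpha> by (intro infsum_nonneg) auto
      then show "\<bar>c k\<bar> \<le> \<bar>\<Sum>\<^sub>\<infinity>l. \<alpha> l * \<bar>\<beta> (k - l)\<bar>\<bar>" using c[of k] by linarith
    qed
    also have "\<dots> \<le> infsum \<alpha> UNIV * n2 \<beta>"
    proof (rule tendsto_upperbound)
      show "((\<lambda>L. L2_set (\<lambda>k. \<Sum>l\<in>L. \<alpha> l * \<bar>\<beta> (k - l)\<bar>) A) \<longlongrightarrow> L2_set (\<lambda>k. \<Sum>\<^sub>\<infinity>l. \<alpha> l * \<bar>\<beta> (k - l)\<bar>) A) (finite_subsets_at_top UNIV)"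
        unfolding L2_set_def by (intro tendsto_real_sqrt tendsto_sum tendsto_power infsum_tendsto sm)
      show "\<forall>\<^sub>F L in finite_subsets_at_top UNIV. L2_set (\<lambda>k. \<Sum>l\<in>L. \<alpha> l * \<bar>\<beta> (k - l)\<bar>) A \<le> infsum \<alpha> UNIV * n2 \<beta>"
      proof (rule eventually_finite_subsets_at_top_weakI)
        fix L :: "'a set" assume L: "finite L"
        have "(\<Sum>l\<in>L. \<alpha> l) \<le> infsum \<alpha> UNIV" using \<alpha> L by (intro finite_sum_le_infsum) auto
        then have "(\<Sum>l\<in>L. \<alpha> l) * n2 \<beta> \<le> infsum \<alpha> UNIV * n2 \<beta>" by (intro mult_right_mono) auto
        then show "L2_set (\<lambda>k. \<Sum>l\<in>L. \<alpha> l * \<bar>\<beta> (k - l)\<bar>) A \<le> infsum \<alpha> UNIV * n2 \<beta>" using fin[OF L] by linarith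
      qed
    qed simp
    finally show ?thesis .
  qed
  from l2I[OF this] show "l2 c" "n2 c \<le> infsum \<alpha> UNIV * n2 \<beta>" by auto
qed

text \<open>With \<xi> at order 4 the family |k| |\<xi> k| is summable, so the Jacobian is
  square-summable. The quantitative bound later gives continuity in time.\<close>

lemma jac_l2:
  assumes x: "hs 4 \<xi>" and a: "hs 2 a"
  shows "l2 (\<lambda>k. cmod (jac \<xi> a k))" "n2 (\<lambda>k. cmod (jac \<xi> a k)) \<le> 4 * pi\<^sup>2 * latK * (nw 0 4 \<xi> * nw 0 2 a)"
proof -
  have h: "hs 3 \<xi>" "hs 1 a" "nw 0 3 \<xi> \<le> nw 0 4 \<xi>" "nw 0 1 a \<le> nw 0 2 a"
    using hs_lower[OF x, of 3] hs_lower[OF a, of 1] by auto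
  let ?\<alpha> = "\<lambda>j. mag j ^ 1 * cmod (\<xi> j)" and ?\<beta> = "\<lambda>l. mag l ^ 1 * cmod (a l)"
  have s1: "?\<alpha> summable_on UNIV" "infsum ?\<alpha> UNIV \<le> latK * nw 0 3 \<xi>"
    using hs_l1[of 1 \<xi>] h(1) by (simp_all add: numeral_3_eq_3 eval_nat_numeral)
  have s2: "l2 ?\<beta>" "n2 ?\<beta> = nw 0 1 a" using h(2) by (auto simp: hs_def nw_0)
  have b: "\<bar>cmod (jac \<xi> a k) / (4 * pi\<^sup>2)\<bar> \<le> (\<Sum>\<^sub>\<infinity>l. ?\<alpha> l * \<bar>?\<beta> (k - l)\<bar>)" for k
  proof -
    let ?f = "\<lambda>l. of_real (sg k l) * \<xi> (k - l) * a l"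
    have bij: "bij_betw (\<lambda>l. k - l) UNIV UNIV" by (rule bij_betwI[where g = "\<lambda>l. k - l"]) auto
    have sm: "(\<lambda>l. ?\<alpha> l * \<bar>?\<beta> (k - l)\<bar>) summable_on UNIV"
    proof (rule summable_on_comparison_test)
      show "(\<lambda>l. n2 ?\<beta> * ?\<alpha> l) summable_on UNIV" by (intro summable_on_cmult_right s1)
      show "?\<alpha> l * \<bar>?\<beta> (k - l)\<bar> \<le> n2 ?\<beta> * ?\<alpha> l" for l
        using mult_left_mono[OF abs_le_n2[OF s2(1), of "k - l"], of "?\<alpha> l"] by (simp add: mult.commute)
    qed auto
    have sm': "(\<lambda>l. ?\<alpha> (k - l) * ?\<beta> l) summable_on UNIV"
      using sm summable_on_reindex_bij_betw[OF bij, of "\<lambda>l. ?\<alpha> l * \<bar>?\<beta> (k - l)\<bar>"] by (simp add: abs_mult)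
    have "cmod (\<Sum>\<^sub>\<infinity>l. ?f l) \<le> (\<Sum>\<^sub>\<infinity>l. ?\<alpha> (k - l) * ?\<beta> l)"
    proof (rule norm_infsum_le[OF has_sum_infsum has_sum_infsum])
      show "?f summable_on UNIV" by (rule jac_summable[OF x a])
      show "norm (?f l) \<le> ?\<alpha> (k - l) * ?\<beta> l" for l
        using mult_right_mono[OF abs_sg_shift_le(1)[of k l], of "cmod (\<xi> (k - l)) * cmod (a l)"]
        by (simp add: norm_mult mult_ac)
    qed (rule sm')
    also have "\<dots> = (\<Sum>\<^sub>\<infinity>l. ?\<alpha> l * \<bar>?\<beta> (k - l)\<bar>)"
      using infsum_reindex_bij_betw[OF bij, of "\<lambda>l. ?\<alpha> l * \<bar>?\<beta> (k - l)\<bar>"] by (simp add: abs_mult)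
    finally show ?thesis by (simp add: jac_def norm_mult norm_power)
  qed
  have n: "l2 (\<lambda>k. cmod (jac \<xi> a k) / (4 * pi\<^sup>2))" "n2 (\<lambda>k. cmod (jac \<xi> a k) / (4 * pi\<^sup>2)) \<le> infsum ?\<alpha> UNIV * n2 ?\<beta>"
    by (rule conv_l2[OF _ s1(1) s2(1) b]; simp)+
  have e: "(\<lambda>k. cmod (jac \<xi> a k)) = (\<lambda>k. (4 * pi\<^sup>2) * (cmod (jac \<xi> a k) / (4 * pi\<^sup>2)))" by simp
  show "l2 (\<lambda>k. cmod (jac \<xi> a k))" by (subst e) (rule l2_cmult(1)[OF n(1)])
  have "n2 (\<lambda>k. cmod (jac \<xi> a k)) = \<bar>4 * pi\<^sup>2\<bar> * n2 (\<lambda>k. cmod (jac \<xi> a k) / (4 * pi\<^sup>2))"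
    by (subst e) (rule l2_cmult(2)[OF n(1)])
  also have "\<dots> \<le> \<bar>4 * pi\<^sup>2\<bar> * (latK * nw 0 4 \<xi> * nw 0 2 a)"
  proof (rule mult_left_mono)
    have "infsum ?\<alpha> UNIV * n2 ?\<beta> \<le> (latK * nw 0 4 \<xi>) * nw 0 2 a"
    proof (rule mult_mono)
      show "infsum ?\<alpha> UNIV \<le> latK * nw 0 4 \<xi>" using s1(2) mult_left_mono[OF h(3) latK_nonneg] by linarith
      show "n2 ?\<beta> \<le> nw 0 2 a" using s2 h by simp
    qed auto
    then show "n2 (\<lambda>k. cmod (jac \<xi> a k) / (4 * pi\<^sup>2)) \<le> latK * nw 0 4 \<xi> * nw 0 2 a" using n(2) by linarith
  qed simp
  finally show "n2 (\<lambda>k. cmod (jac \<xi> a k)) \<le> 4 * pi\<^sup>2 * latK * (nw 0 4 \<xi> * nw 0 2 a)" by (simp add: mult.assoc)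
qed

text \<open>A function at order 2 has summable coefficients and therefore multiplies L2 into itself.
  P is built from the coefficients of the product and identified with it by
  \<open>ft_unique\<close>.\<close>

lemma product_in_L2:
  assumes a: "hs 2 (fc a)"
  obtains P where "AE p in torus. val P p = val a p * val u p" "\<And>k. fc P k = (\<Sum>\<^sub>\<infinity>l. fc a l * fc u (k - l))"
proof -
  let ?c = "ft (\<lambda>p. val a p * val u p)"
  have s: "(\<lambda>k. cmod (fc a k)) summable_on UNIV" using hs_l1(1)[of 0 "fc a"] a by (simp add: numeral_2_eq_2)
  have "l2 (\<lambda>k. cmod (?c k))"
  proof (rule conv_l2(1)[OF _ s l2_fc[of u]])
    fix k
    have sm: "(\<lambda>l. norm (fc a l * fc u (k - l))) summable_on UNIV"
      unfolding norm_mult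
      by (rule summable_l2_mult(1)[OF l2_fc l2_shift[where \<alpha> = "\<lambda>k. cmod (fc u k)", OF l2_fc]])
    have "cmod (?c k) \<le> (\<Sum>\<^sub>\<infinity>l. norm (fc a l * fc u (k - l)))"
      unfolding ft_mult by (rule norm_infsum_bound[OF sm])
    then show "\<bar>cmod (?c k)\<bar> \<le> (\<Sum>\<^sub>\<infinity>l. cmod (fc a l) * \<bar>cmod (fc u (k - l))\<bar>)" by (simp add: norm_mult)
  qed simp
  then obtain P where P: "fc P = ?c" using Riesz_Fischer[OF hermitian_ft] by blast
  have "AE p in torus. val P p - val a p * val u p = 0"
  proof (rule ft_unique)
    show "integrable torus (\<lambda>p. val P p - val a p * val u p)" by (intro Bochner_Integration.integrable_diff integrable_val integrable_val_mult)
    have "ft (\<lambda>p. val P p + (- 1) * (val a p * val u p)) k = ft (val P) k + of_real (- 1) * ?c k" for k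
      using ft_add[OF integrable_val integrable_mult_right[OF integrable_val_mult], of P "- 1" a u k] unfolding ft_cmult .
    then show "ft (\<lambda>p. val P p - val a p * val u p) k = 0" for k using P[unfolded fc_def] by simp
  qed
  then have "AE p in torus. val P p = val a p * val u p" by eventually_elim simp
  then show ?thesis using P by (intro that[of P]) (auto simp: ft_mult)
qed

text \<open>The velocity enters through its coefficients, so that the result applies both to
  \<open>velocity f \<omega>\<close> and to \<open>u\<^sub>h\<close>.\<close>

theorem weak_div_flux:
  assumes a: "hs 2 (fc a)" and x: "hs 4 \<xi>"
    and u: "\<And>k. fc (fst u) k = - dy k * \<xi> k" "\<And>k. fc (snd u) k = dx k * \<xi> k"
  shows "fc (weak_div (flux a u)) k = - jac \<xi> (fc a) k"
proof -
  obtain P where P: "AE p in torus. val P p = val a p * val (fst u) p" "\<And>k. fc P k = (\<Sum>\<^sub>\<infinity>l. fc a l * fc (fst u) (k - l))"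
    using product_in_L2[OF a, of "fst u"] by blast
  obtain Q where Q: "AE p in torus. val Q p = val a p * val (snd u) p" "\<And>k. fc Q k = (\<Sum>\<^sub>\<infinity>l. fc a l * fc (snd u) (k - l))"
    using product_in_L2[OF a, of "snd u"] by blast
  have J: "dx k * fc P k + dy k * fc Q k = - jac \<xi> (fc a) k" for k
  proof -
    have "dx k * fc P k + dy k * fc Q k = (\<Sum>\<^sub>\<infinity>l. dx k * (fc a l * fc (fst u) (k - l)) + dy k * (fc a l * fc (snd u) (k - l)))"
      unfolding P(2) Q(2) infsum_cmult_right'[symmetric]
      by (rule infsum_add[symmetric]; intro summable_on_cmult_right summable_conv l2_fc)
    also have "\<dots> = (\<Sum>\<^sub>\<infinity>l. - of_real (4 * pi\<^sup>2) * (of_real (sg k l) * \<xi> (k - l) * fc a l))"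
    proof (rule infsum_cong)
      fix l
      \<comment> \<open>The cross product of k with k - l is minus that with l, and the two
        derivatives contribute (2 pi \<i>)^2.\<close>
      have e: "dy k * dx (k - l) - dx k * dy (k - l) = - of_real (4 * pi\<^sup>2) * of_real (sg k l)"
        by (simp add: dx_def dy_def sg_def power2_eq_square algebra_simps)
      have "dx k * (fc a l * fc (fst u) (k - l)) + dy k * (fc a l * fc (snd u) (k - l)) = (dy k * dx (k - l) - dx k * dy (k - l)) * \<xi> (k - l) * fc a l"
        unfolding u by (simp add: algebra_simps)
      then show "dx k * (fc a l * fc (fst u) (k - l)) + dy k * (fc a l * fc (snd u) (k - l)) = - of_real (4 * pi\<^sup>2) * (of_real (sg k l) * \<xi> (k - l) * fc a l)"
        unfolding e by (simp only: mult.assoc)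
    qed
    also have "\<dots> = - jac \<xi> (fc a) k" unfolding infsum_cmult_right' jac_def by simp
    finally show ?thesis .
  qed
  have her: "hermitian (\<lambda>k. - jac \<xi> (fc a) k)"
    unfolding J[symmetric] hermitian_def by (simp add: dx_minus hermitianD[OF hermitian_fc])
  obtain G where G: "fc G = (\<lambda>k. - jac \<xi> (fc a) k)"
    using Riesz_Fischer[OF her] jac_l2(1)[OF x a] by (simp add: norm_minus_cancel) blast
  have F: "flux a u p = (val a p * val (fst u) p, val a p * val (snd u) p)" for p
    by (simp add: flux_def vval_def)
  have Fi: "integrable torus (flux a u)"
  proof (rule Bochner_Integration.integrable_bound)
    show "integrable torus (\<lambda>p. \<bar>val a p * val (fst u) p\<bar> + \<bar>val a p * val (snd u) p\<bar>)"
      by (intro Bochner_Integration.integrable_add integrable_abs integrable_val_mult)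
    show "flux a u \<in> borel_measurable torus" unfolding F[abs_def] borel_prod[symmetric] by measurable
    show "AE p in torus. norm (flux a u p) \<le> norm (\<bar>val a p * val (fst u) p\<bar> + \<bar>val a p * val (snd u) p\<bar>)"
    proof (rule AE_I2)
      fix p
      show "norm (flux a u p) \<le> norm (\<bar>val a p * val (fst u) p\<bar> + \<bar>val a p * val (snd u) p\<bar>)"
        unfolding F using norm_Pair_le[of "val a p * val (fst u) p" "val a p * val (snd u) p"] by simp
    qed
  qed
  have int: "(\<integral>p. flux a u p \<bullet> (\<phi> p, \<theta> p) \<partial>torus) = (\<integral>p. val P p * \<phi> p \<partial>torus) + (\<integral>p. val Q p * \<theta> p \<partial>torus)"
    if "square_integrable \<phi>" "square_integrable \<theta>" for \<phi> \<theta>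
  proof -
    have i: "integrable torus (\<lambda>p. val P p * \<phi> p)" "integrable torus (\<lambda>p. val Q p * \<theta> p)"
      using that by (auto intro: square_integrable_mult)
    have m: "\<phi> \<in> borel_measurable torus" "\<theta> \<in> borel_measurable torus" using that by (auto simp: square_integrable_def)
    have "(\<integral>p. flux a u p \<bullet> (\<phi> p, \<theta> p) \<partial>torus) = (\<integral>p. val P p * \<phi> p + val Q p * \<theta> p \<partial>torus)"
    proof (rule integral_cong_AE)
      show "AE p in torus. flux a u p \<bullet> (\<phi> p, \<theta> p) = val P p * \<phi> p + val Q p * \<theta> p"
        using P(1) Q(1) by eventually_elim (simp add: F)
      show "(\<lambda>p. flux a u p \<bullet> (\<phi> p, \<theta> p)) \<in> borel_measurable torus" unfolding F using m by simp
    qed (use m in simp)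
    then show ?thesis using i by (simp add: Bochner_Integration.integral_add)
  qed
  have wd: "has_weak_div (flux a u) G" unfolding has_weak_div_def
  proof (intro conjI Fi ballI)
    fix \<phi> assume t: "\<phi> \<in> test_functions"
    note t' = test_functions_pd[OF t]
    have sm: "(\<lambda>l. fc R l * cnj (ft \<theta> l)) summable_on UNIV" if "\<theta> \<in> test_functions" for R \<theta>
    proof (rule abs_summable_summable)
      show "(\<lambda>l. norm (fc R l * cnj (ft \<theta> l))) summable_on UNIV"
        using summable_l2_mult(1)[OF l2_fc[of R] l2_fc[of "cls \<theta>"]] fc_cls[OF square_integrable_test[OF that]]
        by (simp add: norm_mult)
    qed
    have "complex_of_real (\<integral>p. flux a u p \<bullet> (pdx \<phi> p, pdy \<phi> p) \<partial>torus)
        = (\<Sum>\<^sub>\<infinity>l. fc P l * cnj (ft (pdx \<phi>) l)) + (\<Sum>\<^sub>\<infinity>l. fc Q l * cnj (ft (pdy \<phi>) l))"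
      unfolding int[OF square_integrable_test[OF t'(1)] square_integrable_test[OF t'(2)]] of_real_add Parseval_test[OF t'(1)] Parseval_test[OF t'(2)] ..
    also have "\<dots> = (\<Sum>\<^sub>\<infinity>l. fc P l * cnj (ft (pdx \<phi>) l) + fc Q l * cnj (ft (pdy \<phi>) l))"
      by (rule infsum_add[symmetric]; rule sm; rule t')
    also have "\<dots> = (\<Sum>\<^sub>\<infinity>l. - (fc G l * cnj (ft \<phi> l)))"
    proof (rule infsum_cong)
      fix l
      have "fc P l * cnj (ft (pdx \<phi>) l) + fc Q l * cnj (ft (pdy \<phi>) l) = - ((dx l * fc P l + dy l * fc Q l) * cnj (ft \<phi> l))"
        unfolding ft_pd[OF t] by (simp add: cnj_dx algebra_simps)
      then show "fc P l * cnj (ft (pdx \<phi>) l) + fc Q l * cnj (ft (pdy \<phi>) l) = - (fc G l * cnj (ft \<phi> l))"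
        unfolding J G .
    qed
    also have "\<dots> = complex_of_real (- (\<integral>p. val G p * \<phi> p \<partial>torus))"
      unfolding infsum_uminus of_real_minus Parseval_test[OF t] ..
    finally show "(\<integral>p. flux a u p \<bullet> (pdx \<phi> p, pdy \<phi> p) \<partial>torus) = - (\<integral>p. val G p * \<phi> p \<partial>torus)"
      by (simp only: of_real_eq_iff)
  qed
  \<comment> \<open>The test functions \<open>tg\<close> determine all coefficients, so the
    description picks out G.\<close>
  have "weak_div (flux a u) = G" unfolding weak_div_def
  proof (rule the_equality[where P = "has_weak_div (flux a u)", OF wd])
    fix H assume H: "has_weak_div (flux a u) H"
    show "H = G"
    proof (rule fc_eqI)
      fix k
      have "Re (c * cnj (fc H k)) = Re (c * cnj (fc G k))" for c
      proof -
        have "- (\<integral>p. val H p * tg c k p \<partial>torus) = - (\<integral>p. val G p * tg c k p \<partial>torus)"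
          using H wd tg_test_function[of c k] unfolding has_weak_div_def by metis
        then show ?thesis unfolding integral_mult_tg(2)[OF integrable_val] fc_def by simp
      qed
      then have "cnj (fc H k) = cnj (fc G k)" by (rule Re_mult_all_eqD)
      then show "fc H k = fc G k" by simp
    qed
  qed
  then show ?thesis by (simp add: G)
qed

section \<open>Existence of strong solutions\<close>

lemma jac_add_left:
  assumes "hs 4 X" "hs 4 Y" "hs 2 a"
  shows "jac (\<lambda>k. X k + Y k) a k = jac X a k + jac Y a k"
proof -
  have "(\<Sum>\<^sub>\<infinity>l. of_real (sg k l) * (X (k - l) + Y (k - l)) * a l)
      = (\<Sum>\<^sub>\<infinity>l. of_real (sg k l) * X (k - l) * a l + of_real (sg k l) * Y (k - l) * a l)"
    by (simp add: algebra_simps)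
  also have "\<dots> = (\<Sum>\<^sub>\<infinity>l. of_real (sg k l) * X (k - l) * a l) + (\<Sum>\<^sub>\<infinity>l. of_real (sg k l) * Y (k - l) * a l)"
    by (intro infsum_add jac_summable assms)
  finally show ?thesis unfolding jac_def by (simp add: distrib_left)
qed

lemma jac_add_right:
  assumes "hs 4 X" "hs 2 a" "hs 2 b"
  shows "jac X (\<lambda>k. a k + b k) k = jac X a k + jac X b k"
proof -
  have "(\<Sum>\<^sub>\<infinity>l. of_real (sg k l) * X (k - l) * (a l + b l))
      = (\<Sum>\<^sub>\<infinity>l. of_real (sg k l) * X (k - l) * a l + of_real (sg k l) * X (k - l) * b l)"
    by (simp add: algebra_simps)
  also have "\<dots> = (\<Sum>\<^sub>\<infinity>l. of_real (sg k l) * X (k - l) * a l) + (\<Sum>\<^sub>\<infinity>l. of_real (sg k l) * X (k - l) * b l)"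
    by (intro infsum_add jac_summable assms)
  finally show ?thesis unfolding jac_def by (simp add: distrib_left)
qed

text \<open>Bilinearity: J(X, a) - J(Y, b) = J(X - Y, a) + J(Y, a - b). The norm of a is replaced by
  that of a - b plus that of b, so that only differences and the fixed limit point occur.\<close>

lemma jac_diff_l2:
  assumes X: "hs 4 X" "hs 4 Y" and a: "hs 2 a" "hs 2 b"
  shows "n2 (\<lambda>k. cmod (jac X a k - jac Y b k)) \<le> 4 * pi\<^sup>2 * latK *
    (nw 0 4 (\<lambda>k. X k - Y k) * (nw 0 2 (\<lambda>k. a k - b k) + nw 0 2 b) + nw 0 4 Y * nw 0 2 (\<lambda>k. a k - b k))"
proof -
  note d = hs_diff[OF X] hs_diff[OF a]
  have e: "jac X a k - jac Y b k = jac (\<lambda>k. X k - Y k) a k + jac Y (\<lambda>k. a k - b k) k" for k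
    using jac_add_left[OF d(1) X(2) a(1), of k] jac_add_right[OF X(2) d(2) a(2), of k] by simp
  have n: "nw 0 2 a \<le> nw 0 2 (\<lambda>k. a k - b k) + nw 0 2 b"
    using nw_add_le[OF d(2) a(2) order_refl] by simp
  have l: "l2 (\<lambda>k. cmod (jac (\<lambda>k. X k - Y k) a k) + cmod (jac Y (\<lambda>k. a k - b k) k))"
    by (intro l2_add jac_l2 d X a)
  have "n2 (\<lambda>k. cmod (jac X a k - jac Y b k)) \<le> n2 (\<lambda>k. cmod (jac (\<lambda>k. X k - Y k) a k) + cmod (jac Y (\<lambda>k. a k - b k) k))"
    by (rule l2_mono(2)[OF l]) (simp add: e norm_triangle_ineq)
  also have "\<dots> \<le> n2 (\<lambda>k. cmod (jac (\<lambda>k. X k - Y k) a k)) + n2 (\<lambda>k. cmod (jac Y (\<lambda>k. a k - b k) k))"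
    by (intro l2_add jac_l2 d X a)
  also have "\<dots> \<le> 4 * pi\<^sup>2 * latK * (nw 0 4 (\<lambda>k. X k - Y k) * nw 0 2 a) + 4 * pi\<^sup>2 * latK * (nw 0 4 Y * nw 0 2 (\<lambda>k. a k - b k))"
    by (intro add_mono jac_l2 d X a)
  also have "\<dots> = 4 * pi\<^sup>2 * latK * (nw 0 4 (\<lambda>k. X k - Y k) * nw 0 2 a + nw 0 4 Y * nw 0 2 (\<lambda>k. a k - b k))"
    by (simp only: distrib_left)
  also have "\<dots> \<le> 4 * pi\<^sup>2 * latK * (nw 0 4 (\<lambda>k. X k - Y k) * (nw 0 2 (\<lambda>k. a k - b k) + nw 0 2 b) + nw 0 4 Y * nw 0 2 (\<lambda>k. a k - b k))"
    by (intro mult_left_mono add_right_mono n) auto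
  finally show ?thesis .
qed

lemma continuous_on_jac:
  fixes G :: "real \<Rightarrow> torus_L2"
  assumes G: "\<And>s k. s \<in> S \<Longrightarrow> fc (G s) k = - jac (X s) (a s) k"
    and h: "\<And>s. s \<in> S \<Longrightarrow> hs 4 (X s)" "\<And>s. s \<in> S \<Longrightarrow> hs 2 (a s)"
    and lim: "\<And>t. t \<in> S \<Longrightarrow> ((\<lambda>s. nw 0 4 (\<lambda>k. X s k - X t k)) \<longlongrightarrow> 0) (at t within S)"
      "\<And>t. t \<in> S \<Longrightarrow> ((\<lambda>s. nw 0 2 (\<lambda>k. a s k - a t k)) \<longlongrightarrow> 0) (at t within S)"
  shows "continuous_on S G"
  unfolding continuous_on_def
proof
  fix t assume t: "t \<in> S"
  let ?B = "\<lambda>s. 4 * pi\<^sup>2 * latK * (nw 0 4 (\<lambda>k. X s k - X t k) * (nw 0 2 (\<lambda>k. a s k - a t k) + nw 0 2 (a t)) + nw 0 4 (X t) * nw 0 2 (\<lambda>k. a s k - a t k))"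
  have "(?B \<longlongrightarrow> 4 * pi\<^sup>2 * latK * (0 * (0 + nw 0 2 (a t)) + nw 0 4 (X t) * 0)) (at t within S)"
    by (intro tendsto_intros lim t)
  then have B: "(?B \<longlongrightarrow> 0) (at t within S)" by simp
  have "norm (G s - G t) \<le> ?B s" if s: "s \<in> S" for s
  proof -
    have "norm (G s - G t) = n2 (\<lambda>k. cmod (jac (X s) (a s) k - jac (X t) (a t) k))"
      unfolding norm_eq_n2 fc_diff G[OF s] G[OF t] by (simp add: norm_minus_commute)
    then show ?thesis using jac_diff_l2[OF h(1)[OF s] h(1)[OF t] h(2)[OF s] h(2)[OF t]] by simp
  qed
  then have "((\<lambda>s. G s - G t) \<longlongrightarrow> 0) (at t within S)"
    by (intro Lim_null_comparison[OF _ B]) (auto simp: eventually_at_filter)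
  then show "(G \<longlongrightarrow> G t) (at t within S)" by (simp add: LIM_zero_iff)
qed

text \<open>Continuity provides the integral; the bounded functionals \<open>fc\<close> commute with
  it, so the scalar equations identify its coefficients and hence the integral.\<close>

lemma has_integral_of_fc:
  fixes G :: "real \<Rightarrow> torus_L2"
  assumes c: "continuous_on {a..b} G" and i: "\<And>k. ((\<lambda>s. fc (G s) k) has_integral fc v k) {a..b}"
  shows "(G has_integral v) {a..b}"
proof -
  have I: "(G has_integral integral {a..b} G) {a..b}"
    using integrable_continuous_interval[OF c] by (rule integrable_integral)
  have "integral {a..b} G = v"
  proof (rule fc_eqI)
    fix k
    have "((\<lambda>s. fc (G s) k) has_integral fc (integral {a..b} G) k) {a..b}"
      using has_integral_linear[OF I bounded_linear_fc[of k]] by (simp add: o_def)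
    then show "fc (integral {a..b} G) k = fc v k" by (rule has_integral_unique[OF _ i])
  qed
  then show ?thesis using I by simp
qed

lemma hs_imp_l2: "hs s a \<Longrightarrow> l2 (\<lambda>k. cmod (a k))"
  using hs_lower(1)[of s a 0] by (simp add: hs_def)

lemma (in tqg) nw_psi_diff:
  assumes "hs 2 w" "hs 2 w'" shows "nw 0 4 (\<lambda>k. psi w k - psi w' k) \<le> nw 0 2 (\<lambda>k. w k - w' k)"
proof -
  have d: "hs 2 (\<lambda>k. w k - w' k)" by (rule hs_diff[OF assms])
  \<comment> \<open>\<open>psi\<close> is affine with shift f; adding f back isolates its linear
    part.\<close>
  have "psi w k - psi w' k = psi (\<lambda>k. w k - w' k + f k) k" for k
    unfolding psi_def diff_divide_distrib[symmetric] by (simp add: algebra_simps)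
  then have c: "(mag k)\<^sup>2 * cmod (psi w k - psi w' k) \<le> cmod (w k - w' k)" for k
    using cmod_psi_le[of k "\<lambda>k. w k - w' k + f k"] by simp
  have "wt 0 4 k = wt 0 2 k * (mag k)\<^sup>2" for k
    by (simp add: wt_def power2_eq_square power4_eq_xxxx mult_ac)
  then have "\<bar>wt 0 4 k * cmod (psi w k - psi w' k)\<bar> \<le> \<bar>wt 0 2 k * cmod (w k - w' k)\<bar>" for k
    using mult_left_mono[OF c[of k], of "wt 0 2 k"] by (simp add: abs_mult mult.assoc)
  then show ?thesis unfolding nw_def by (rule l2_mono(2)[OF hs_l2_wt[OF d order_refl]])
qed

lemma perp_grad_coefficients:
  assumes "\<psi> \<in> sobolev 1"
  shows "fc (fst (perp_grad \<psi>)) k = - dy k * fc \<psi> k" "fc (snd (perp_grad \<psi>)) k = dx k * fc \<psi> k"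
  using fc_weak_deriv[OF assms, of 0 1] fc_weak_deriv[OF assms, of 1 0]
  by (simp_all add: perp_grad_def fc_minus dd_def)

text \<open>Both components of the velocity are given at order 3; since |k| \<le> |dx k| + |dy k|,
  the stream function has order 4.\<close>

lemma hs_stream:
  assumes "a 0 = 0" "hs 3 (\<lambda>k. dx k * a k)" "hs 3 (\<lambda>k. dy k * a k)"
  shows "hs 4 a"
  unfolding hs_def
proof
  have l: "l2 (\<lambda>k. mag k ^ 3 * cmod (dx k * a k) + mag k ^ 3 * cmod (dy k * a k))"
    using assms(2,3) by (intro l2_add) (auto simp: hs_def)
  show "l2 (\<lambda>k. mag k ^ 4 * cmod (a k))"
  proof (rule l2_mono(1)[OF l])
    fix k
    have "1 \<le> 2 * pi" using pi_gt3 by linarith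
    then have c: "\<bar>x\<bar> \<le> 2 * pi * \<bar>x\<bar>" for x :: real using mult_right_mono[of 1 "2 * pi" "\<bar>x\<bar>"] by simp
    have "mag k \<le> \<bar>real_of_int (fst k)\<bar> + \<bar>real_of_int (snd k)\<bar>"
      unfolding mag_def using norm_Pair_le[of "real_of_int (fst k)" "real_of_int (snd k)"] by simp
    also have "\<dots> \<le> cmod (dx k) + cmod (dy k)" unfolding cmod_dx by (intro add_mono c)
    finally have "mag k ^ 3 * (mag k * cmod (a k)) \<le> mag k ^ 3 * ((cmod (dx k) + cmod (dy k)) * cmod (a k))"
      by (intro mult_left_mono mult_right_mono) auto
    then show "\<bar>mag k ^ 4 * cmod (a k)\<bar> \<le> \<bar>mag k ^ 3 * cmod (dx k * a k) + mag k ^ 3 * cmod (dy k * a k)\<bar>"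
      by (simp add: norm_mult abs_mult distrib_left distrib_right eval_nat_numeral mult_ac)
  qed
qed (fact assms(1))

theorem theorem2p10:
  fixes h f b\<^sub>0 \<omega>\<^sub>0 :: torus_L2
    and u\<^sub>h :: "torus_L2 \<times> torus_L2"
  assumes "h \<in> sobolev 1" and "h \<in> mean_zero"
    and "u\<^sub>h = (1/2) *\<^sub>R perp_grad h"
    and "u\<^sub>h \<in> sobolev_div 3"
    and "f \<in> sobolev 2" and "f \<in> mean_zero"
    and "(b\<^sub>0, \<omega>\<^sub>0) \<in> state_space"
    and "b\<^sub>0 \<in> mean_zero" and "\<omega>\<^sub>0 \<in> mean_zero"
  shows "\<exists>T>0. \<exists>b \<omega>. local_strong_solution u\<^sub>h f b\<^sub>0 \<omega>\<^sub>0 b \<omega> T"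
proof -
  define \<xi> where "\<xi> k = (1 / 2) *\<^sub>R fc h k" for k
  have uh: "fc (fst u\<^sub>h) k = - dy k * \<xi> k" "fc (snd u\<^sub>h) k = dx k * \<xi> k" for k
    unfolding assms(3) \<xi>_def by (simp_all add: fc_scaleR perp_grad_coefficients[OF assms(1)])
  \<comment> \<open>The symbols \<open>dx\<close> and \<open>dy\<close> vanish at frequency 0, so a
    perpendicular gradient has zero average.\<close>
  have mz: "fst u\<^sub>h \<in> mean_zero" "snd u\<^sub>h \<in> mean_zero"
    unfolding fc_mean_zero uh by (simp_all add: dx_def dy_def)
  have us: "fst u\<^sub>h \<in> sobolev 3" "snd u\<^sub>h \<in> sobolev 3"
    using assms(4) by (auto simp: sobolev_div_def mem_Times_iff)
  have e: "fc (fst u\<^sub>h) = (\<lambda>k. - (dy k * \<xi> k))" "fc (snd u\<^sub>h) = (\<lambda>k. dx k * \<xi> k)" using uh by auto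
  have xi: "hs 4 \<xi>"
  proof (rule hs_stream)
    show "\<xi> 0 = 0" using assms(2) by (simp add: \<xi>_def fc_mean_zero)
    show "hs 3 (\<lambda>k. dx k * \<xi> k)" using sobolev_imp_hs[OF us(2) mz(2)] unfolding e .
    show "hs 3 (\<lambda>k. dy k * \<xi> k)" using hs_uminus(1)[OF sobolev_imp_hs[OF us(1) mz(1)]] unfolding e by simp
  qed
  have st: "b\<^sub>0 \<in> sobolev 3" "\<omega>\<^sub>0 \<in> sobolev 2" using assms(7) by (auto simp: state_space_def)
  interpret tqg "fc b\<^sub>0" "fc \<omega>\<^sub>0" "fc f" \<xi>
  proof
    show "hermitian \<xi>" unfolding hermitian_def \<xi>_def by (simp add: hermitianD[OF hermitian_fc])
  qed (intro sobolev_imp_hs st assms xi hermitian_fc)+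
  obtain vb vw where v:
    "\<And>t. t \<in> {0..T} \<Longrightarrow> hs 3 (vb t) \<and> hs 2 (vw t) \<and> hermitian (vb t) \<and> hermitian (vw t)"
    "\<And>t. t \<in> {0..T} \<Longrightarrow> ((\<lambda>s. nw 0 3 (\<lambda>k. vb s k - vb t k)) \<longlongrightarrow> 0) (at t within {0..T})"
    "\<And>t. t \<in> {0..T} \<Longrightarrow> ((\<lambda>s. nw 0 2 (\<lambda>k. vw s k - vw t k)) \<longlongrightarrow> 0) (at t within {0..T})"
    "\<And>t k. t \<in> {0..T} \<Longrightarrow> ((\<lambda>s. jac (psi (vw s)) (vb s) k) has_integral (vb t k - fc b\<^sub>0 k)) {0..t}"
    "\<And>t k. t \<in> {0..T} \<Longrightarrow> ((\<lambda>s. jac (psi (vw s)) (\<lambda>k. vw s k - vb s k) k + jac \<xi> (vb s) k) has_integral (vw t k - fc \<omega>\<^sub>0 k)) {0..t}"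
    by (rule coefficient_solution) (rule that)
  have h: "hs 3 (vb t)" "hs 2 (vb t)" "hs 2 (vw t)" "hermitian (vb t)" "hermitian (vw t)" if "t \<in> {0..T}" for t
    using v(1)[OF that] hs_lower(1)[of 3 "vb t" 2] by auto
  \<comment> \<open>Riesz-Fischer provides such a g for times in {0..T}; at other times the value is
    arbitrary.\<close>
  define b \<omega> where "b t = (SOME g. fc g = vb t)" and "\<omega> t = (SOME g. fc g = vw t)" for t
  have fcb: "fc (b t) = vb t" and fcw: "fc (\<omega> t) = vw t" if "t \<in> {0..T}" for t
    using someI_ex[of "\<lambda>g. fc g = vb t"] someI_ex[of "\<lambda>g. fc g = vw t"]
      Riesz_Fischer[OF h(4)[OF that] hs_imp_l2[OF h(1)[OF that]]] Riesz_Fischer[OF h(5)[OF that] hs_imp_l2[OF h(3)[OF that]]]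
    unfolding b_def \<omega>_def by blast+
  have hp: "hs 4 (psi (vw t))" if "t \<in> {0..T}" for t by (rule psi_bounds(1)[OF h(3)[OF that] order_refl])
  have vel: "fc (fst (velocity f (\<omega> t))) k = - dy k * psi (vw t) k" "fc (snd (velocity f (\<omega> t))) k = dx k * psi (vw t) k"
    if t: "t \<in> {0..T}" for t k
  proof -
    obtain \<psi> where \<psi>: "fc \<psi> = psi (vw t)"
      using Riesz_Fischer[OF hermitian_psi[OF h(5)[OF t]] hs_imp_l2[OF hp[OF t]]] by blast
    have s: "\<psi> \<in> sobolev 1" "\<psi> \<in> sobolev 2"
      using hs_lower(1)[OF hp[OF t]] by (auto intro!: hs_imp_sobolev simp: \<psi>)
    have "inv_helmholtz (\<omega> t - f) = \<psi>"
      by (rule inv_helmholtz[OF s(2)]) (simp only: \<psi> psi_def fc_diff fcw[OF t])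
    then show "fc (fst (velocity f (\<omega> t))) k = - dy k * psi (vw t) k" "fc (snd (velocity f (\<omega> t))) k = dx k * psi (vw t) k"
      unfolding velocity_def by (simp_all only: perp_grad_coefficients[OF s(1)] \<psi>)
  qed
  have fcd: "fc (\<omega> t - b t) = (\<lambda>k. vw t k - vb t k)" if "t \<in> {0..T}" for t
    by (simp add: fun_eq_iff fc_diff fcb[OF that] fcw[OF that])
  let ?G1 = "\<lambda>\<tau>. weak_div (flux (b \<tau>) (velocity f (\<omega> \<tau>)))"
  let ?G2 = "\<lambda>\<tau>. weak_div (flux (\<omega> \<tau> - b \<tau>) (velocity f (\<omega> \<tau>)))"
  let ?G3 = "\<lambda>\<tau>. weak_div (flux (b \<tau>) u\<^sub>h)"
  have hd: "hs 2 (\<lambda>k. vw t k - vb t k)" if "t \<in> {0..T}" for t by (intro hs_diff h that)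
  have G1: "fc (?G1 t) k = - jac (psi (vw t)) (vb t) k" if "t \<in> {0..T}" for t k
    using weak_div_flux[of "b t" "psi (vw t)" "velocity f (\<omega> t)", OF _ hp[OF that] vel[OF that]] h[OF that] by (simp add: fcb[OF that])
  have G2: "fc (?G2 t) k = - jac (psi (vw t)) (\<lambda>k. vw t k - vb t k) k" if "t \<in> {0..T}" for t k
    using weak_div_flux[of "\<omega> t - b t" "psi (vw t)" "velocity f (\<omega> t)", OF _ hp[OF that] vel[OF that]] hd[OF that]
    by (simp add: fcd[OF that])
  have G3: "fc (?G3 t) k = - jac \<xi> (vb t) k" if "t \<in> {0..T}" for t k
    using weak_div_flux[of "b t" \<xi> u\<^sub>h, OF _ xi uh] h[OF that] by (simp add: fcb[OF that])
  have evT: "eventually (\<lambda>s. s \<in> {0..T}) (at t within {0..T})" for t by (auto simp: eventually_at_filter)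
  have cb: "((\<lambda>s. nw 0 2 (\<lambda>k. vb s k - vb t k)) \<longlongrightarrow> 0) (at t within {0..T})" if t: "t \<in> {0..T}" for t
  proof (rule tendsto_sandwich[OF _ _ tendsto_const v(2)[OF t]])
    have "nw 0 2 (\<lambda>k. vb s k - vb t k) \<le> nw 0 3 (\<lambda>k. vb s k - vb t k)" if s: "s \<in> {0..T}" for s
      using hs_lower(2)[OF hs_diff[OF h(1)[OF s] h(1)[OF t]], of 2] by simp
    then show "\<forall>\<^sub>F s in at t within {0..T}. nw 0 2 (\<lambda>k. vb s k - vb t k) \<le> nw 0 3 (\<lambda>k. vb s k - vb t k)"
      using evT[of t] by (auto elim: eventually_mono)
  qed simp
  have cp: "((\<lambda>s. nw 0 4 (\<lambda>k. psi (vw s) k - psi (vw t) k)) \<longlongrightarrow> 0) (at t within {0..T})" if t: "t \<in> {0..T}" for t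
  proof (rule tendsto_sandwich[OF _ _ tendsto_const v(3)[OF t]])
    show "\<forall>\<^sub>F s in at t within {0..T}. nw 0 4 (\<lambda>k. psi (vw s) k - psi (vw t) k) \<le> nw 0 2 (\<lambda>k. vw s k - vw t k)"
      using evT[of t] nw_psi_diff[OF h(3) h(3)[OF t]] by (auto elim: eventually_mono)
  qed simp
  have cd: "((\<lambda>s. nw 0 2 (\<lambda>k. (vw s k - vb s k) - (vw t k - vb t k))) \<longlongrightarrow> 0) (at t within {0..T})" if t: "t \<in> {0..T}" for t
  proof (rule tendsto_sandwich[OF _ _ tendsto_const])
    show "((\<lambda>s. nw 0 2 (\<lambda>k. vw s k - vw t k) + nw 0 2 (\<lambda>k. vb s k - vb t k)) \<longlongrightarrow> 0) (at t within {0..T})"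
      using tendsto_add[OF v(3)[OF t] cb[OF t]] by simp
    have "nw 0 2 (\<lambda>k. (vw s k - vb s k) - (vw t k - vb t k)) \<le> nw 0 2 (\<lambda>k. vw s k - vw t k) + nw 0 2 (\<lambda>k. vb s k - vb t k)"
      if s: "s \<in> {0..T}" for s
      using nw_diff_le[OF hs_diff[OF h(3)[OF s] h(3)[OF t]] hs_diff[OF h(2)[OF s] h(2)[OF t]] order_refl]
      by (simp add: algebra_simps)
    then show "\<forall>\<^sub>F s in at t within {0..T}. nw 0 2 (\<lambda>k. (vw s k - vb s k) - (vw t k - vb t k)) \<le> nw 0 2 (\<lambda>k. vw s k - vw t k) + nw 0 2 (\<lambda>k. vb s k - vb t k)"
      using evT[of t] by (auto elim: eventually_mono)
  qed simp
  have C1: "continuous_on {0..T} ?G1"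
    by (rule continuous_on_jac[where X = "\<lambda>s. psi (vw s)" and a = vb, OF G1 hp h(2) cp cb])
  have C2: "continuous_on {0..T} ?G2"
    by (rule continuous_on_jac[where X = "\<lambda>s. psi (vw s)" and a = "\<lambda>s k. vw s k - vb s k", OF G2 hp hd cp cd])
  have C3: "continuous_on {0..T} ?G3"
  proof (rule continuous_on_jac[where X = "\<lambda>s. \<xi>" and a = vb, OF G3 xi h(2) _ cb])
    have "nw 0 4 (\<lambda>k. \<xi> k - \<xi> k) = 0" by (simp add: nw_def)
    then show "((\<lambda>s. nw 0 4 (\<lambda>k. \<xi> k - \<xi> k)) \<longlongrightarrow> 0) (at t within {0..T})" for t
      by (simp only: tendsto_const)
  qed
  have sub: "{0..t} \<subseteq> {0..T}" if "t \<in> {0..T}" for t using that by auto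
  have I1: "(?G1 has_integral (b\<^sub>0 - b t)) {0..t}" if t: "t \<in> {0..T}" for t
  proof (rule has_integral_of_fc)
    show "continuous_on {0..t} ?G1" by (rule continuous_on_subset[OF C1 sub[OF t]])
    fix k
    \<comment> \<open>The minus sign of \<open>weak_div_flux\<close> matches the order
      \<open>b\<^sub>0 - b t\<close> in the definition of a solution.\<close>
    have "((\<lambda>s. - jac (psi (vw s)) (vb s) k) has_integral - (vb t k - fc b\<^sub>0 k)) {0..t}"
      by (rule has_integral_neg[OF v(4)[OF t]])
    then have "((\<lambda>s. fc (?G1 s) k) has_integral - (vb t k - fc b\<^sub>0 k)) {0..t}"
      by (rule has_integral_eq[rotated]) (use sub[OF t] in \<open>auto simp: G1\<close>)
    then show "((\<lambda>s. fc (?G1 s) k) has_integral fc (b\<^sub>0 - b t) k) {0..t}"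
      by (simp add: fc_diff fcb[OF t])
  qed
  have I2: "((\<lambda>\<tau>. ?G2 \<tau> + ?G3 \<tau>) has_integral (\<omega>\<^sub>0 - \<omega> t)) {0..t}" if t: "t \<in> {0..T}" for t
  proof (rule has_integral_of_fc)
    show "continuous_on {0..t} (\<lambda>\<tau>. ?G2 \<tau> + ?G3 \<tau>)"
      by (rule continuous_on_subset[OF continuous_on_add[OF C2 C3] sub[OF t]])
    fix k
    have "((\<lambda>s. - (jac (psi (vw s)) (\<lambda>k. vw s k - vb s k) k + jac \<xi> (vb s) k)) has_integral - (vw t k - fc \<omega>\<^sub>0 k)) {0..t}"
      by (rule has_integral_neg[OF v(5)[OF t]])
    then have "((\<lambda>s. fc (?G2 s + ?G3 s) k) has_integral - (vw t k - fc \<omega>\<^sub>0 k)) {0..t}"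
      by (rule has_integral_eq[rotated]) (use sub[OF t] in \<open>auto simp: G2 G3 fc_add\<close>)
    then show "((\<lambda>s. fc (?G2 s + ?G3 s) k) has_integral fc (\<omega>\<^sub>0 - \<omega> t) k) {0..t}"
      by (simp add: fc_diff fcw[OF t])
  qed
  have "local_strong_solution u\<^sub>h f b\<^sub>0 \<omega>\<^sub>0 b \<omega> T"
    unfolding local_strong_solution_def
  proof (intro conjI ballI)
    show "0 < T" by (rule T_pos)
    show "continuous_into_sobolev 3 T b"
      by (rule continuous_into_sobolevI)
        (simp_all add: fcb h, rule Lim_transform_eventually[OF v(2)], simp, use evT in \<open>eventually_elim, simp add: fcb\<close>)
    show "continuous_into_sobolev 2 T \<omega>"
      by (rule continuous_into_sobolevI)
        (simp_all add: fcw h, rule Lim_transform_eventually[OF v(3)], simp, use evT in \<open>eventually_elim, simp add: fcw\<close>)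
    fix t assume t: "t \<in> {0..T}"
    show "b t \<in> mean_zero" using hs_imp_mean_zero[of 3 "b t"] h[OF t] fcb[OF t] by simp
    show "\<omega> t \<in> mean_zero" using hs_imp_mean_zero[of 2 "\<omega> t"] h[OF t] fcw[OF t] by simp
    show "(?G1 has_integral (b\<^sub>0 - b t)) {0..t}" by (rule I1[OF t])
    show "((\<lambda>\<tau>. ?G2 \<tau> + ?G3 \<tau>) has_integral (\<omega>\<^sub>0 - \<omega> t)) {0..t}" by (rule I2[OF t])
  qed
  then show ?thesis using T_pos by blast
qed

end
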